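(* Let $(\mathcal{H},d)$ be a separable full Hilbert-Hadamard space and let $(T,\mathsf{T},\tau)$ be a complete and separable probability space. Let $f:T\times\mathcal{H}\to(-\infty,+\infty]$ be a proper normal convex integrand. Suppose that $f$ is $L^2$-Lipschitz and that there exists $u_0\in L^2(T,\mathcal{H},\tau)$ such that $f(\cdot,u_0(\cdot))\in L^1(T,\mathbb{R},\tau)$. Then for any $x\in\mathcal{H}$: \[ \int\partial f(t,x)\,d\tau(t)=\partial\left(\int f(t,\cdot)\,d\tau(t)\right)(x). \]
   Context: A geodesic in a metric space $(\mathcal{H},d)$ is an isometric embedding $\gamma:[0,l]\to\mathcal{H}$; it issues from $\gamma(0)$. A Hadamard space is a complete metric space in which any two points are joined by a geodesic and such that $d^2(\gamma(tl),x)\le(1-t)d^2(\gamma(0),x)+td^2(\gamma(l),x)-t(1-t)d^2(\gamma(0),\gamma(l))$ for all $x\in\mathcal{H}$, $t\in[0,1]$ and geodesics $\gamma:[0,l]\to\mathcal{H}$. Geodesics are unique; $\gamma_{x,y}$ is the geodesic from $x$ to $y$. Convexity of functions means convexity along geodesics. Tangent cones: for nonconstant geodesics $\gamma,\eta$ issuing from $x$, $\angle_x(\gamma,\eta)=\lim_{s,t\to0^+}\bar\angle_x(\gamma(s),\eta(t))$, where $\bar\angle_x(y,z)$ is the angle at $\bar x$ of the Euclidean comparison triangle of $x,y,z$. Let $\Sigma'_x\mathcal{H}$ be the metric space of classes (angle $0$) of such geodesics and $\Sigma_x\mathcal{H}$ its completion. $T_x\mathcal{H}$ is the Euclidean cone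 over $\Sigma_x\mathcal{H}$: the classes $t\gamma$ of pairs $(\gamma,t)\in\Sigma_x\mathcal{H}\times[0,\infty)$ (all pairs with $t=0$ identified to $0_x$), with metric $d_x(t\gamma,s\eta)=\sqrt{t^2+s^2-2ts\cos\angle_x(\gamma,\eta)}$, which is itself a Hadamard space (separable if $\mathcal{H}$ is). Write $g_x(t\gamma,s\eta)=ts\cos\angle_x(\gamma,\eta)$ and $\log_xa:=d(x,a)\gamma_{x,a}$ for $a\ne x$, $\log_xx:=0_x$. A full Hilbert-Hadamard space is a Hadamard space such that every tangent cone is isometric to a Hilbert space. A probability space is separable if $\mathsf{T}$ with the (pseudo)metric $d_\tau(A,B)=\tau(A\triangle B)$ is separable. $L^2(T,\mathcal{H},\tau)$ is the space of (a.e. classes of) measurable $u:T\to\mathcal{H}$ with $\int d^2(u,z)\,d\tau<\infty$ for some/any $z\in\mathcal{H}$. $f$ is a normal integrand if $f(t,\cdot)$ is lower-semicontinuous for all $t$ and the set-valued map $t\mapsto\{(x,\alpha)\in\mathcal{H}\times\mathbb{R}\mid f(t,x)\le\alpha\}$ is measurable (for every closed $C$, the set of $t$ whose image meets $C$ is in $\mathsf{T}$); on a complete space the measurability can equivalently be replaced by $\mathsf{T}\otimes\mathsf{B}(\mathcal{H})$-measurability of $f$. It is a normal convex integrand if moreover every $f(t,\cdot)$ is convex, and proper if every $f(t,\cdot)$ is proper. $f$ is $L^2$-Lipschitz if there is $L\in L^2(T,(0,\infty),\tau)$ with $|f(t,x)-f(t,y)|\le L(t)d(x,y)$ for all $x,y\in\mathcal{H}$,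 $t\in T$. Subdifferentials: for $h:\mathcal{H}\to(-\infty,+\infty]$, $\partial h(x):=\{u\in T_x\mathcal{H}\mid h(y)\ge h(x)+g_x(u,\log_xy)\text{ for all }y\in\mathcal{H}\}$, and $\partial f(t,x):=\partial(f(t,\cdot))(x)$. The integral of a measurable $\phi:T\to T_x\mathcal{H}$ with $\int d_x(\phi,0_x)\,d\tau<\infty$ is the barycenter $\int\phi\,d\tau:=\mathrm{argmin}_{z\in T_x\mathcal{H}}\int(d_x^2(z,\phi)-d_x^2(y,\phi))\,d\tau$ (unique, independent of $y$; the Bochner integral if $T_x\mathcal{H}$ is a Hilbert space). The left-hand side of the claim is the Aumann integral $\{\int\phi\,d\tau\mid\phi:T\to T_x\mathcal{H}\text{ measurable and integrable with }\phi(t)\in\partial f(t,x)\text{ for all }t\in T\}$. *)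

theory Defs
  imports "HOL-Probability.Probability"
begin

section \<open>Hadamard spaces\<close>

text \<open>A geodesic \<open>\<gamma> : [0,l] \<rightarrow> \<H>\<close> is a pair \<open>(l, \<gamma>)\<close>; the values of \<open>\<gamma>\<close> outside
  \<open>{0..l}\<close> are irrelevant.\<close>

definition geodesic :: "real \<Rightarrow> (real \<Rightarrow> 'a::metric_space) \<Rightarrow> bool" where
  "geodesic l \<gamma> \<longleftrightarrow> 0 \<le> l \<and> (\<forall>s\<in>{0..l}. \<forall>t\<in>{0..l}. dist (\<gamma> s) (\<gamma> t) = \<bar>s - t\<bar>)"

text \<open>Completeness is part of the sort. A separable Hadamard space is one on a type of sort
  \<^class>\<open>polish_space\<close>: for metric spaces, separability and second countability coincide.\<close>

definition hadamard_space :: "'a::complete_space itself \<Rightarrow> bool" where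
  "hadamard_space _ \<longleftrightarrow>
     (\<forall>x y :: 'a. \<exists>l \<gamma>. geodesic l \<gamma> \<and> \<gamma> 0 = x \<and> \<gamma> l = y) \<and>
     (\<forall>(x :: 'a) l \<gamma> t. geodesic l \<gamma> \<longrightarrow> 0 \<le> t \<longrightarrow> t \<le> 1 \<longrightarrow>
        (dist (\<gamma> (t * l)) x)\<^sup>2 \<le> (1 - t) * (dist (\<gamma> 0) x)\<^sup>2 + t * (dist (\<gamma> l) x)\<^sup>2
          - t * (1 - t) * (dist (\<gamma> 0) (\<gamma> l))\<^sup>2)"

definition convex_along_geodesics :: "('a::metric_space \<Rightarrow> ereal) \<Rightarrow> bool" where
  "convex_along_geodesics h \<longleftrightarrow> (\<forall>l \<gamma> t. geodesic l \<gamma> \<longrightarrow> 0 \<le> t \<longrightarrow> t \<le> 1 \<longrightarrow>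
     h (\<gamma> (t * l)) \<le> ereal (1 - t) * h (\<gamma> 0) + ereal t * h (\<gamma> l))"

section \<open>Metrics on a carrier: quotient and completion\<close>

text \<open>The locale \<^locale>\<open>Metric_space\<close> requires nonnegativity and symmetry of the distance on the
  whole type. The distances below are meaningful on their carrier only, hence the following
  notions, which do not refer to points outside the carrier.\<close>

definition cauchy_seqs :: "'a set \<Rightarrow> ('a \<Rightarrow> 'a \<Rightarrow> real) \<Rightarrow> (nat \<Rightarrow> 'a) set" where
  "cauchy_seqs M d = {\<sigma>. range \<sigma> \<subseteq> M \<and> (\<forall>\<epsilon>>0. \<exists>N. \<forall>m\<ge>N. \<forall>n\<ge>N. d (\<sigma> m) (\<sigma> n) < \<epsilon>)}"

definition complete_on :: "'a set \<Rightarrow> ('a \<Rightarrow> 'a \<Rightarrow> real) \<Rightarrow> bool" where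
  "complete_on M d \<longleftrightarrow> (\<forall>\<sigma>\<in>cauchy_seqs M d. \<exists>a\<in>M. (\<lambda>n. d (\<sigma> n) a) \<longlonglongrightarrow> 0)"

definition open_sets_on :: "'a set \<Rightarrow> ('a \<Rightarrow> 'a \<Rightarrow> real) \<Rightarrow> 'a set set" where
  "open_sets_on M d = {U. U \<subseteq> M \<and> (\<forall>a\<in>U. \<exists>\<epsilon>>0. \<forall>b\<in>M. d a b < \<epsilon> \<longrightarrow> b \<in> U)}"

text \<open>The metric space of classes at distance zero of a pseudometric space \<open>(M, d)\<close>.\<close>

definition zero_dist_rel :: "'a set \<Rightarrow> ('a \<Rightarrow> 'a \<Rightarrow> real) \<Rightarrow> ('a \<times> 'a) set" where
  "zero_dist_rel M d = {(a, b). a \<in> M \<and> b \<in> M \<and> d a b = 0}"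

definition quot_space :: "'a set \<Rightarrow> ('a \<Rightarrow> 'a \<Rightarrow> real) \<Rightarrow> 'a set set" where
  "quot_space M d = M // zero_dist_rel M d"

definition quot_class :: "'a set \<Rightarrow> ('a \<Rightarrow> 'a \<Rightarrow> real) \<Rightarrow> 'a \<Rightarrow> 'a set" where
  "quot_class M d a = zero_dist_rel M d `` {a}"

definition quot_dist :: "('a \<Rightarrow> 'a \<Rightarrow> real) \<Rightarrow> 'a set \<Rightarrow> 'a set \<Rightarrow> real" where
  "quot_dist d A B = d (SOME a. a \<in> A) (SOME b. b \<in> B)"

text \<open>The completion consists of Cauchy sequences modulo the limit of their distance; a point
  is embedded as the class of its constant sequence.\<close>

definition lim_dist :: "('a \<Rightarrow> 'a \<Rightarrow> real) \<Rightarrow> (nat \<Rightarrow> 'a) \<Rightarrow> (nat \<Rightarrow> 'a) \<Rightarrow> real" where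
  "lim_dist d \<sigma> \<rho> = lim (\<lambda>n. d (\<sigma> n) (\<rho> n))"

definition completion_space :: "'a set \<Rightarrow> ('a \<Rightarrow> 'a \<Rightarrow> real) \<Rightarrow> (nat \<Rightarrow> 'a) set set" where
  "completion_space M d = quot_space (cauchy_seqs M d) (lim_dist d)"

definition completion_dist ::
  "('a \<Rightarrow> 'a \<Rightarrow> real) \<Rightarrow> (nat \<Rightarrow> 'a) set \<Rightarrow> (nat \<Rightarrow> 'a) set \<Rightarrow> real" where
  "completion_dist d = quot_dist (lim_dist d)"

definition completion_embed ::
  "'a set \<Rightarrow> ('a \<Rightarrow> 'a \<Rightarrow> real) \<Rightarrow> 'a \<Rightarrow> (nat \<Rightarrow> 'a) set" where
  "completion_embed M d a = quot_class (cauchy_seqs M d) (lim_dist d) (\<lambda>_. a)"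

section \<open>Angles and tangent cones\<close>

text \<open>The angle at the vertex corresponding to \<open>x\<close> of a Euclidean triangle with the side lengths
  of \<open>x, y, z\<close>, given by the law of cosines; see \<open>comparison_angle_euclidean\<close>.\<close>

definition comparison_angle :: "'a::metric_space \<Rightarrow> 'a \<Rightarrow> 'a \<Rightarrow> real" where
  "comparison_angle x y z =
     arccos (((dist x y)\<^sup>2 + (dist x z)\<^sup>2 - (dist y z)\<^sup>2) / (2 * dist x y * dist x z))"

lemma comparison_angle_euclidean:
  fixes x y z :: "'a::metric_space" and a b c :: "real^2"
  assumes "dist a b = dist x y" "dist a c = dist x z" "dist b c = dist y z"
  shows "comparison_angle x y z = arccos (((b - a) \<bullet> (c - a)) / (norm (b - a) * norm (c - a)))"
proof -
  have "(dist b c)\<^sup>2 = (dist a b)\<^sup>2 + (dist a c)\<^sup>2 - 2 * ((b - a) \<bullet> (c - a))"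
    by (simp add: dist_norm power2_norm_eq_inner inner_diff inner_commute algebra_simps)
  moreover have "dist a b = norm (b - a)" "dist a c = norm (c - a)"
    by (simp_all add: dist_norm norm_minus_commute)
  ultimately show ?thesis
    unfolding comparison_angle_def assms[symmetric] by simp
qed

definition geodesics_from :: "'a::metric_space \<Rightarrow> (real \<times> (real \<Rightarrow> 'a)) set" where
  "geodesics_from x = {(l, \<gamma>). 0 < l \<and> geodesic l \<gamma> \<and> \<gamma> 0 = x}"

definition geod_angle ::
  "'a::metric_space \<Rightarrow> real \<times> (real \<Rightarrow> 'a) \<Rightarrow> real \<times> (real \<Rightarrow> 'a) \<Rightarrow> real" where
  "geod_angle x p q =
     Lim (at_right 0 \<times>\<^sub>F at_right 0) (\<lambda>(s, t). comparison_angle x (snd p s) (snd q t))"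

definition pre_directions :: "'a::metric_space \<Rightarrow> (real \<times> (real \<Rightarrow> 'a)) set set" where
  "pre_directions x = quot_space (geodesics_from x) (geod_angle x)"

definition pre_angle ::
  "'a::metric_space \<Rightarrow> (real \<times> (real \<Rightarrow> 'a)) set \<Rightarrow> (real \<times> (real \<Rightarrow> 'a)) set \<Rightarrow> real" where
  "pre_angle x = quot_dist (geod_angle x)"

type_synonym 'a direction = "(nat \<Rightarrow> (real \<times> (real \<Rightarrow> 'a)) set) set"

definition directions :: "'a::metric_space \<Rightarrow> 'a direction set" where
  "directions x = completion_space (pre_directions x) (pre_angle x)"

definition angle :: "'a::metric_space \<Rightarrow> 'a direction \<Rightarrow> 'a direction \<Rightarrow> real" where
  "angle x = completion_dist (pre_angle x)"

text \<open>In the Euclidean cone, \<open>None\<close> is the apex \<open>0\<^sub>x\<close> (the class of all pairs with \<open>t = 0\<close>) and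
  \<open>Some (\<xi>, t)\<close> with \<open>t > 0\<close> is the element \<open>t\<xi>\<close>. The apex is present also if there are no
  directions, i.e. if the space is a single point.\<close>

type_synonym 'a tangent = "('a direction \<times> real) option"

definition tangent_cone :: "'a::metric_space \<Rightarrow> 'a tangent set" where
  "tangent_cone x = insert None (Some ` (directions x \<times> {0<..}))"

definition radius :: "'a tangent \<Rightarrow> real" where
  "radius u = (case u of None \<Rightarrow> 0 | Some (\<xi>, t) \<Rightarrow> t)"

definition tangent_inner :: "'a::metric_space \<Rightarrow> 'a tangent \<Rightarrow> 'a tangent \<Rightarrow> real" where
  "tangent_inner x u v = (case (u, v) of
     (Some (\<xi>, t), Some (\<zeta>, s)) \<Rightarrow> t * s * cos (angle x \<xi> \<zeta>) | _ \<Rightarrow> 0)"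

definition tangent_dist :: "'a::metric_space \<Rightarrow> 'a tangent \<Rightarrow> 'a tangent \<Rightarrow> real" where
  "tangent_dist x u v = sqrt ((radius u)\<^sup>2 + (radius v)\<^sup>2 - 2 * tangent_inner x u v)"

definition geodesic_between :: "'a::metric_space \<Rightarrow> 'a \<Rightarrow> real \<times> (real \<Rightarrow> 'a)" where
  "geodesic_between x y = (SOME (l, \<gamma>). geodesic l \<gamma> \<and> \<gamma> 0 = x \<and> \<gamma> l = y)"

definition log_map :: "'a::metric_space \<Rightarrow> 'a \<Rightarrow> 'a tangent" where
  "log_map x a = (if a = x then None else
     Some (completion_embed (pre_directions x) (pre_angle x)
             (quot_class (geodesics_from x) (geod_angle x) (geodesic_between x a)),
           dist x a))"

section \<open>Full Hilbert-Hadamard spaces\<close>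

text \<open>A real Hilbert space on a carrier set. A carrier is needed because the Hilbert space
  isometric to a tangent cone may depend on the base point.\<close>

locale hilbert_space_on =
  fixes V :: "'v set" and add :: "'v \<Rightarrow> 'v \<Rightarrow> 'v" and zero :: 'v
    and scale :: "real \<Rightarrow> 'v \<Rightarrow> 'v" and ip :: "'v \<Rightarrow> 'v \<Rightarrow> real"
  assumes add_closed: "v \<in> V \<Longrightarrow> w \<in> V \<Longrightarrow> add v w \<in> V"
    and zero_closed: "zero \<in> V"
    and scale_closed: "v \<in> V \<Longrightarrow> scale r v \<in> V"
    and add_assoc: "u \<in> V \<Longrightarrow> v \<in> V \<Longrightarrow> w \<in> V \<Longrightarrow> add (add u v) w = add u (add v w)"
    and add_commute: "v \<in> V \<Longrightarrow> w \<in> V \<Longrightarrow> add v w = add w v"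
    and add_zero: "v \<in> V \<Longrightarrow> add zero v = v"
    and add_neg: "v \<in> V \<Longrightarrow> add v (scale (-1) v) = zero"
    and scale_one: "v \<in> V \<Longrightarrow> scale 1 v = v"
    and scale_scale: "v \<in> V \<Longrightarrow> scale r (scale s v) = scale (r * s) v"
    and scale_add_left: "v \<in> V \<Longrightarrow> scale (r + s) v = add (scale r v) (scale s v)"
    and scale_add_right: "v \<in> V \<Longrightarrow> w \<in> V \<Longrightarrow> scale r (add v w) = add (scale r v) (scale r w)"
    and ip_commute: "v \<in> V \<Longrightarrow> w \<in> V \<Longrightarrow> ip v w = ip w v"
    and ip_add: "u \<in> V \<Longrightarrow> v \<in> V \<Longrightarrow> w \<in> V \<Longrightarrow> ip (add u v) w = ip u w + ip v w"
    and ip_scale: "v \<in> V \<Longrightarrow> w \<in> V \<Longrightarrow> ip (scale r v) w = r * ip v w"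
    and ip_nonneg: "v \<in> V \<Longrightarrow> 0 \<le> ip v v"
    and ip_definite: "v \<in> V \<Longrightarrow> ip v v = 0 \<Longrightarrow> v = zero"
    and complete: "complete_on V
      (\<lambda>v w. sqrt (ip (add v (scale (-1) w)) (add v (scale (-1) w))))"

definition isometric_spaces ::
  "'a set \<Rightarrow> ('a \<Rightarrow> 'a \<Rightarrow> real) \<Rightarrow> 'b set \<Rightarrow> ('b \<Rightarrow> 'b \<Rightarrow> real) \<Rightarrow> bool" where
  "isometric_spaces M d N e \<longleftrightarrow>
     (\<exists>\<phi>. bij_betw \<phi> M N \<and> (\<forall>a\<in>M. \<forall>b\<in>M. e (\<phi> a) (\<phi> b) = d a b))"

text \<open>Taking the carrier of the Hilbert space in the type of \<open>M\<close> is no loss of generality: an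
  isometry transports any Hilbert space structure to \<open>M\<close> itself.\<close>

definition isometric_to_hilbert :: "'a set \<Rightarrow> ('a \<Rightarrow> 'a \<Rightarrow> real) \<Rightarrow> bool" where
  "isometric_to_hilbert M d \<longleftrightarrow>
     (\<exists>(V :: 'a set) add zero scale ip. hilbert_space_on V add zero scale ip \<and>
        isometric_spaces M d V
          (\<lambda>v w. sqrt (ip (add v (scale (-1) w)) (add v (scale (-1) w)))))"

definition full_hilbert_hadamard_space :: "'a::complete_space itself \<Rightarrow> bool" where
  "full_hilbert_hadamard_space A \<longleftrightarrow> hadamard_space A \<and>
     (\<forall>x :: 'a. isometric_to_hilbert (tangent_cone x) (tangent_dist x))"

section \<open>Integrands\<close>

definition separable_measure :: "'t measure \<Rightarrow> bool" where
  "separable_measure M \<longleftrightarrow> (\<exists>D \<subseteq> sets M. countable D \<and>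
     (\<forall>A\<in>sets M. \<forall>\<epsilon>>0. \<exists>B\<in>D. measure M (sym_diff A B) < \<epsilon>))"

definition L2_maps :: "'t measure \<Rightarrow> ('t \<Rightarrow> 'a::metric_space) set" where
  "L2_maps M = {u \<in> borel_measurable M. \<exists>z. integrable M (\<lambda>t. (dist (u t) z)\<^sup>2)}"

definition lsc :: "('a::topological_space \<Rightarrow> ereal) \<Rightarrow> bool" where
  "lsc h \<longleftrightarrow> (\<forall>x. h x \<le> Liminf (at x) h)"

definition normal_integrand :: "'t measure \<Rightarrow> ('t \<Rightarrow> 'a::metric_space \<Rightarrow> ereal) \<Rightarrow> bool" where
  "normal_integrand M f \<longleftrightarrow> (\<forall>t\<in>space M. lsc (f t)) \<and>
     (\<forall>C :: ('a \<times> real) set. closed C \<longrightarrow>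
        {t \<in> space M. {(x, \<alpha>). f t x \<le> ereal \<alpha>} \<inter> C \<noteq> {}} \<in> sets M)"

definition normal_convex_integrand ::
  "'t measure \<Rightarrow> ('t \<Rightarrow> 'a::metric_space \<Rightarrow> ereal) \<Rightarrow> bool" where
  "normal_convex_integrand M f \<longleftrightarrow>
     normal_integrand M f \<and> (\<forall>t\<in>space M. convex_along_geodesics (f t))"

definition proper_fun :: "('a \<Rightarrow> ereal) \<Rightarrow> bool" where
  "proper_fun h \<longleftrightarrow> (\<forall>x. h x \<noteq> -\<infinity>) \<and> (\<exists>x. h x \<noteq> \<infinity>)"

text \<open>Since \<open>\<bar>\<infinity> - r\<bar> = \<bar>\<infinity> - \<infinity>\<bar> = \<infinity>\<close> in \<^typ>\<open>ereal\<close>, the Lipschitz bound forces \<open>f\<close> to be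
  finite; for proper \<open>f\<close> this is automatic under any convention for \<open>\<infinity> - \<infinity>\<close>.\<close>

definition L2_Lipschitz :: "'t measure \<Rightarrow> ('t \<Rightarrow> 'a::metric_space \<Rightarrow> ereal) \<Rightarrow> bool" where
  "L2_Lipschitz M f \<longleftrightarrow> (\<exists>L :: 't \<Rightarrow> real. L \<in> L2_maps M \<and> (\<forall>t\<in>space M. 0 < L t) \<and>
     (\<forall>t\<in>space M. \<forall>x y. \<bar>f t x - f t y\<bar> \<le> ereal (L t * dist x y)))"

text \<open>Integral of an extended real function, with \<open>\<infinity> - \<infinity> = \<infinity>\<close>.\<close>

definition ereal_integral :: "'t measure \<Rightarrow> ('t \<Rightarrow> ereal) \<Rightarrow> ereal" where
  "ereal_integral M \<phi> =
     enn2ereal (\<integral>\<^sup>+ t. e2ennreal (\<phi> t) \<partial>M) - enn2ereal (\<integral>\<^sup>+ t. e2ennreal (- \<phi> t) \<partial>M)"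

definition L1_ereal :: "'t measure \<Rightarrow> ('t \<Rightarrow> ereal) \<Rightarrow> bool" where
  "L1_ereal M \<phi> \<longleftrightarrow> (AE t in M. \<bar>\<phi> t\<bar> \<noteq> \<infinity>) \<and> integrable M (\<lambda>t. real_of_ereal (\<phi> t))"

section \<open>Subdifferentials and the Aumann integral\<close>

definition subdifferential :: "('a::metric_space \<Rightarrow> ereal) \<Rightarrow> 'a \<Rightarrow> 'a tangent set" where
  "subdifferential h x =
     {u \<in> tangent_cone x. \<forall>y. h y \<ge> h x + ereal (tangent_inner x u (log_map x y))}"

definition tangent_borel :: "'a::metric_space \<Rightarrow> 'a tangent measure" where
  "tangent_borel x = sigma (tangent_cone x)
     (open_sets_on (tangent_cone x) (tangent_dist x))"

definition tangent_integrable ::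
  "'t measure \<Rightarrow> 'a::metric_space \<Rightarrow> ('t \<Rightarrow> 'a tangent) \<Rightarrow> bool" where
  "tangent_integrable M x \<phi> \<longleftrightarrow>
     \<phi> \<in> M \<rightarrow>\<^sub>M tangent_borel x \<and> integrable M (\<lambda>t. tangent_dist x (\<phi> t) None)"

text \<open>The barycenter; since it does not depend on the base point \<open>y\<close> in
  \<open>\<integral> d\<^sub>x\<^sup>2(z,\<phi>) - d\<^sub>x\<^sup>2(y,\<phi>) d\<tau>\<close>, that point is taken to be the apex.\<close>

definition tangent_integral ::
  "'t measure \<Rightarrow> 'a::metric_space \<Rightarrow> ('t \<Rightarrow> 'a tangent) \<Rightarrow> 'a tangent" where
  "tangent_integral M x \<phi> = arg_min_on
     (\<lambda>z. \<integral>t. ((tangent_dist x z (\<phi> t))\<^sup>2 - (tangent_dist x None (\<phi> t))\<^sup>2) \<partial>M) (tangent_cone x)"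

definition aumann_integral ::
  "'t measure \<Rightarrow> 'a::metric_space \<Rightarrow> ('t \<Rightarrow> 'a tangent set) \<Rightarrow> 'a tangent set" where
  "aumann_integral M x S =
     {tangent_integral M x \<phi> | \<phi>. tangent_integrable M x \<phi> \<and> (\<forall>t\<in>space M. \<phi> t \<in> S t)}"

end

(*
Write V for the tangent cone at x, which is a Hilbert space with inner product g. For a convex
L-Lipschitz function h, the directional derivative of h at x, defined on the dense set of the
r log y, extends to an L-Lipschitz function p on V. It is sublinear: log is nonexpansive, so the
rescaled logarithm of the midpoint of two points near x is an almost midpoint in V. A vector k is
a subgradient of h at x iff g(k,v) <= p(v) for all v, and for the integral of f(t,.) the derivative
is the integral of the p_t by dominated convergence. This reduces the claim to a theorem of Strassen:
if g(u,v) <= int p_t(v) for all v, then u is the integral of some phi with g(phi(t),.) <= p_t.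

For the latter, Hahn-Banach extends v |-> g(u,v) from the constants to a functional
l(w) <= int p_t(w(t)) on simple functions w : T -> V. By Radon-Nikodym, A |-> l(1_A v) has a density
phi_v(t) <= p_t(v), which for almost all t is additive in v on a countable dense subgroup of V and
hence, by Riesz, of the form g(phi(t),v).
*)

theory Submission
  imports Defs
begin

section \<open>Hilbert spaces on a carrier\<close>

text \<open>Only an isometry of the cone with some Hilbert space is given; bilinearity of
  \<open>tangent_inner\<close> is not. The linear structure is pulled back along the isometry,
  translated so that the apex becomes the zero; polarization then shows that the inner product of
  this structure is exactly \<open>tangent_inner\<close>. The selection must lie in the
  subdifferential for every t, while Radon-Nikodym yields identities only almost everywhere. Three
  things bridge this. The densities are built as p_t(v) minus something nonnegative, so they are
  dominated at every t. Additivity is requested only on a countable set, so a single null set is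
  exceptional, and there the selection is some subgradient given by Hahn-Banach and Riesz.
  Completeness of the measure keeps the patched selection measurable. Directions realized by
  geodesics are only dense in the cone and carry no linear structure. The derivative is therefore
  defined on the whole cone by one infimum: finiteness and Lipschitz continuity follow without an
  extension argument, and subadditivity can be tested on the terms of the infimum.\<close>

locale vector_space_on =
  fixes V :: "'v set" and add :: "'v \<Rightarrow> 'v \<Rightarrow> 'v" and zero :: 'v and scale :: "real \<Rightarrow> 'v \<Rightarrow> 'v"
  assumes add_closed: "v \<in> V \<Longrightarrow> w \<in> V \<Longrightarrow> add v w \<in> V"
    and zero_closed: "zero \<in> V"
    and scale_closed: "v \<in> V \<Longrightarrow> scale r v \<in> V"
    and add_assoc: "u \<in> V \<Longrightarrow> v \<in> V \<Longrightarrow> w \<in> V \<Longrightarrow> add (add u v) w = add u (add v w)"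
    and add_commute: "v \<in> V \<Longrightarrow> w \<in> V \<Longrightarrow> add v w = add w v"
    and add_zero: "v \<in> V \<Longrightarrow> add zero v = v"
    and add_neg: "v \<in> V \<Longrightarrow> add v (scale (-1) v) = zero"
    and scale_one: "v \<in> V \<Longrightarrow> scale 1 v = v"
    and scale_scale: "v \<in> V \<Longrightarrow> scale r (scale s v) = scale (r * s) v"
    and scale_add_left: "v \<in> V \<Longrightarrow> scale (r + s) v = add (scale r v) (scale s v)"
    and scale_add_right: "v \<in> V \<Longrightarrow> w \<in> V \<Longrightarrow> scale r (add v w) = add (scale r v) (scale r w)"
begin

lemma scale_zero_left: "v \<in> V \<Longrightarrow> scale 0 v = zero"
  using scale_add_left[of v 1 "-1"] scale_one add_neg by simp

lemma scale_zero_right: "scale r zero = zero"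
  using scale_scale[OF zero_closed, of r 0] scale_zero_left[OF zero_closed] by simp

lemma add_zero_right: "v \<in> V \<Longrightarrow> add v zero = v"
  using add_commute add_zero zero_closed by metis

lemma add_left_commute:
  "u \<in> V \<Longrightarrow> v \<in> V \<Longrightarrow> w \<in> V \<Longrightarrow> add u (add v w) = add v (add u w)"
  using add_assoc add_commute by metis

lemma add_middle_swap:
  assumes "a \<in> V" "b \<in> V" "c \<in> V" "d \<in> V"
  shows "add (add a b) (add c d) = add (add a c) (add b d)"
  using assms add_assoc add_left_commute add_closed by metis

lemma add_neg_cancel:
  "v \<in> V \<Longrightarrow> w \<in> V \<Longrightarrow> add (add v w) (scale (-1) w) = v"
  using add_assoc add_neg add_zero_right scale_closed by metis

lemma scale_neg_neg: "v \<in> V \<Longrightarrow> scale (-1) (scale (-1) v) = v"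
  by (simp add: scale_scale scale_one)

lemma add_neg_cancel2:
  "v \<in> V \<Longrightarrow> w \<in> V \<Longrightarrow> add (add v (scale (-1) w)) w = v"
  using add_neg_cancel[of v "scale (-1) w"] scale_neg_neg[of w] scale_closed[of w] by simp

end

section \<open>Norm, distance and Riesz representation on a carrier\<close>

context hilbert_space_on
begin

sublocale vector_space_on V add zero scale
  by unfold_locales
    (fact add_closed zero_closed scale_closed add_assoc add_commute add_zero add_neg scale_one
      scale_scale scale_add_left scale_add_right)+

definition nrm :: "'v \<Rightarrow> real" where "nrm v = sqrt (ip v v)"

definition dst :: "'v \<Rightarrow> 'v \<Rightarrow> real" where "dst v w = nrm (add v (scale (-1) w))"

lemmas closed = add_closed zero_closed scale_closed

lemma ip_add_right: "u \<in> V \<Longrightarrow> v \<in> V \<Longrightarrow> w \<in> V \<Longrightarrow> ip w (add u v) = ip w u + ip w v"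
  by (metis ip_add ip_commute add_closed)

lemma ip_scale_right: "v \<in> V \<Longrightarrow> w \<in> V \<Longrightarrow> ip w (scale r v) = r * ip w v"
  by (metis ip_scale ip_commute scale_closed)

lemma ip_zero [simp]: "w \<in> V \<Longrightarrow> ip zero w = 0" "w \<in> V \<Longrightarrow> ip w zero = 0"
  using ip_scale[of zero w 0] ip_scale_right[of zero w 0] scale_zero_left zero_closed by auto

lemmas ip_simps = closed ip_add ip_add_right ip_scale ip_scale_right

lemma nrm_nonneg [simp]: "v \<in> V \<Longrightarrow> 0 \<le> nrm v"
  by (simp add: nrm_def ip_nonneg)

lemma nrm_square: "v \<in> V \<Longrightarrow> (nrm v)\<^sup>2 = ip v v"
  by (simp add: nrm_def ip_nonneg)

lemma dst_nonneg [simp]: "v \<in> V \<Longrightarrow> w \<in> V \<Longrightarrow> 0 \<le> dst v w"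
  by (simp add: dst_def closed)

lemma dst_square: "v \<in> V \<Longrightarrow> w \<in> V \<Longrightarrow> (dst v w)\<^sup>2 = ip v v - 2 * ip v w + ip w w"
  by (simp add: dst_def nrm_square ip_simps ip_commute[of w v])

lemma dst_commute: "v \<in> V \<Longrightarrow> w \<in> V \<Longrightarrow> dst v w = dst w v"
  by (rule power2_eq_imp_eq) (simp_all add: dst_square ip_commute[of w v])

lemma dst_zero [simp]: "v \<in> V \<Longrightarrow> dst v zero = nrm v"
  by (rule power2_eq_imp_eq) (simp_all add: dst_square zero_closed nrm_square)

lemma dst_eq_zero: "v \<in> V \<Longrightarrow> w \<in> V \<Longrightarrow> dst v w = 0 \<Longrightarrow> v = w"
proof -
  assume vw: "v \<in> V" "w \<in> V" "dst v w = 0"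
  let ?u = "add v (scale (-1) w)"
  have "ip ?u ?u = 0" using vw nrm_square[of ?u] by (simp add: dst_def closed)
  then have "?u = zero" using ip_definite vw by (simp add: closed)
  then show "v = w" using add_neg_cancel2[of v w] vw add_zero by metis
qed

text \<open>Testing with z = v and z = w makes the squared distance vanish. This is the device for
  vector identities: after applying it, \<open>ip_simps\<close> leaves only arithmetic of real
  numbers.\<close>

lemma ip_ext:
  assumes "v \<in> V" "w \<in> V" "\<And>z. z \<in> V \<Longrightarrow> ip v z = ip w z"
  shows "v = w"
proof (rule dst_eq_zero)
  have "(dst v w)\<^sup>2 = 0"
    using assms(3)[of v] assms(3)[of w] assms(1,2) ip_commute[of v w] by (simp add: dst_square)
  then show "dst v w = 0" by simp
qed (use assms in auto)

lemma cauchy_schwarz: 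
  assumes "v \<in> V" "w \<in> V" shows "\<bar>ip v w\<bar> \<le> nrm v * nrm w"
proof (cases "ip w w = 0")
  case True
  then have "w = zero" using assms ip_definite by auto
  then show ?thesis using assms by simp
next
  case False
  then have pos: "ip w w > 0" using ip_nonneg[of w] assms by simp
  \<comment> \<open>The minimizer of the quadratic polynomial r \<mapsto> |v + r w|^2.\<close>
  define r where "r = - ip v w / ip w w"
  let ?u = "add v (scale r w)"
  have "0 \<le> ip ?u ?u" using assms by (intro ip_nonneg closed)
  also have "ip ?u ?u = ip v v + 2 * r * ip v w + r * (r * ip w w)"
    using assms by (simp add: ip_simps ip_commute[of w v] algebra_simps)
  also have "\<dots> = ip v v - (ip v w)\<^sup>2 / ip w w"
    using False by (simp add: r_def power2_eq_square)
  finally have "(ip v w)\<^sup>2 \<le> ip v v * ip w w" using pos by (simp add: field_simps)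
  also have "\<dots> = (nrm v * nrm w)\<^sup>2" using assms by (simp add: nrm_square power_mult_distrib)
  finally have "\<bar>ip v w\<bar>\<^sup>2 \<le> (nrm v * nrm w)\<^sup>2" by simp
  then show ?thesis using assms by (rule_tac power2_le_imp_le) simp_all
qed

lemma ip_le: "v \<in> V \<Longrightarrow> w \<in> V \<Longrightarrow> ip v w \<le> nrm v * nrm w"
  using cauchy_schwarz[of v w] by simp

lemma nrm_triangle: 
  assumes "v \<in> V" "w \<in> V" shows "nrm (add v w) \<le> nrm v + nrm w"
proof (rule power2_le_imp_le)
  show "(nrm (add v w))\<^sup>2 \<le> (nrm v + nrm w)\<^sup>2"
    using assms ip_le[of v w]
    by (simp add: nrm_square ip_simps power2_sum ip_commute[of w v])
qed (use assms in simp)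

lemma nrm_scale: "v \<in> V \<Longrightarrow> nrm (scale r v) = \<bar>r\<bar> * nrm v"
  by (simp add: nrm_def ip_simps real_sqrt_mult flip: mult.assoc)

lemma dst_scale: 
  assumes "v \<in> V" "w \<in> V" shows "dst (scale r v) (scale r w) = \<bar>r\<bar> * dst v w"
proof -
  have "add (scale r v) (scale (-1) (scale r w)) = scale r (add v (scale (-1) w))"
    using assms by (simp add: scale_add_right scale_scale closed)
  then show ?thesis using assms by (simp add: dst_def nrm_scale closed)
qed

lemma dst_scale_left: 
  assumes "v \<in> V" shows "dst (scale r v) (scale s v) = \<bar>r - s\<bar> * nrm v"
proof -
  have "add (scale r v) (scale (-1) (scale s v)) = scale (r - s) v"
    using assms scale_add_left[of v r "-s"] by (simp add: scale_scale)
  then show ?thesis using assms by (simp add: dst_def nrm_scale)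
qed

lemma dst_triangle: 
  assumes "u \<in> V" "v \<in> V" "w \<in> V" shows "dst u w \<le> dst u v + dst v w"
proof -
  have "add u (scale (-1) w) = add (add u (scale (-1) v)) (add v (scale (-1) w))"
    using assms by (intro ip_ext) (simp_all add: ip_simps)
  then show ?thesis using assms unfolding dst_def by (simp add: nrm_triangle closed)
qed

lemma dst_add: 
  assumes "a \<in> V" "b \<in> V" "c \<in> V" "d \<in> V" shows "dst (add a b) (add c d) \<le> dst a c + dst b d"
proof -
  have "add (add a b) (scale (-1) (add c d)) = add (add a (scale (-1) c)) (add b (scale (-1) d))"
    using assms by (intro ip_ext) (simp_all add: ip_simps)
  then show ?thesis using assms unfolding dst_def by (simp add: nrm_triangle closed)
qed

lemma nrm_le_dst: "v \<in> V \<Longrightarrow> w \<in> V \<Longrightarrow> nrm v \<le> nrm w + dst v w"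
  using dst_triangle[of v w zero] by (simp add: zero_closed)

lemma ip_diff_le: 
  assumes "k \<in> V" "v \<in> V" "w \<in> V" shows "\<bar>ip k v - ip k w\<bar> \<le> nrm k * dst v w"
  using cauchy_schwarz[of k "add v (scale (-1) w)"] assms by (simp add: ip_simps dst_def)

lemma complete_dst: "complete_on V dst"
  using complete unfolding dst_def nrm_def .

lemma tendsto_ip_dst:
  assumes "range s \<subseteq> V" "a \<in> V" "k \<in> V" "(\<lambda>n. dst (s n) a) \<longlonglongrightarrow> 0"
  shows "(\<lambda>n. ip k (s n)) \<longlonglongrightarrow> ip k a"
proof -
  have "(\<lambda>n. nrm k * dst (s n) a) \<longlonglongrightarrow> 0"
    using tendsto_mult_right_zero[OF assms(4)] by simp
  moreover have "norm (ip k (s n) - ip k a) \<le> nrm k * dst (s n) a" for n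
    using ip_diff_le[of k "s n" a] assms by auto
  ultimately have "(\<lambda>n. ip k (s n) - ip k a) \<longlonglongrightarrow> 0"
    by (rule_tac Lim_null_comparison[rotated]) (auto intro: always_eventually)
  then show ?thesis by (simp add: LIM_zero_iff)
qed

text \<open>The parallelogram law for c - a and c - b. If both distances are close to half of
  \<open>dst a b\<close>, the right-hand side is close to 0, so an almost midpoint c is close to the
  true midpoint.\<close>

lemma midpoint_dst:
  assumes "a \<in> V" "b \<in> V" "c \<in> V"
  shows "(dst (scale 2 c) (add a b))\<^sup>2 = 2 * (dst c a)\<^sup>2 + 2 * (dst c b)\<^sup>2 - (dst a b)\<^sup>2"
  using assms by (simp add: dst_square ip_simps ip_commute[of b a] ip_commute[of c a]
      ip_commute[of c b] algebra_simps)

text \<open>\<open>k\<close> is the limit of a minimizing sequence of \<open>ip v v - 2 * l v\<close> in \<open>D\<close>. Additivity on \<open>D\<close> and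
  closure under halving replace linearity, so that \<open>D\<close> can be countable.\<close>

lemma riesz:
  assumes D: "D \<subseteq> V" "D \<noteq> {}"
    and D_add: "\<And>v w. v \<in> D \<Longrightarrow> w \<in> D \<Longrightarrow> add v w \<in> D"
    and D_half: "\<And>v. v \<in> D \<Longrightarrow> scale (-1/2) v \<in> D"
    and l_add: "\<And>v w. v \<in> D \<Longrightarrow> w \<in> D \<Longrightarrow> l (add v w) = l v + (l w :: real)"
    and l_le: "\<And>v. v \<in> D \<Longrightarrow> l v \<le> C * nrm v"
  shows "\<exists>k\<in>V. \<forall>v\<in>D. ip k v = l v"
proof -
  have DV [simp]: "v \<in> D \<Longrightarrow> v \<in> V" for v using D by auto
  have dbl: "add (scale r v) (scale r v) = scale (2 * r) v" if "v \<in> D" for r v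
    using that by (intro ip_ext) (simp_all add: ip_simps)
  \<comment> \<open>The scalar -1/2 lets one closure condition give both negation, as a sum of two
    copies, and then halving.\<close>
  have D_neg: "scale (-1) v \<in> D" if "v \<in> D" for v
    using D_add[OF D_half[OF that] D_half[OF that]] dbl[OF that, of "-1/2"] by simp
  have D_hf: "scale (1/2) v \<in> D" if "v \<in> D" for v
    using D_neg[OF D_half[OF that]] scale_scale[of v "-1" "-1/2"] that by simp
  have l_zero: "l zero = 0"
  proof -
    obtain v where v: "v \<in> D" using D by auto
    have z: "zero \<in> D" using D_add[OF v D_neg[OF v]] add_neg v by simp
    show ?thesis using l_add[OF z z] add_zero[OF zero_closed] by simp
  qed
  have l_neg: "l (scale (-1) v) = - l v" if "v \<in> D" for v
    using l_add[OF that D_neg[OF that]] add_neg[of v] that l_zero by simp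
  have l_hf: "l (scale (1/2) v) = l v / 2" if "v \<in> D" for v
    using l_add[OF D_hf[OF that] D_hf[OF that]] dbl[OF that, of "1/2"] scale_one that by simp
  define r where "r n = inverse (real (Suc n))" for n
  have r0: "r \<longlonglongrightarrow> 0" and r_pos: "r n > 0" for n
    using LIMSEQ_inverse_real_of_nat by (simp_all add: r_def[abs_def])
  define J where "J v = ip v v - 2 * l v" for v
  define m where "m = Inf (J ` D)"
  have J_ge: "J v \<ge> - C\<^sup>2" if "v \<in> D" for v
  proof -
    have "J v \<ge> (nrm v)\<^sup>2 - 2 * C * nrm v" using l_le[OF that] that by (simp add: J_def nrm_square)
    moreover have "0 \<le> (nrm v - C)\<^sup>2" by simp
    ultimately show ?thesis by (simp add: power2_diff algebra_simps)
  qed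
  then have bdd: "bdd_below (J ` D)" by (auto intro!: bdd_belowI)
  then have m_le: "m \<le> J v" if "v \<in> D" for v unfolding m_def using that by (auto intro: cInf_lower)
  have "\<exists>v\<in>D. J v < m + r n" for n
    using cInf_lessD[of "J ` D" "m + r n"] D r_pos[of n] unfolding m_def by auto
  then obtain s where s: "\<And>n. s n \<in> D" "\<And>n. J (s n) < m + r n" by metis
  have sV: "range s \<subseteq> V" using s by auto
  \<comment> \<open>J at the half sum is at least m, and the parallelogram identity turns this into
    a bound on the distance. Hence minimizing sequences are Cauchy.\<close>
  have par: "(dst v w)\<^sup>2 \<le> 2 * (J v - m) + 2 * (J w - m)" if "v \<in> D" "w \<in> D" for v w
  proof -
    let ?h = "scale (1/2) (add v w)"
    have "m \<le> J ?h" using that by (intro m_le D_hf D_add)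
    also have "J ?h = J v / 2 + J w / 2 - (dst v w)\<^sup>2 / 4"
      using that D_add[OF that] 
      by (simp add: J_def l_hf l_add dst_square ip_simps ip_commute[of w v] field_simps)
    finally show ?thesis by simp
  qed
  have "s \<in> cauchy_seqs V dst"
    unfolding cauchy_seqs_def
  proof (safe)
    show "s n \<in> V" for n using s by simp
    fix e :: real assume e: "e > 0"
    have "r \<longlonglongrightarrow> 0" by (rule r0)
    then have "eventually (\<lambda>n. r n < e\<^sup>2 / 4) sequentially"
      using e by (intro order_tendstoD) auto
    then obtain N where N: "\<And>n. n \<ge> N \<Longrightarrow> r n < e\<^sup>2 / 4"
      by (auto simp: eventually_sequentially)
    have "dst (s i) (s j) < e" if "i \<ge> N" "j \<ge> N" for i j
    proof (rule power2_less_imp_less)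
      show "(dst (s i) (s j))\<^sup>2 < e\<^sup>2"
        using par[OF s(1)[of i] s(1)[of j]] N[OF that(1)] N[OF that(2)] s(2)[of i] s(2)[of j]
        by (simp add: field_simps)
    qed (use e in simp)
    then show "\<exists>N. \<forall>i\<ge>N. \<forall>j\<ge>N. dst (s i) (s j) < e" by blast
  qed
  then obtain k where k: "k \<in> V" "(\<lambda>n. dst (s n) k) \<longlonglongrightarrow> 0"
    using complete_dst unfolding complete_on_def by blast
  \<comment> \<open>The limit k need not lie in D, where l is known, so J is not evaluated at k.
    Instead s n + w is compared with the infimum m and only the inner products pass to the
    limit.\<close>
  have step: "2 * (ip k w - l w) + ip w w \<ge> 0" if w: "w \<in> D" for w
  proof -
    have "2 * (ip w (s n) - l w) + ip w w \<ge> - r n" for n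
    proof -
      have "m \<le> J (add (s n) w)" using D_add[OF s(1) w] by (rule m_le)
      also have "\<dots> = J (s n) + 2 * (ip w (s n) - l w) + ip w w"
        using w s(1) by (simp add: J_def ip_simps l_add ip_commute[of "s n" w])
      finally show ?thesis using s(2)[of n] by simp
    qed
    moreover have "(\<lambda>n. 2 * (ip w (s n) - l w) + ip w w) \<longlonglongrightarrow> 2 * (ip w k - l w) + ip w w"
      by (intro tendsto_intros tendsto_ip_dst sV k) (use w in simp)
    moreover have "(\<lambda>n. - r n) \<longlonglongrightarrow> 0"
      using tendsto_minus[OF r0] by simp
    ultimately have "0 \<le> 2 * (ip w k - l w) + ip w w"
      by (intro LIMSEQ_le[of "\<lambda>n. - r n"]) auto
    then show ?thesis using w k by (simp add: ip_commute[of k w])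
  qed
  \<comment> \<open>To remove the quadratic term from \<open>step\<close>, w is replaced by w / 2^j:
    the linear part shrinks like 2^(-j), the quadratic one like 4^(-j). Only halving is used because
    D is not closed under real multiples.\<close>
  have half: "ip k w - l w \<ge> 0" if w: "w \<in> D" for w
  proof -
    have iter: "\<exists>w'\<in>D. ip k w' - l w' = (ip k w - l w) / 2 ^ j \<and> ip w' w' = ip w w / 2 ^ j / 2 ^ j" for j
    proof (induction j)
      case 0 then show ?case using w by auto
    next
      case (Suc j)
      then obtain w' where w': "w' \<in> D" "ip k w' - l w' = (ip k w - l w) / 2 ^ j" 
        "ip w' w' = ip w w / 2 ^ j / 2 ^ j" by auto
      then show ?case using k
        by (intro bexI[of _ "scale (1/2) w'"]) (auto simp: ip_simps l_hf D_hf)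
    qed
    have "2 * (ip k w - l w) + ip w w / 2 ^ j \<ge> 0" for j
    proof -
      obtain w' where w': "w' \<in> D" "ip k w' - l w' = (ip k w - l w) / 2 ^ j" 
        "ip w' w' = ip w w / 2 ^ j / 2 ^ j" using iter by blast
      from step[OF w'(1)] have "0 \<le> (2 * (ip k w - l w) + ip w w / 2 ^ j) / 2 ^ j"
        unfolding w' by (simp add: add_divide_distrib)
      then show ?thesis using zero_less_power[of "2::real" j] by (simp add: zero_le_divide_iff del: zero_less_power)
    qed
    moreover have "(\<lambda>j. 2 * (ip k w - l w) + ip w w / 2 ^ j) \<longlonglongrightarrow> 2 * (ip k w - l w) + 0"
      by (intro tendsto_intros LIMSEQ_divide_realpow_zero) auto
    ultimately have "0 \<le> 2 * (ip k w - l w) + 0"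
      by (intro LIMSEQ_le_const[of _ _ 0]) auto
    then show ?thesis by simp
  qed
  have "ip k w = l w" if w: "w \<in> D" for w
    using half[OF w] half[OF D_neg[OF w]] l_neg[OF w] w k by (simp add: ip_simps)
  then show ?thesis using k by auto
qed

end

section \<open>The Hahn-Banach theorem\<close>

context vector_space_on
begin

definition sublinear :: "('v \<Rightarrow> real) \<Rightarrow> bool" where
  "sublinear q \<longleftrightarrow> (\<forall>a\<in>V. \<forall>b\<in>V. q (add a b) \<le> q a + q b) \<and>
     (\<forall>r>0. \<forall>a\<in>V. q (scale r a) = r * q a)"

text \<open>The reverse inequality for scaling is the given one with factor 1/r, applied to
  \<open>scale r a\<close>.\<close>

lemma sublinearI:
  assumes "\<And>a b. a \<in> V \<Longrightarrow> b \<in> V \<Longrightarrow> q (add a b) \<le> q a + q b"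
    and "\<And>r a. r > 0 \<Longrightarrow> a \<in> V \<Longrightarrow> q (scale r a) \<le> r * q a"
  shows "sublinear q"
proof -
  have "r * q a \<le> q (scale r a)" if "r > 0" "a \<in> V" for r a
    using assms(2)[of "1 / r" "scale r a"] that
    by (simp add: scale_scale scale_one scale_closed field_simps)
  then show ?thesis using assms by (force simp: sublinear_def intro: antisym)
qed

lemma sublinear_add: "sublinear q \<Longrightarrow> a \<in> V \<Longrightarrow> b \<in> V \<Longrightarrow> q (add a b) \<le> q a + q b"
  and sublinear_scale: "sublinear q \<Longrightarrow> r > 0 \<Longrightarrow> a \<in> V \<Longrightarrow> q (scale r a) = r * q a"
  by (auto simp: sublinear_def)

lemma sublinear_zero: "sublinear q \<Longrightarrow> q zero = 0"
  using sublinear_scale[of q 2 zero] zero_closed scale_zero_right[of 2] by simp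

lemma sublinear_neg: "sublinear q \<Longrightarrow> a \<in> V \<Longrightarrow> - q (scale (-1) a) \<le> q a"
  using sublinear_add[of q a "scale (-1) a"] sublinear_zero[of q] add_neg[of a]
  by (simp add: scale_closed)

text \<open>The infimum is finite because l w <= q w <= q (x + w) + q (-x). It pushes q down as far
  as l allows: if -w is also available, the term for -w bounds q' w by l w. It is applied to a
  half-line for additivity of minimal functionals and to a subspace for the extension
  theorem.\<close>

lemma sublinear_INF_cone:
  assumes q: "sublinear q" and W: "W \<subseteq> V" "W \<noteq> {}"
    and W_add: "\<And>a b. a \<in> W \<Longrightarrow> b \<in> W \<Longrightarrow> add a b \<in> W"
    and W_scale: "\<And>r a. r > 0 \<Longrightarrow> a \<in> W \<Longrightarrow> scale r a \<in> W"
    and l_add: "\<And>a b. a \<in> W \<Longrightarrow> b \<in> W \<Longrightarrow> l (add a b) = l a + l b"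
    and l_scale: "\<And>r a. r > 0 \<Longrightarrow> a \<in> W \<Longrightarrow> l (scale r a) = r * l a"
    and l_le: "\<And>a. a \<in> W \<Longrightarrow> l a \<le> q a"
  defines "q' \<equiv> \<lambda>x. INF w\<in>W. q (add x w) - l w"
  shows "sublinear q'" and "\<And>x w. x \<in> V \<Longrightarrow> w \<in> W \<Longrightarrow> q' x \<le> q (add x w) - l w"
proof -
  have [simp]: "w \<in> V" if "w \<in> W" for w using W that by auto
  have "- q (scale (-1) x) \<le> q (add x w) - l w" if "x \<in> V" "w \<in> W" for x w
  proof -
    have "add (add x w) (scale (-1) x) = w"
      using that add_commute[of x w] by (simp add: add_neg_cancel)
    then have "q w \<le> q (add x w) + q (scale (-1) x)"
      using sublinear_add[OF q, of "add x w" "scale (-1) x"] that by (simp add: scale_closed add_closed)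
    then show ?thesis using l_le[OF that(2)] by simp
  qed
  then have bdd: "bdd_below ((\<lambda>w. q (add x w) - l w) ` W)" if "x \<in> V" for x
    using that by (intro bdd_belowI2) auto
  show le: "q' x \<le> q (add x w) - l w" if "x \<in> V" "w \<in> W" for x w
    unfolding q'_def by (rule cINF_lower[OF bdd]) (use that in auto)
  have greatest: "c \<le> q' x" if "\<And>w. w \<in> W \<Longrightarrow> c \<le> q (add x w) - l w" for c x
    unfolding q'_def by (rule cINF_greatest) (use that W in auto)
  show "sublinear q'"
  proof (rule sublinearI)
    fix a b assume ab: "a \<in> V" "b \<in> V"
    have *: "q' (add a b) \<le> (q (add a v) - l v) + (q (add b w) - l w)"
      if "v \<in> W" "w \<in> W" for v w
    proof -
      have "add (add a b) (add v w) = add (add a v) (add b w)"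
        using ab that by (simp add: add_middle_swap)
      then have "q (add (add a b) (add v w)) \<le> q (add a v) + q (add b w)"
        using sublinear_add[OF q, of "add a v" "add b w"] ab that by (simp add: add_closed)
      then show ?thesis using le[of "add a b" "add v w"] that ab l_add[OF that]
        by (simp add: add_closed W_add)
    qed
    \<comment> \<open>The two infima are taken one after the other, with the other cone element held
      fixed.\<close>
    have "q' (add a b) - (q (add b w) - l w) \<le> q' a" if "w \<in> W" for w
      by (rule greatest) (use *[OF _ that] in \<open>simp add: algebra_simps\<close>)
    then have "q' (add a b) - q' a \<le> q' b"
      by (intro greatest) (simp add: algebra_simps)
    then show "q' (add a b) \<le> q' a + q' b" by simp
  next
    fix c :: real and a assume ca: "c > 0" "a \<in> V"
    have "q' (scale c a) / c \<le> q' a"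
    proof (rule greatest)
      fix w assume w: "w \<in> W"
      have "add (scale c a) (scale c w) = scale c (add a w)"
        using ca w by (simp add: scale_add_right)
      then have "q' (scale c a) \<le> c * q (add a w) - c * l w"
        using le[of "scale c a" "scale c w"] sublinear_scale[OF q, of c "add a w"] ca w l_scale
        by (simp add: scale_closed add_closed W_scale)
      then show "q' (scale c a) / c \<le> q (add a w) - l w"
        using ca by (simp add: field_simps)
    qed
    then show "q' (scale c a) \<le> c * q' a" using ca by (simp add: field_simps)
  qed
qed

text \<open>A minimal sublinear functional below \<open>p\<close> is additive, since it cannot be lowered by
  \<open>sublinear_INF_cone\<close> along a half-line.\<close>

theorem hahn_banach:
  assumes p: "sublinear p"
  shows "\<exists>l. (\<forall>a\<in>V. \<forall>b\<in>V. l (add a b) = l a + l b) \<and> (\<forall>a\<in>V. l a \<le> p a)"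
proof -
  \<comment> \<open>Values outside V are fixed to 0; otherwise they could be lowered forever and no
    element would be minimal. The order R is reversed, so the maximal element from Zorn's lemma is a
    minimal functional.\<close>
  define A where "A = {q. sublinear q \<and> (\<forall>a\<in>V. q a \<le> p a) \<and> (\<forall>a. a \<notin> V \<longrightarrow> q a = 0)}"
  define R where "R q q' \<longleftrightarrow> (\<forall>a. q' a \<le> q a)" for q q' :: "'v \<Rightarrow> real"
  have restrict: "sublinear (\<lambda>a. if a \<in> V then q a else 0)" if "sublinear q" for q
    using that by (auto simp: sublinear_def add_closed scale_closed)
  have "\<exists>m\<in>A. \<forall>a\<in>A. R m a \<longrightarrow> a = m"
  proof (rule predicate_Zorn)
    show "partial_order_on A (relation_of R A)"
      by (rule partial_order_on_relation_ofI) (auto simp: R_def fun_eq_iff intro: order_trans antisym)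
  next
    fix C assume C: "C \<in> Chains (relation_of R A)"
    then have CA: "C \<subseteq> A" and ch: "\<And>q q'. q \<in> C \<Longrightarrow> q' \<in> C \<Longrightarrow> R q q' \<or> R q' q"
      by (auto simp: Chains_def relation_of_def)
    show "\<exists>u\<in>A. \<forall>a\<in>C. R a u"
    proof (cases "C = {}")
      case True
      then show ?thesis using restrict[OF p]
        by (intro bexI[of _ "\<lambda>a. if a \<in> V then p a else 0"]) (auto simp: A_def)
    next
      case False
      define u where "u a = (INF q\<in>C. q a)" for a
      have sub: "sublinear q" if "q \<in> C" for q using CA that by (auto simp: A_def)
      \<comment> \<open>A lower bound common to the whole chain: - p (-a) <= - q (-a) <= q a. It
        makes the infimum over the chain finite.\<close>
      have "- p (scale (-1) a) \<le> q a" if "q \<in> C" "a \<in> V" for a q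
        using sublinear_neg[OF sub[OF that(1)] that(2)] CA that scale_closed[of a "-1"]
        by (force simp: A_def)
      then have le: "u a \<le> q a" if "q \<in> C" "a \<in> V" for q a
        unfolding u_def using that by (intro cINF_lower bdd_belowI2) auto
      have greatest: "c \<le> u a" if "\<And>q. q \<in> C \<Longrightarrow> c \<le> q a" for c a
        unfolding u_def using False that by (intro cINF_greatest) auto
      have "sublinear u"
      proof (rule sublinearI)
        fix a b assume ab: "a \<in> V" "b \<in> V"
        have *: "u (add a b) \<le> q a + q' b" if q: "q \<in> C" "q' \<in> C" for q q'
        proof -
          \<comment> \<open>The members q and q' of the chain are comparable, and the smaller one
            serves for both.\<close>
          obtain q'' where q'': "q'' \<in> C" "q'' a \<le> q a" "q'' b \<le> q' b"
            using ch[OF q] q unfolding R_def by (metis order_refl)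
          then show ?thesis
            using le[OF q''(1), of "add a b"] sublinear_add[OF sub[OF q''(1)] ab] ab
            by (simp add: add_closed)
        qed
        have "u (add a b) - q' b \<le> u a" if "q' \<in> C" for q'
          by (rule greatest) (use *[OF _ that] in \<open>simp add: algebra_simps\<close>)
        then have "u (add a b) - u a \<le> u b"
          by (intro greatest) (simp add: algebra_simps)
        then show "u (add a b) \<le> u a + u b" by simp
      next
        fix c :: real and a assume ca: "c > 0" "a \<in> V"
        have "u (scale c a) / c \<le> u a"
        proof (rule greatest)
          fix q assume "q \<in> C"
          then have "u (scale c a) \<le> c * q a"
            using le[of q "scale c a"] sublinear_scale[OF sub, of q c a] ca by (simp add: scale_closed)
          then show "u (scale c a) / c \<le> q a" using ca by (simp add: field_simps)
        qed
        then show "u (scale c a) \<le> c * u a" using ca by (simp add: field_simps)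
      qed
      note u = restrict[OF this]
      obtain q\<^sub>0 where q\<^sub>0: "q\<^sub>0 \<in> C" using False by auto
      have "u a \<le> p a" if "a \<in> V" for a
        using le[OF q\<^sub>0 that] q\<^sub>0 CA that unfolding A_def by (blast intro: order_trans)
      then have "(\<lambda>a. if a \<in> V then u a else 0) \<in> A"
        using u by (simp add: A_def)
      moreover have "R q (\<lambda>a. if a \<in> V then u a else 0)" if "q \<in> C" for q
        using le[OF that] that CA by (auto simp: R_def A_def)
      ultimately show ?thesis by blast
    qed
  qed
  then obtain q where q: "q \<in> A" and min: "\<And>q'. q' \<in> A \<Longrightarrow> R q q' \<Longrightarrow> q' = q" by auto
  have sub: "sublinear q" and qp: "\<forall>a\<in>V. q a \<le> p a" using q by (auto simp: A_def)
  have "q (add x y) = q x + q y" if xy: "x \<in> V" "y \<in> V" for x y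
  proof -
    \<comment> \<open>On the half-line q is additive and can itself take the place of l. Minimality
      forces q' = q, and the term w = y of the infimum is then the missing inequality q x + q y <= q
      (x + y).\<close>
    define W where "W = (\<lambda>r. scale r y) ` {0..}"
    define q' where "q' = (\<lambda>x. INF w\<in>W. q (add x w) - q w)"
    have q_scale: "q (scale r y) = r * q y" if "r \<ge> 0" for r
      using that sublinear_scale[OF sub _ xy(2), of r] sublinear_zero[OF sub] scale_zero_left[OF xy(2)]
      by (cases "r = 0") auto
    have W_add: "add a b \<in> W \<and> q (add a b) = q a + q b" if a: "a \<in> W" and b: "b \<in> W" for a b
    proof -
      obtain r where r: "r \<ge> 0" "a = scale r y" using a by (auto simp: W_def)
      obtain s where s: "s \<ge> 0" "b = scale s y" using b by (auto simp: W_def)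
      have "add a b = scale (r + s) y" using r s xy by (simp add: scale_add_left)
      then show ?thesis using r s q_scale by (auto simp: W_def algebra_simps)
    qed
    have W_scale: "scale c a \<in> W" if "a \<in> W" "c > 0" for a c
      using that xy by (auto simp: W_def scale_scale scale_closed)
    have W_mem: "zero \<in> W" "y \<in> W"
      using xy by (auto simp: W_def intro: rev_image_eqI[of 0] rev_image_eqI[of 1]
          simp: scale_zero_left scale_one)
    have WV: "W \<subseteq> V" using xy by (auto simp: W_def scale_closed)
    have W_ne: "W \<noteq> {}" using W_mem by auto
    have q_scale_W: "q (scale r a) = r * q a" if "r > 0" "a \<in> W" for r a
      using that WV sublinear_scale[OF sub] by auto
    note cone = sublinear_INF_cone[OF sub WV W_ne _ _ _ q_scale_W order_refl]
    have q': "sublinear q'" unfolding q'_def by (rule cone) (use W_add W_scale in auto)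
    have le: "q' x \<le> q (add x w) - q w" if "x \<in> V" "w \<in> W" for x w
      unfolding q'_def by (rule cone) (use W_add W_scale that in auto)
    have q'q: "q' x \<le> q x" if "x \<in> V" for x
      using le[OF that W_mem(1)] that sublinear_zero[OF sub] by (simp add: add_zero_right)
    have "(\<lambda>x. if x \<in> V then q' x else 0) = q"
    proof (rule min)
      show "(\<lambda>x. if x \<in> V then q' x else 0) \<in> A"
        using restrict[OF q'] order_trans[OF q'q] qp by (simp add: A_def)
      show "R q (\<lambda>x. if x \<in> V then q' x else 0)"
        using q'q q by (auto simp: A_def R_def)
    qed
    from fun_cong[OF this, of x] have "q x = q' x" using xy by simp
    then have "q x \<le> q (add x y) - q y" using le[OF xy(1) W_mem(2)] by simp
    then show ?thesis using sublinear_add[OF sub xy] by simp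
  qed
  then show ?thesis using qp by auto
qed

text \<open>Any additive l' below q' works. For w in W, the term for -w of the infimum gives l' w <=
  q' w <= l w, and the same for -w gives equality. The term for 0 gives l' <= q on all of V.\<close>

corollary hahn_banach_extension:
  assumes q: "sublinear q" and W: "W \<subseteq> V" "W \<noteq> {}"
    and W_add: "\<And>a b. a \<in> W \<Longrightarrow> b \<in> W \<Longrightarrow> add a b \<in> W"
    and W_scale: "\<And>r a. a \<in> W \<Longrightarrow> scale r a \<in> W"
    and l_add: "\<And>a b. a \<in> W \<Longrightarrow> b \<in> W \<Longrightarrow> l (add a b) = l a + l b"
    and l_scale: "\<And>r a. a \<in> W \<Longrightarrow> l (scale r a) = r * l a"
    and l_le: "\<And>a. a \<in> W \<Longrightarrow> l a \<le> q a"
  shows "\<exists>l'. (\<forall>a\<in>V. \<forall>b\<in>V. l' (add a b) = l' a + l' b) \<and> (\<forall>a\<in>V. l' a \<le> q a) \<and>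
    (\<forall>w\<in>W. l' w = l w)"
proof -
  define q' where "q' = (\<lambda>x. INF w\<in>W. q (add x w) - l w)"
  have q': "sublinear q'" and le: "\<And>x w. x \<in> V \<Longrightarrow> w \<in> W \<Longrightarrow> q' x \<le> q (add x w) - l w"
    unfolding q'_def using sublinear_INF_cone[OF assms(1-4) W_scale l_add l_scale l_le] by auto
  obtain l' where add: "\<forall>a\<in>V. \<forall>b\<in>V. l' (add a b) = l' a + l' b" and l'_le: "\<forall>a\<in>V. l' a \<le> q' a"
    using hahn_banach[OF q'] by blast
  obtain w\<^sub>0 where "w\<^sub>0 \<in> W" using W by auto
  then have zero: "zero \<in> W" "l zero = 0"
    using W_scale[of w\<^sub>0 0] l_scale[of w\<^sub>0 0] W scale_zero_left[of w\<^sub>0] by auto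
  have *: "l' w \<le> l w" if w: "w \<in> W" for w
  proof -
    have "q' w \<le> q (add w (scale (-1) w)) - l (scale (-1) w)"
      using le[of w "scale (-1) w"] w W W_scale by auto
    also have "\<dots> = l w" using w W sublinear_zero[OF q] l_scale[OF w] add_neg[of w] by auto
    finally show ?thesis using l'_le w W by fastforce
  qed
  have "l' zero = 0" using bspec[OF bspec[OF add zero_closed] zero_closed] add_zero[OF zero_closed] by simp
  then have neg: "l' (scale (-1) w) = - l' w" if "w \<in> V" for w
    using bspec[OF bspec[OF add that] scale_closed[OF that, of "-1"]] add_neg[OF that] by simp
  have "l' w = l w" if w: "w \<in> W" for w
    using *[OF w] *[OF W_scale[OF w, of "-1"]] neg[of w] l_scale[OF w, of "-1"] w W by auto
  moreover have "l' a \<le> q a" if "a \<in> V" for a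
    using l'_le that le[OF that zero(1)] zero that by (auto simp: add_zero_right intro: order_trans)
  ultimately show ?thesis using add by auto
qed

end

section \<open>Strassen's theorem\<close>

text \<open>Domination upgrades finite to countable additivity: along a decreasing sequence of sets
  with empty intersection the integrals of b tend to 0 and squeeze the values of \<nu>. It also
  gives absolute continuity, so Radon-Nikodym applies.\<close>

lemma (in sigma_finite_measure) density_of_dominated_additive:
  fixes \<nu> :: "'a set \<Rightarrow> real"
  assumes b: "integrable M b"
    and nonneg: "\<And>A. A \<in> sets M \<Longrightarrow> 0 \<le> \<nu> A"
    and le: "\<And>A. A \<in> sets M \<Longrightarrow> \<nu> A \<le> (\<integral>t. b t * indicator A t \<partial>M)"
    and add: "\<And>A B. A \<in> sets M \<Longrightarrow> B \<in> sets M \<Longrightarrow> A \<inter> B = {} \<Longrightarrow> \<nu> (A \<union> B) = \<nu> A + \<nu> B"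
  shows "\<exists>h. integrable M h \<and> (\<forall>t. 0 \<le> h t) \<and>
    (\<forall>A\<in>sets M. (\<integral>t. h t * indicator A t \<partial>M) = \<nu> A)"
proof -
  note [measurable] = borel_measurable_integrable[OF b]
  let ?\<nu> = "\<lambda>A. ennreal (\<nu> A)"
  have empty: "\<nu> {} = 0" using le[of "{}"] nonneg[of "{}"] by simp
  have pos: "positive (sets M) ?\<nu>" using empty by (simp add: positive_def)
  have "countably_additive (sets M) ?\<nu>"
  proof (rule sets.empty_continuous_imp_countably_additive[OF pos])
    show "additive (sets M) ?\<nu>" by (simp add: additive_def add nonneg)
  next
    fix A :: "nat \<Rightarrow> 'a set" assume A: "range A \<subseteq> sets M" "decseq A" "(\<Inter>i. A i) = {}"
    have [measurable]: "A i \<in> sets M" for i using A by auto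
    have "(\<lambda>i. \<integral>t. b t * indicator (A i) t \<partial>M) \<longlonglongrightarrow> (\<integral>t. 0 \<partial>M)"
    proof (rule integral_dominated_convergence[where w="\<lambda>t. norm (b t)"])
      show "AE t in M. (\<lambda>i. b t * indicator (A i) t) \<longlonglongrightarrow> 0"
      proof (intro AE_I2)
        fix t
        obtain n where "t \<notin> A n" using A by auto
        then have "t \<notin> A i" if "i \<ge> n" for i using decseqD[OF A(2) that] by auto
        then have "\<forall>\<^sub>F i in sequentially. b t * indicator (A i) t = 0"
          by (auto simp: eventually_sequentially indicator_def)
        then show "(\<lambda>i. b t * indicator (A i) t) \<longlonglongrightarrow> 0" by (rule tendsto_eventually)
      qed
      show "integrable M (\<lambda>t. norm (b t))" using b by simp
    qed (auto simp: indicator_def)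
    then have lim: "(\<lambda>i. \<integral>t. b t * indicator (A i) t \<partial>M) \<longlonglongrightarrow> 0" by simp
    have "(\<lambda>i. \<nu> (A i)) \<longlonglongrightarrow> 0"
      by (rule tendsto_sandwich[OF _ _ tendsto_const lim])
        (auto intro!: always_eventually nonneg le)
    then show "(\<lambda>i. ?\<nu> (A i)) \<longlonglongrightarrow> 0" by (metis ennreal_0 tendsto_ennrealI)
  qed simp
  then have em: "emeasure (measure_of (space M) (sets M) ?\<nu>) A = ?\<nu> A" if "A \<in> sets M" for A
    using that pos by (intro emeasure_measure_of_sigma sets.sigma_algebra_axioms) auto
  let ?N = "measure_of (space M) (sets M) ?\<nu>"
  have "absolutely_continuous M ?N"
    unfolding absolutely_continuous_def
  proof
    fix A assume A: "A \<in> null_sets M"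
    then have "AE t in M. b t * indicator A t = 0"
      by (auto dest!: AE_not_in elim!: eventually_mono)
    then have "(\<integral>t. b t * indicator A t \<partial>M) = 0" by (rule integral_eq_zero_AE)
    then show "A \<in> null_sets ?N" using A le[of A] nonneg[of A] by (auto simp: null_sets_def em)
  qed
  from Radon_Nikodym[OF this] obtain h where h [measurable]: "h \<in> borel_measurable M"
    and hN: "density M h = ?N" by auto
  have h_int: "(\<integral>\<^sup>+t. h t * indicator A t \<partial>M) = ?\<nu> A" if "A \<in> sets M" for A
    using that emeasure_density[OF h that] em[OF that] hN by simp
  have "(\<integral>\<^sup>+t. h t \<partial>M) = (\<integral>\<^sup>+t. h t * indicator (space M) t \<partial>M)"
    by (rule nn_integral_cong) simp
  then have "(\<integral>\<^sup>+t. h t \<partial>M) \<noteq> \<infinity>" using h_int[of "space M"] by simp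
  then have fin: "AE t in M. h t \<noteq> \<infinity>" by (rule nn_integral_PInf_AE[OF h])
  \<comment> \<open>\<open>enn2real\<close> turns the value infinity into 0, which by
    \<open>fin\<close> alters h only on a null set.\<close>
  have nn: "(\<integral>\<^sup>+t. ennreal (enn2real (h t) * indicator A t) \<partial>M) = ?\<nu> A" if "A \<in> sets M" for A
  proof -
    have "(\<integral>\<^sup>+t. ennreal (enn2real (h t) * indicator A t) \<partial>M) = (\<integral>\<^sup>+t. h t * indicator A t \<partial>M)"
      by (rule nn_integral_cong_AE, use fin in eventually_elim) (auto simp: indicator_def top.not_eq_extremum)
    then show ?thesis using h_int[OF that] by simp
  qed
  have "integrable M (\<lambda>t. enn2real (h t) * indicator (space M) t)"
    by (intro integrableI_nonneg) (auto simp: nn)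
  then have "integrable M (\<lambda>t. enn2real (h t))"
    by (rule Bochner_Integration.integrable_cong[THEN iffD1, rotated -1]) auto
  moreover have "(\<integral>t. enn2real (h t) * indicator A t \<partial>M) = \<nu> A" if [measurable]: "A \<in> sets M" for A
    using nn[OF that] nonneg[OF that] by (subst integral_eq_nn_integral) auto
  ultimately show ?thesis by (intro exI[of _ "\<lambda>t. enn2real (h t)"]) auto
qed

text \<open>Preimages under f and g differ within a null set. It is needed because the selection in
  \<open>strassen\<close> is chosen pointwise and is compared with measurable densities only almost
  everywhere.\<close>

lemma (in complete_measure) borel_measurable_cong_AE:
  assumes f: "f \<in> borel_measurable M" and eq: "AE t in M. f t = g t"
  shows "g \<in> borel_measurable M"
proof (rule measurableI)
  fix B :: "'b set" assume B: "B \<in> sets borel"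
  show "g -` B \<inter> space M \<in> sets M"
  proof (rule in_sets_AE)
    show "AE t in M. (t \<in> f -` B \<inter> space M) = (t \<in> g -` B \<inter> space M)"
      using eq by eventually_elim auto
    show "f -` B \<inter> space M \<in> sets M" using f B by (rule measurable_sets)
  qed auto
qed auto

section \<open>Linear functionals below an integral of sublinear functions\<close>

locale sublinear_integrand = hilbert_space_on V add zero scale ip + prob_space M
  for V :: "'v set" and add zero scale ip and M :: "'t measure" +
  fixes p :: "'t \<Rightarrow> 'v \<Rightarrow> real" and L :: "'t \<Rightarrow> real"
  assumes p_sublinear: "t \<in> space M \<Longrightarrow> sublinear (p t)"
    and p_measurable: "v \<in> V \<Longrightarrow> (\<lambda>t. p t v) \<in> borel_measurable M"
    and p_le: "t \<in> space M \<Longrightarrow> v \<in> V \<Longrightarrow> p t v \<le> L t * nrm v"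
    and L_integrable: "integrable M L"
begin

lemma abs_p_le: "t \<in> space M \<Longrightarrow> v \<in> V \<Longrightarrow> \<bar>p t v\<bar> \<le> L t * nrm v"
  using p_le[of t v] p_le[of t "scale (-1) v"] sublinear_neg[OF p_sublinear, of t v]
  by (auto simp: nrm_scale closed abs_le_iff)

lemma p_integrable: "v \<in> V \<Longrightarrow> integrable M (\<lambda>t. p t v)"
  by (rule Bochner_Integration.integrable_bound[of M "\<lambda>t. L t * nrm v"])
    (auto intro!: AE_I2 p_measurable L_integrable abs_p_le order_trans[OF abs_p_le] mult_right_mono simp: abs_mult)

text \<open>Both sides are Lipschitz in v: the inner product with constant \<open>nrm k\<close>, and
  p t because p t d <= p t v + p t (d - v).\<close>

lemma ip_le_p_dense:
  assumes t: "t \<in> space M" and k: "k \<in> V" and D: "D \<subseteq> V"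
    and dense: "\<And>v e. v \<in> V \<Longrightarrow> e > 0 \<Longrightarrow> \<exists>d\<in>D. dst v d < e"
    and le: "\<And>d. d \<in> D \<Longrightarrow> ip k d \<le> p t d" and v: "v \<in> V"
  shows "ip k v \<le> p t v"
proof (rule ccontr)
  assume "\<not> ip k v \<le> p t v"
  \<comment> \<open>More than the sum of both Lipschitz constants, the 1 making it positive: a point
    of D within (gap / C) of v contradicts the gap.\<close>
  define C where "C = \<bar>L t\<bar> + nrm k + 1"
  have C: "C > 0" using k by (simp add: C_def add_nonneg_pos)
  with \<open>\<not> ip k v \<le> p t v\<close> have "(ip k v - p t v) / C > 0" by simp
  from dense[OF v this] obtain d where d: "d \<in> D" and dv: "dst v d < (ip k v - p t v) / C" by blast
  have dV: "d \<in> V" using d D by auto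
  let ?u = "add d (scale (-1) v)"
  have "d = add v ?u" using add_neg_cancel2[OF dV v] add_commute[of v ?u] v dV by (simp add: closed)
  then have "p t d \<le> p t v + p t ?u"
    using sublinear_add[OF p_sublinear[OF t], of v ?u] v dV by (simp add: closed)
  also have "p t ?u \<le> L t * dst d v" using p_le[OF t, of ?u] v dV by (simp add: closed dst_def)
  also have "\<dots> \<le> \<bar>L t\<bar> * dst v d"
    using v dV by (simp add: dst_commute[of d v] mult_right_mono)
  finally have "ip k d \<le> p t v + \<bar>L t\<bar> * dst v d" using le[OF d] by simp
  moreover have "ip k v \<le> ip k d + nrm k * dst v d" using ip_diff_le[OF k v dV] by simp
  ultimately have "ip k v - p t v \<le> C * dst v d"
    using dst_nonneg[OF v dV] by (simp add: C_def algebra_simps)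
  then show False using dv C by (simp add: field_simps)
qed

text \<open>The functional from Hahn-Banach is bounded by L t times the norm, so
  \<open>riesz\<close> represents it. It supplies the value of the selection where the densities
  fail to be additive.\<close>

lemma subgradient_exists:
  assumes t: "t \<in> space M" shows "\<exists>k\<in>V. \<forall>v\<in>V. ip k v \<le> p t v"
proof -
  obtain l where add: "\<forall>a\<in>V. \<forall>b\<in>V. l (add a b) = l a + l b" and le: "\<forall>a\<in>V. l a \<le> p t a"
    using hahn_banach[OF p_sublinear[OF t]] by blast
  have "\<exists>k\<in>V. \<forall>v\<in>V. ip k v = l v"
  proof (rule riesz[of V _ "L t"])
    show "l v \<le> L t * nrm v" if "v \<in> V" for v using le p_le[OF t that] that by fastforce
  qed (use add zero_closed closed in auto)
  then obtain k where "k \<in> V" "\<And>v. v \<in> V \<Longrightarrow> ip k v = l v" by blast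
  then show ?thesis using le by (intro bexI[of _ k]) auto
qed

text \<open>The second space to which Hahn-Banach is applied, besides the cone itself; it is why the
  linear axioms form a locale apart from the inner product. Values are required to lie in V also
  outside \<open>space M\<close>, so that the axioms hold as equations of total functions.\<close>

lemma vector_space_on_simple_functions:
  "vector_space_on {w. simple_function M w \<and> range w \<subseteq> V} (\<lambda>a b t. add (a t) (b t)) (\<lambda>_. zero)
    (\<lambda>r a t. scale r (a t))"
  by unfold_locales
    (auto simp: fun_eq_iff image_subset_iff closed add_assoc add_zero add_neg scale_one scale_scale
      scale_add_left scale_add_right intro: add_commute
      simple_function_compose2[where h=add] simple_function_compose1[where g="scale _"])

text \<open>Integrability of p is known only for a fixed vector, so the composition is split over
  the finitely many values of w.\<close>

lemma simple_function_integrable: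
  assumes w: "simple_function M w" "range w \<subseteq> V"
  shows "integrable M (\<lambda>t. p t (w t))"
proof -
  have fin: "finite (w ` space M)" and set: "w -` {v} \<inter> space M \<in> sets M" for v
    using w by (auto dest: simple_functionD)
  have "integrable M (\<lambda>t. \<Sum>v\<in>w ` space M. p t v * indicator (w -` {v} \<inter> space M) t)"
    by (intro Bochner_Integration.integrable_sum integrable_real_mult_indicator set p_integrable)
      (use w in auto)
  moreover have "(\<Sum>v\<in>w ` space M. p t v * indicator (w -` {v} \<inter> space M) t) = p t (w t)"
    if "t \<in> space M" for t
  proof -
    have "(\<Sum>v\<in>w ` space M. p t v * indicator (w -` {v} \<inter> space M) t) =
        (\<Sum>v\<in>w ` space M. if v = w t then p t v else 0)"
      by (rule sum.cong) (use that in \<open>auto simp: indicator_def\<close>)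
    also have "\<dots> = p t (w t)" using fin that by (simp add: sum.delta)
    finally show ?thesis .
  qed
  ultimately show ?thesis by (simp cong: Bochner_Integration.integrable_cong)
qed

lemma additive_set_function_exists:
  assumes u: "u \<in> V" and u_le: "\<And>v. v \<in> V \<Longrightarrow> ip u v \<le> (\<integral>t. p t v \<partial>M)"
  obtains \<mu> where "\<And>A v. A \<in> sets M \<Longrightarrow> v \<in> V \<Longrightarrow> \<mu> A v \<le> (\<integral>t. p t v * indicator A t \<partial>M)"
    and "\<And>A v w. A \<in> sets M \<Longrightarrow> v \<in> V \<Longrightarrow> w \<in> V \<Longrightarrow> \<mu> A (add v w) = \<mu> A v + \<mu> A w"
    and "\<And>A B v. A \<in> sets M \<Longrightarrow> B \<in> sets M \<Longrightarrow> A \<inter> B = {} \<Longrightarrow> v \<in> V \<Longrightarrow> \<mu> (A \<union> B) v = \<mu> A v + \<mu> B v"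
    and "\<And>v. v \<in> V \<Longrightarrow> \<mu> (space M) v = ip u v"
proof -
  define X where "X = {w. simple_function M w \<and> range w \<subseteq> V}"
  interpret X: vector_space_on X "\<lambda>a b t. add (a t) (b t)" "\<lambda>_. zero" "\<lambda>r a t. scale r (a t)"
    unfolding X_def by (rule vector_space_on_simple_functions)
  define P where "P w = (\<integral>t. p t (w t) \<partial>M)" for w
  have XV [simp]: "w t \<in> V" if "w \<in> X" for w t using that by (auto simp: X_def)
  have X_int: "integrable M (\<lambda>t. p t (w t))" if "w \<in> X" for w
    using that simple_function_integrable by (auto simp: X_def)
  have P: "X.sublinear P"
  proof (rule X.sublinearI)
    fix a b assume ab: "a \<in> X" "b \<in> X"
    have "P (\<lambda>t. add (a t) (b t)) \<le> (\<integral>t. p t (a t) + p t (b t) \<partial>M)"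
      unfolding P_def
      by (intro integral_mono X_int X.add_closed Bochner_Integration.integrable_add sublinear_add
          p_sublinear) (use ab in auto)
    also have "\<dots> = P a + P b" using ab X_int by (simp add: P_def)
    finally show "P (\<lambda>t. add (a t) (b t)) \<le> P a + P b" .
  next
    fix r :: real and a assume "r > 0" "a \<in> X"
    then have "P (\<lambda>t. scale r (a t)) = (\<integral>t. r * p t (a t) \<partial>M)"
      unfolding P_def by (intro Bochner_Integration.integral_cong sublinear_scale p_sublinear) auto
    then show "P (\<lambda>t. scale r (a t)) \<le> r * P a" by (simp add: P_def)
  qed
  \<comment> \<open>The function 1_A v; on these functions the integral P is the integral of p t v
    over A.\<close>
  define S where "S A v t = (if t \<in> A then v else zero)" for A :: "'t set" and v t
  have S: "S A v \<in> X" if "A \<in> sets M" "v \<in> V" for A v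
  proof -
    have "A \<inter> space M \<in> sets M" using that by simp
    from simple_function_If_set[OF _ _ this, of "\<lambda>_. v" "\<lambda>_. zero"] show ?thesis
      using that zero_closed by (auto simp: X_def S_def[abs_def])
  qed
  have S_add: "S A (add v w) = (\<lambda>t. add (S A v t) (S A w t))" if "v \<in> V" "w \<in> V" for A v w
    using add_zero[OF zero_closed] by (auto simp: S_def)
  have S_scale: "S A (scale r v) = (\<lambda>t. scale r (S A v t))" for A r v
    by (auto simp: S_def scale_zero_right)
  have P_S: "P (S A v) = (\<integral>t. p t v * indicator A t \<partial>M)" for A v
    unfolding P_def
    by (rule Bochner_Integration.integral_cong)
      (auto simp: S_def indicator_def sublinear_zero p_sublinear)
  obtain t\<^sub>0 where t\<^sub>0: "t\<^sub>0 \<in> space M" using not_empty by auto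
  \<comment> \<open>The constants, set to zero outside \<open>space M\<close>. Evaluation at the
    fixed point \<open>t\<^sub>0\<close> recovers v, so the functional to be extended can be written
    as w \<mapsto> \<open>ip u (w t\<^sub>0)\<close>.\<close>
  define W where "W = S (space M) ` V"
  have "\<exists>l'. (\<forall>a\<in>X. \<forall>b\<in>X. l' (\<lambda>t. add (a t) (b t)) = l' a + l' b) \<and> (\<forall>a\<in>X. l' a \<le> P a) \<and>
    (\<forall>w\<in>W. l' w = ip u (w t\<^sub>0))"
  proof (rule X.hahn_banach_extension[OF P])
    show "W \<subseteq> X" "W \<noteq> {}" using S zero_closed by (auto simp: W_def)
    show "(\<lambda>t. add (a t) (b t)) \<in> W" if "a \<in> W" "b \<in> W" for a b
      using that S_add[symmetric] by (auto simp: W_def closed)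
    show "(\<lambda>t. scale r (a t)) \<in> W" if "a \<in> W" for r a
      using that by (auto simp: W_def closed S_scale[symmetric])
    have WV: "w t \<in> V" if "w \<in> W" for w t using that by (auto simp: W_def S_def zero_closed)
    show "ip u (add (a t\<^sub>0) (b t\<^sub>0)) = ip u (a t\<^sub>0) + ip u (b t\<^sub>0)" if "a \<in> W" "b \<in> W" for a b
      using WV that u by (simp add: ip_simps)
    show "ip u (scale r (a t\<^sub>0)) = r * ip u (a t\<^sub>0)" if "a \<in> W" for r a
      using WV that u by (simp add: ip_simps)
    show "ip u (a t\<^sub>0) \<le> P a" if a: "a \<in> W" for a
    proof -
      obtain v where v: "v \<in> V" "a = S (space M) v" using a by (auto simp: W_def)
      have "P a = (\<integral>t. p t v \<partial>M)"
        unfolding P_def v by (rule Bochner_Integration.integral_cong) (auto simp: S_def)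
      then show ?thesis using u_le v t\<^sub>0 by (simp add: S_def)
    qed
  qed
  then obtain l where l: "\<And>a b. a \<in> X \<Longrightarrow> b \<in> X \<Longrightarrow> l (\<lambda>t. add (a t) (b t)) = l a + l b"
    "\<And>a. a \<in> X \<Longrightarrow> l a \<le> P a" "\<And>w. w \<in> W \<Longrightarrow> l w = ip u (w t\<^sub>0)" by blast
  show thesis
  proof (rule that[of "\<lambda>A v. l (S A v)"])
    show "l (S A v) \<le> (\<integral>t. p t v * indicator A t \<partial>M)" if "A \<in> sets M" "v \<in> V" for A v
      using l(2)[OF S[OF that]] P_S by simp
    show "l (S A (add v w)) = l (S A v) + l (S A w)" if "A \<in> sets M" "v \<in> V" "w \<in> V" for A v w
      using l(1)[OF S S] that S_add by simp
    show "l (S (A \<union> B) v) = l (S A v) + l (S B v)"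
      if "A \<in> sets M" "B \<in> sets M" "A \<inter> B = {}" "v \<in> V" for A B v
    proof -
      have "S (A \<union> B) v = (\<lambda>t. add (S A v t) (S B v t))"
        using that(3,4) add_zero add_zero_right zero_closed by (auto simp: S_def fun_eq_iff)
      then show ?thesis using l(1)[OF S S] that by simp
    qed
    show "l (S (space M) v) = ip u v" if "v \<in> V" for v
      using l(3)[of "S (space M) v"] that t\<^sub>0 by (simp add: W_def S_def)
  qed
qed

theorem strassen:
  assumes M: "complete_measure M"
    and D: "countable D" "D \<subseteq> V" "D \<noteq> {}"
    and D_add: "\<And>v w. v \<in> D \<Longrightarrow> w \<in> D \<Longrightarrow> add v w \<in> D"
    and D_half: "\<And>v. v \<in> D \<Longrightarrow> scale (-1/2) v \<in> D"
    and dense: "\<And>v e. v \<in> V \<Longrightarrow> e > 0 \<Longrightarrow> \<exists>d\<in>D. dst v d < e"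
    and u: "u \<in> V" and u_le: "\<And>v. v \<in> V \<Longrightarrow> ip u v \<le> (\<integral>t. p t v \<partial>M)"
  obtains \<phi> where "\<And>t. t \<in> space M \<Longrightarrow> \<phi> t \<in> V"
    and "\<And>t v. t \<in> space M \<Longrightarrow> v \<in> V \<Longrightarrow> ip (\<phi> t) v \<le> p t v"
    and "\<And>v. v \<in> V \<Longrightarrow> (\<lambda>t. ip (\<phi> t) v) \<in> borel_measurable M"
    and "\<And>v. v \<in> V \<Longrightarrow> (\<integral>t. ip (\<phi> t) v \<partial>M) = ip u v"
proof -
  obtain \<mu> where \<mu>_le: "\<And>A v. A \<in> sets M \<Longrightarrow> v \<in> V \<Longrightarrow> \<mu> A v \<le> (\<integral>t. p t v * indicator A t \<partial>M)"
    and \<mu>_add: "\<And>A v w. A \<in> sets M \<Longrightarrow> v \<in> V \<Longrightarrow> w \<in> V \<Longrightarrow> \<mu> A (add v w) = \<mu> A v + \<mu> A w"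
    and \<mu>_Un: "\<And>A B v. A \<in> sets M \<Longrightarrow> B \<in> sets M \<Longrightarrow> A \<inter> B = {} \<Longrightarrow> v \<in> V \<Longrightarrow>
      \<mu> (A \<union> B) v = \<mu> A v + \<mu> B v"
    and \<mu>_space: "\<And>v. v \<in> V \<Longrightarrow> \<mu> (space M) v = ip u v"
    using additive_set_function_exists[OF u u_le] by blast
  have p_ind: "integrable M (\<lambda>t. p t v * indicator A t)" if "v \<in> V" "A \<in> sets M" for v A
    using that by (intro integrable_real_mult_indicator p_integrable)
  have \<mu>_neg: "\<mu> A (scale (-1) v) = - \<mu> A v" if "A \<in> sets M" "v \<in> V" for A v
    using \<mu>_add[OF that(1), of zero zero] \<mu>_add[OF that scale_closed[OF that(2), of "-1"]] that
    by (simp add: add_neg add_zero zero_closed)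
  \<comment> \<open>Radon-Nikodym is applied to the nonnegative set function \<open>?\<nu>\<close>,
    and g is p t v minus its nonnegative density; hence g <= p holds at every t. The dominating
    function p t v + p t (-v) comes from - \<mu> A v = \<mu> A (-v), which is at most the integral
    of p t (-v) over A.\<close>
  have "\<exists>g. integrable M g \<and> (\<forall>t. g t \<le> p t v) \<and>
    (\<forall>A\<in>sets M. (\<integral>t. g t * indicator A t \<partial>M) = \<mu> A v)" if v: "v \<in> V" for v
  proof -
    let ?\<nu> = "\<lambda>A. (\<integral>t. p t v * indicator A t \<partial>M) - \<mu> A v"
    have "\<exists>h. integrable M h \<and> (\<forall>t. 0 \<le> h t) \<and>
      (\<forall>A\<in>sets M. (\<integral>t. h t * indicator A t \<partial>M) = ?\<nu> A)"
    proof (rule density_of_dominated_additive)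
      show "integrable M (\<lambda>t. p t v + p t (scale (-1) v))"
        using v by (intro Bochner_Integration.integrable_add p_integrable closed)
      show "0 \<le> ?\<nu> A" if "A \<in> sets M" for A using \<mu>_le[OF that v] by simp
      show "?\<nu> A \<le> (\<integral>t. (p t v + p t (scale (-1) v)) * indicator A t \<partial>M)" if "A \<in> sets M" for A
        using \<mu>_le[OF that scale_closed[OF v, of "-1"]] \<mu>_neg[OF that v] that v
        by (simp add: distrib_right p_ind closed)
      show "?\<nu> (A \<union> B) = ?\<nu> A + ?\<nu> B" if "A \<in> sets M" "B \<in> sets M" "A \<inter> B = {}" for A B
      proof -
        have "p t v * indicator (A \<union> B) t = p t v * indicator A t + p t v * indicator B t" for t
          using that(3) by (auto simp: indicator_def)
        then show ?thesis using \<mu>_Un[OF that v] p_ind[OF v] that by simp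
      qed
    qed
    then obtain h where h: "integrable M h" "\<And>t. 0 \<le> h t"
      "\<And>A. A \<in> sets M \<Longrightarrow> (\<integral>t. h t * indicator A t \<partial>M) = ?\<nu> A" by blast
    have "(\<integral>t. (p t v - h t) * indicator A t \<partial>M) = \<mu> A v" if "A \<in> sets M" for A
      using h(3)[OF that] p_ind[OF v that] integrable_real_mult_indicator[OF that h(1)]
      by (simp add: left_diff_distrib)
    then show ?thesis using h p_integrable[OF v] by (intro exI[of _ "\<lambda>t. p t v - h t"]) auto
  qed
  then obtain g where g_int: "\<And>v. v \<in> V \<Longrightarrow> integrable M (g v)"
    and g_le: "\<And>v t. v \<in> V \<Longrightarrow> g v t \<le> p t v"
    and g_ind: "\<And>v A. v \<in> V \<Longrightarrow> A \<in> sets M \<Longrightarrow> (\<integral>t. g v t * indicator A t \<partial>M) = \<mu> A v"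
    by metis
  have g_add: "AE t in M. g (add v w) t = g v t + g w t" if vw: "v \<in> V" "w \<in> V" for v w
  proof (rule density_unique_real)
    fix A assume A: "A \<in> sets M"
    have "(\<integral>t. (g v t + g w t) * indicator A t \<partial>M) =
        (\<integral>t. g v t * indicator A t \<partial>M) + (\<integral>t. g w t * indicator A t \<partial>M)"
      using integrable_real_mult_indicator[OF A g_int] vw by (simp add: distrib_right)
    then show "(\<integral>t\<in>A. g (add v w) t \<partial>M) = (\<integral>t\<in>A. (g v t + g w t) \<partial>M)"
      using vw A \<mu>_add[OF A vw] g_ind[OF _ A]
      by (simp add: set_lebesgue_integral_def mult.commute[of "indicator A _"] closed)
  qed (use vw g_int in \<open>auto simp: closed\<close>)
  \<comment> \<open>Each additivity relation fails on a null set only, and D has countably many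
    pairs, so almost every t is good.\<close>
  define good where "good t \<longleftrightarrow> (\<forall>(v, w)\<in>D \<times> D. g (add v w) t = g v t + g w t)" for t
  have AE_good: "AE t in M. good t"
    unfolding good_def using D g_add by (subst AE_ball_countable) auto
  have "\<exists>k. k \<in> V \<and> (\<forall>v\<in>V. ip k v \<le> p t v) \<and> (good t \<longrightarrow> (\<forall>d\<in>D. ip k d = g d t))"
    if t: "t \<in> space M" for t
  proof (cases "good t")
    case True
    have "\<exists>k\<in>V. \<forall>d\<in>D. ip k d = g d t"
    proof (rule riesz[of D _ "L t"])
      show "g (add v w) t = g v t + g w t" if "v \<in> D" "w \<in> D" for v w
        using True that by (auto simp: good_def)
      show "g v t \<le> L t * nrm v" if "v \<in> D" for v
        using g_le[of v t] p_le[OF t, of v] that D by (meson order_trans subsetD)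
    qed (use D D_add D_half in auto)
    then obtain k where k: "k \<in> V" "\<And>d. d \<in> D \<Longrightarrow> ip k d = g d t" by blast
    have "ip k v \<le> p t v" if "v \<in> V" for v
      by (rule ip_le_p_dense[OF t k(1) D(2) dense]) (use k g_le D that in auto)
    then show ?thesis using k by blast
  next
    case False
    then show ?thesis using subgradient_exists[OF t] by blast
  qed
  then obtain \<phi> where \<phi>_V: "\<And>t. t \<in> space M \<Longrightarrow> \<phi> t \<in> V"
    and \<phi>_le: "\<And>t v. t \<in> space M \<Longrightarrow> v \<in> V \<Longrightarrow> ip (\<phi> t) v \<le> p t v"
    and \<phi>_D: "\<And>t d. t \<in> space M \<Longrightarrow> good t \<Longrightarrow> d \<in> D \<Longrightarrow> ip (\<phi> t) d = g d t"
    by metis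
  have \<phi>_AE: "AE t in M. g d t = ip (\<phi> t) d" if "d \<in> D" for d
    using AE_good AE_space by eventually_elim (use \<phi>_D that in auto)
  have \<phi>_meas_D: "(\<lambda>t. ip (\<phi> t) d) \<in> borel_measurable M" if "d \<in> D" for d
    by (rule complete_measure.borel_measurable_cong_AE[OF M _ \<phi>_AE[OF that]])
      (use g_int that D in auto)
  have \<phi>_int_D: "(\<integral>t. ip (\<phi> t) d \<partial>M) = ip u d" if d: "d \<in> D" for d
  proof -
    have dV: "d \<in> V" using d D by auto
    have "(\<integral>t. ip (\<phi> t) d \<partial>M) = (\<integral>t. g d t \<partial>M)"
      by (rule integral_cong_AE[OF \<phi>_meas_D[OF d]]) (use \<phi>_AE[OF d] g_int[OF dV] in auto)
    also have "\<dots> = (\<integral>t. g d t * indicator (space M) t \<partial>M)"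
      by (rule Bochner_Integration.integral_cong) auto
    also have "\<dots> = ip u d" using g_ind[OF dV sets.top] \<mu>_space[OF dV] by simp
    finally show ?thesis .
  qed
  \<comment> \<open>Measurability and the integral formula pass from D to V along a sequence that
    approximates v. Its members are within distance 1 of v, which explains the dominating factor
    \<open>nrm v + 1\<close>.\<close>
  have lim: "(\<lambda>t. ip (\<phi> t) v) \<in> borel_measurable M \<and> (\<integral>t. ip (\<phi> t) v \<partial>M) = ip u v" if v: "v \<in> V" for v
  proof -
    have "\<exists>d\<in>D. dst v d < inverse (real (Suc n))" for n using dense[OF v] by simp
    then obtain d where d: "\<And>n. d n \<in> D" "\<And>n. dst v (d n) < inverse (real (Suc n))" by metis
    have dV: "d n \<in> V" for n using d D by auto
    have d0: "(\<lambda>n. dst (d n) v) \<longlonglongrightarrow> 0"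
      by (rule tendsto_sandwich[OF _ _ tendsto_const LIMSEQ_inverse_real_of_nat])
        (use d dV v in \<open>auto intro!: always_eventually less_imp_le simp: dst_commute[of _ v]\<close>)
    have conv: "(\<lambda>n. ip k (d n)) \<longlonglongrightarrow> ip k v" if "k \<in> V" for k
      by (rule tendsto_ip_dst[OF _ v that d0]) (use dV in auto)
    have meas: "(\<lambda>t. ip (\<phi> t) v) \<in> borel_measurable M"
      by (rule borel_measurable_LIMSEQ_real[OF conv[OF \<phi>_V] \<phi>_meas_D[OF d(1)]])
    have "(\<lambda>n. \<integral>t. ip (\<phi> t) (d n) \<partial>M) \<longlonglongrightarrow> (\<integral>t. ip (\<phi> t) v \<partial>M)"
    proof (rule integral_dominated_convergence[where w="\<lambda>t. \<bar>L t\<bar> * (nrm v + 1)"])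
      show "AE t in M. (\<lambda>n. ip (\<phi> t) (d n)) \<longlonglongrightarrow> ip (\<phi> t) v"
        using conv \<phi>_V by (auto intro: AE_I2)
      have "\<bar>ip (\<phi> t) (d n)\<bar> \<le> \<bar>L t\<bar> * (nrm v + 1)" if t: "t \<in> space M" for t n
      proof -
        have "inverse (real (Suc n)) \<le> 1" by (simp add: field_simps)
        then have "dst v (d n) \<le> 1" using d(2)[of n] by linarith
        then have nd: "nrm (d n) \<le> nrm v + 1"
          using nrm_le_dst[OF dV v, of n] dst_commute[OF dV v, of n] by simp
        have "\<bar>ip (\<phi> t) (d n)\<bar> \<le> L t * nrm (d n)"
          using \<phi>_le[OF t dV, of n] \<phi>_le[OF t scale_closed[OF dV], of "-1" n] p_le[OF t dV, of n]
            p_le[OF t scale_closed[OF dV], of "-1" n] \<phi>_V[OF t] dV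
          by (simp add: nrm_scale ip_scale_right abs_le_iff)
        also have "\<dots> \<le> \<bar>L t\<bar> * (nrm v + 1)" using nd dV by (intro mult_mono) auto
        finally show ?thesis .
      qed
      then show "AE t in M. norm (ip (\<phi> t) (d n)) \<le> \<bar>L t\<bar> * (nrm v + 1)" for n
        by (intro AE_I2) simp
      show "(\<lambda>t. ip (\<phi> t) v) \<in> borel_measurable M" by (rule meas)
      show "(\<lambda>t. ip (\<phi> t) (d n)) \<in> borel_measurable M" for n by (rule \<phi>_meas_D[OF d(1)])
      show "integrable M (\<lambda>t. \<bar>L t\<bar> * (nrm v + 1))" using L_integrable by simp
    qed
    then have "(\<lambda>n. ip u (d n)) \<longlonglongrightarrow> (\<integral>t. ip (\<phi> t) v \<partial>M)" using \<phi>_int_D d by simp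
    then show ?thesis using meas conv[OF u] LIMSEQ_unique by blast
  qed
  show thesis by (rule that[of \<phi>]) (use \<phi>_V \<phi>_le lim in auto)
qed

end

section \<open>Completions and transport of structure\<close>

text \<open>An isometry \<phi> need not map z to zero, so it is replaced by its translate \<psi>,
  which has the same differences, with inverse \<theta>. Since r is the distance from z,
  polarization identifies g with the inner product of the images under \<psi>. All operations are
  then pulled back along \<psi>.\<close>

lemma isometric_to_hilbert_transport:
  assumes iso: "isometric_to_hilbert C d" and z: "z \<in> C"
    and d: "\<And>a b. a \<in> C \<Longrightarrow> b \<in> C \<Longrightarrow> (d a b)\<^sup>2 = (r a)\<^sup>2 + (r b)\<^sup>2 - 2 * g a b"
    and rz: "r z = 0" and gz: "\<And>a. a \<in> C \<Longrightarrow> g a z = 0"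
  obtains add scale where "hilbert_space_on C add z scale g"
proof -
  obtain V :: "'a set" and add zero scale ip \<phi> where H: "hilbert_space_on V add zero scale ip"
    and bij: "bij_betw \<phi> C V"
    and iso: "\<forall>a\<in>C. \<forall>b\<in>C. sqrt (ip (add (\<phi> a) (scale (-1) (\<phi> b))) (add (\<phi> a) (scale (-1) (\<phi> b)))) = d a b"
    using iso unfolding isometric_to_hilbert_def isometric_spaces_def by blast
  interpret hilbert_space_on V add zero scale ip by (fact H)
  have \<phi>V: "\<phi> a \<in> V" if "a \<in> C" for a using bij that by (auto dest: bij_betwE)
  define \<psi> where "\<psi> a = add (\<phi> a) (scale (-1) (\<phi> z))" for a
  define \<theta> where "\<theta> v = inv_into C \<phi> (add v (\<phi> z))" for v
  have \<psi>V: "\<psi> a \<in> V" if "a \<in> C" for a using \<phi>V that z by (auto simp: \<psi>_def closed)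
  have \<theta>C: "\<theta> v \<in> C" if "v \<in> V" for v
    unfolding \<theta>_def
    by (rule inv_into_into) (use bij that \<phi>V[OF z] in \<open>simp add: closed bij_betw_def\<close>)
  have \<psi>\<theta>: "\<psi> (\<theta> v) = v" if "v \<in> V" for v
    using bij_betw_inv_into_right[OF bij] that \<phi>V[OF z]
    by (simp add: \<psi>_def \<theta>_def closed add_neg_cancel)
  have \<theta>\<psi>: "\<theta> (\<psi> a) = a" if "a \<in> C" for a
    using bij_betw_inv_into_left[OF bij that] \<phi>V z that
    by (simp add: \<psi>_def \<theta>_def add_neg_cancel2)
  have dist: "dst (\<psi> a) (\<psi> b) = d a b" if "a \<in> C" "b \<in> C" for a b
  proof -
    have "add (\<psi> a) (scale (-1) (\<psi> b)) = add (\<phi> a) (scale (-1) (\<phi> b))"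
      using \<phi>V that z by (intro ip_ext) (simp_all add: \<psi>_def ip_simps)
    then show ?thesis using iso that by (simp add: dst_def nrm_def)
  qed
  have \<psi>z: "\<psi> z = zero" using add_neg \<phi>V[OF z] by (simp add: \<psi>_def)
  have g: "g a b = ip (\<psi> a) (\<psi> b)" if ab: "a \<in> C" "b \<in> C" for a b
  proof -
    have norm: "ip (\<psi> c) (\<psi> c) = (r c)\<^sup>2" if "c \<in> C" for c
      using d[OF that z] dist[OF that z] dst_square[OF \<psi>V[OF that] zero_closed] gz[OF that] \<psi>V[OF that]
      by (simp add: \<psi>z rz nrm_square zero_closed)
    show ?thesis
      using d[OF ab] dist[OF ab] dst_square[OF \<psi>V[OF ab(1)] \<psi>V[OF ab(2)]] norm[OF ab(1)] norm[OF ab(2)]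
      by simp
  qed
  define add' where "add' a b = \<theta> (add (\<psi> a) (\<psi> b))" for a b
  define scale' where "scale' r a = \<theta> (scale r (\<psi> a))" for r a
  have \<psi>_add: "\<psi> (add' a b) = add (\<psi> a) (\<psi> b)" "add' a b \<in> C" if "a \<in> C" "b \<in> C" for a b
    using that \<psi>V by (auto simp: add'_def \<psi>\<theta> \<theta>C closed)
  have \<psi>_scale: "\<psi> (scale' r a) = scale r (\<psi> a)" "scale' r a \<in> C" if "a \<in> C" for r a
    using that \<psi>V by (auto simp: scale'_def \<psi>\<theta> \<theta>C closed)
  note \<psi>_simps = \<psi>_add \<psi>_scale z \<psi>V \<psi>z
  have eqI: "a = b" if "\<psi> a = \<psi> b" "a \<in> C" "b \<in> C" for a b
    using that \<theta>\<psi> by metis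
  have "hilbert_space_on C add' z scale' g"
  proof
    show "complete_on C (\<lambda>v w. sqrt (g (add' v (scale' (-1) w)) (add' v (scale' (-1) w))))"
      unfolding complete_on_def
    proof (intro ballI)
      fix \<sigma> assume \<sigma>: "\<sigma> \<in> cauchy_seqs C (\<lambda>v w. sqrt (g (add' v (scale' (-1) w)) (add' v (scale' (-1) w))))"
      have dd: "sqrt (g (add' v (scale' (-1) w)) (add' v (scale' (-1) w))) = dst (\<psi> v) (\<psi> w)"
        if "v \<in> C" "w \<in> C" for v w
        using that by (simp add: g \<psi>_simps dst_def nrm_def)
      have \<sigma>C: "\<sigma> n \<in> C" for n using \<sigma> by (auto simp: cauchy_seqs_def)
      then have "(\<lambda>n. \<psi> (\<sigma> n)) \<in> cauchy_seqs V dst"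
        using \<sigma> unfolding cauchy_seqs_def by (simp add: dd[OF \<sigma>C \<sigma>C] \<psi>V image_subset_iff)
      from complete_dst[unfolded complete_on_def, THEN bspec, OF this]
      obtain a where a: "a \<in> V" "(\<lambda>n. dst (\<psi> (\<sigma> n)) a) \<longlonglongrightarrow> 0" ..
      then show "\<exists>a\<in>C. (\<lambda>n. sqrt (g (add' (\<sigma> n) (scale' (-1) a)) (add' (\<sigma> n) (scale' (-1) a)))) \<longlonglongrightarrow> 0"
        using \<sigma>C by (intro bexI[of _ "\<theta> a"]) (simp_all add: dd[OF \<sigma>C \<theta>C] \<theta>C \<psi>\<theta>)
    qed
    show "v = z" if "v \<in> C" "g v v = 0" for v
      using that ip_definite[of "\<psi> v"] by (intro eqI[of v z]) (simp_all add: g \<psi>_simps)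
    show "add' (add' u v) w = add' u (add' v w)" if "u \<in> C" "v \<in> C" "w \<in> C" for u v w
      by (rule eqI) (use that in \<open>simp_all add: \<psi>_simps add_assoc\<close>)
    show "add' v w = add' w v" if "v \<in> C" "w \<in> C" for v w
      by (rule eqI) (use that in \<open>simp_all add: \<psi>_simps add_commute\<close>)
    show "add' z v = v" if "v \<in> C" for v
      by (rule eqI) (use that in \<open>simp_all add: \<psi>_simps add_zero\<close>)
    show "add' v (scale' (-1) v) = z" if "v \<in> C" for v
      by (rule eqI) (use that in \<open>simp_all add: \<psi>_simps add_neg\<close>)
    show "scale' 1 v = v" if "v \<in> C" for v
      by (rule eqI) (use that in \<open>simp_all add: \<psi>_simps scale_one\<close>)
    show "scale' r (scale' s v) = scale' (r * s) v" if "v \<in> C" for r s v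
      by (rule eqI) (use that in \<open>simp_all add: \<psi>_simps scale_scale\<close>)
    show "scale' (r + s) v = add' (scale' r v) (scale' s v)" if "v \<in> C" for r s v
      by (rule eqI) (use that in \<open>simp_all add: \<psi>_simps scale_add_left\<close>)
    show "scale' r (add' v w) = add' (scale' r v) (scale' r w)" if "v \<in> C" "w \<in> C" for r v w
      by (rule eqI) (use that in \<open>simp_all add: \<psi>_simps scale_add_right\<close>)
    show "g v w = g w v" if "v \<in> C" "w \<in> C" for v w
      using that ip_commute by (simp add: g \<psi>_simps)
  qed (simp_all add: \<psi>_simps g ip_nonneg ip_simps)
  then show thesis by (rule that)
qed

section \<open>Pseudometrics, their quotients and completions\<close>

locale pseudometric_on =
  fixes S :: "'a set" and d :: "'a \<Rightarrow> 'a \<Rightarrow> real"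
  assumes refl_zero: "a \<in> S \<Longrightarrow> d a a = 0"
    and commute: "a \<in> S \<Longrightarrow> b \<in> S \<Longrightarrow> d a b = d b a"
    and triangle: "a \<in> S \<Longrightarrow> b \<in> S \<Longrightarrow> c \<in> S \<Longrightarrow> d a c \<le> d a b + d b c"
begin

lemma nonneg: "a \<in> S \<Longrightarrow> b \<in> S \<Longrightarrow> 0 \<le> d a b"
  using triangle[of a b a] refl_zero[of a] commute[of a b] by simp

lemma equiv_zero_dist_rel: "equiv S (zero_dist_rel S d)"
proof (rule equivI)
  show "refl_on S (zero_dist_rel S d)" by (auto simp: refl_on_def zero_dist_rel_def refl_zero)
  show "sym (zero_dist_rel S d)" by (auto simp: sym_def zero_dist_rel_def commute)
  show "trans (zero_dist_rel S d)"
  proof (rule transI, unfold zero_dist_rel_def, safe)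
    fix a b c assume "a \<in> S" "b \<in> S" "d a b = 0" "c \<in> S" "d b c = 0"
    then show "d a c = 0" using triangle[of a b c] nonneg[of a c] by simp
  qed
qed (auto simp: zero_dist_rel_def)

lemma quot_class_in: "a \<in> S \<Longrightarrow> quot_class S d a \<in> quot_space S d"
  by (simp add: quot_class_def quot_space_def quotientI)

lemma quot_spaceE:
  assumes "A \<in> quot_space S d" obtains a where "a \<in> S" "A = quot_class S d a"
  using assms by (auto simp: quot_space_def quot_class_def elim: quotientE)

lemma quot_class_eq: "a \<in> S \<Longrightarrow> b \<in> S \<Longrightarrow> d a b = 0 \<Longrightarrow> quot_class S d a = quot_class S d b"
  unfolding quot_class_def
  by (rule equiv_class_eq[OF equiv_zero_dist_rel]) (simp add: zero_dist_rel_def)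

text \<open>The representatives chosen by \<open>quot_dist\<close> have distance 0 from a and b, and
  the triangle inequality, used in both directions, shows that such a change does not affect the
  distance.\<close>

lemma quot_dist_class:
  assumes "a \<in> S" "b \<in> S"
  shows "quot_dist d (quot_class S d a) (quot_class S d b) = d a b"
proof -
  have *: "(SOME a'. a' \<in> quot_class S d a) \<in> S \<and> d a (SOME a'. a' \<in> quot_class S d a) = 0" if "a \<in> S" for a
    using someI[of "\<lambda>a'. a' \<in> quot_class S d a" a] that refl_zero[OF that]
    by (simp add: quot_class_def zero_dist_rel_def)
  define a' b' where "a' = (SOME a'. a' \<in> quot_class S d a)" and "b' = (SOME b'. b' \<in> quot_class S d b)"
  have "a' \<in> S" "b' \<in> S" "d a a' = 0" "d b b' = 0"
    using *[OF assms(1)] *[OF assms(2)] by (auto simp: a'_def b'_def)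
  then have "d a' b' = d a b"
    using assms triangle[of a' a b'] triangle[of a b b'] triangle[of a a' b] triangle[of a' b' b]
      commute[of a a'] commute[of b b'] by linarith
  then show ?thesis by (simp add: quot_dist_def a'_def b'_def)
qed

lemma pseudometric_on_quot_space: "pseudometric_on (quot_space S d) (quot_dist d)"
proof
  fix A B C assume "A \<in> quot_space S d" "B \<in> quot_space S d" "C \<in> quot_space S d"
  then show "quot_dist d A C \<le> quot_dist d A B + quot_dist d B C"
    by (elim quot_spaceE) (simp add: quot_dist_class triangle)
next
  fix A B assume "A \<in> quot_space S d" "B \<in> quot_space S d"
  then show "quot_dist d A B = quot_dist d B A"
    by (elim quot_spaceE) (simp add: quot_dist_class commute)
next
  fix A assume "A \<in> quot_space S d"
  then show "quot_dist d A A = 0"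
    by (elim quot_spaceE) (simp add: quot_dist_class refl_zero)
qed

lemma cauchy_seqs_in: "\<sigma> \<in> cauchy_seqs S d \<Longrightarrow> \<sigma> n \<in> S"
  by (auto simp: cauchy_seqs_def)

lemma cauchy_seqsD:
  "\<sigma> \<in> cauchy_seqs S d \<Longrightarrow> 0 < e \<Longrightarrow> \<exists>N. \<forall>m\<ge>N. \<forall>n\<ge>N. d (\<sigma> m) (\<sigma> n) < e"
  by (simp add: cauchy_seqs_def)

text \<open>Justifies the \<open>lim\<close> in \<open>lim_dist\<close>: the distances form a Cauchy
  sequence of reals, because they change from m to n by at most d (\<sigma> m) (\<sigma> n) + d
  (\<rho> m) (\<rho> n).\<close>

lemma tendsto_lim_dist:
  assumes "\<sigma> \<in> cauchy_seqs S d" "\<rho> \<in> cauchy_seqs S d"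
  shows "(\<lambda>n. d (\<sigma> n) (\<rho> n)) \<longlonglongrightarrow> lim_dist d \<sigma> \<rho>"
proof -
  note in_S = cauchy_seqs_in[OF assms(1)] cauchy_seqs_in[OF assms(2)]
  have "Cauchy (\<lambda>n. d (\<sigma> n) (\<rho> n))"
  proof (rule metric_CauchyI)
    fix e :: real assume e: "e > 0"
    then have "e / 2 > 0" by simp
    obtain N where N: "\<And>m n. m \<ge> N \<Longrightarrow> n \<ge> N \<Longrightarrow> d (\<sigma> m) (\<sigma> n) < e / 2"
      using cauchy_seqsD[OF assms(1) \<open>e / 2 > 0\<close>] by blast
    obtain N' where N': "\<And>m n. m \<ge> N' \<Longrightarrow> n \<ge> N' \<Longrightarrow> d (\<rho> m) (\<rho> n) < e / 2"
      using cauchy_seqsD[OF assms(2) \<open>e / 2 > 0\<close>] by blast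
    have "dist (d (\<sigma> m) (\<rho> m)) (d (\<sigma> n) (\<rho> n)) < e" if "m \<ge> max N N'" "n \<ge> max N N'" for m n
    proof -
      have "d (\<sigma> m) (\<sigma> n) < e / 2" "d (\<rho> m) (\<rho> n) < e / 2" using N N' that by auto
      moreover have "d (\<sigma> m) (\<rho> m) \<le> d (\<sigma> m) (\<sigma> n) + (d (\<sigma> n) (\<rho> n) + d (\<rho> m) (\<rho> n))"
        using triangle[of "\<sigma> m" "\<sigma> n" "\<rho> m"] triangle[of "\<sigma> n" "\<rho> n" "\<rho> m"] in_S
          commute[of "\<rho> n" "\<rho> m"] by simp
      moreover have "d (\<sigma> n) (\<rho> n) \<le> d (\<sigma> m) (\<sigma> n) + (d (\<sigma> m) (\<rho> m) + d (\<rho> m) (\<rho> n))"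
        using triangle[of "\<sigma> n" "\<sigma> m" "\<rho> n"] triangle[of "\<sigma> m" "\<rho> m" "\<rho> n"] in_S
          commute[of "\<sigma> n" "\<sigma> m"] by simp
      ultimately show ?thesis by (simp add: dist_real_def)
    qed
    then show "\<exists>N. \<forall>m\<ge>N. \<forall>n\<ge>N. dist (d (\<sigma> m) (\<rho> m)) (d (\<sigma> n) (\<rho> n)) < e" by blast
  qed
  then show ?thesis
    unfolding lim_dist_def by (simp add: real_Cauchy_convergent convergent_LIMSEQ_iff[symmetric])
qed

lemma pseudometric_on_cauchy_seqs: "pseudometric_on (cauchy_seqs S d) (lim_dist d)"
proof
  fix \<sigma> assume \<sigma>: "\<sigma> \<in> cauchy_seqs S d"
  show "lim_dist d \<sigma> \<sigma> = 0"
    using tendsto_lim_dist[OF \<sigma> \<sigma>] refl_zero[OF cauchy_seqs_in[OF \<sigma>]]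
    by (simp add: LIMSEQ_const_iff)
next
  fix \<sigma> \<rho> assume "\<sigma> \<in> cauchy_seqs S d" "\<rho> \<in> cauchy_seqs S d"
  then show "lim_dist d \<sigma> \<rho> = lim_dist d \<rho> \<sigma>"
    unfolding lim_dist_def using cauchy_seqs_in commute by simp
next
  fix \<sigma> \<rho> \<tau> assume *: "\<sigma> \<in> cauchy_seqs S d" "\<rho> \<in> cauchy_seqs S d" "\<tau> \<in> cauchy_seqs S d"
  show "lim_dist d \<sigma> \<tau> \<le> lim_dist d \<sigma> \<rho> + lim_dist d \<rho> \<tau>"
    by (rule LIMSEQ_le[OF tendsto_lim_dist tendsto_add[OF tendsto_lim_dist tendsto_lim_dist]])
      (use * cauchy_seqs_in triangle in auto)
qed

lemma const_cauchy: "a \<in> S \<Longrightarrow> (\<lambda>_. a) \<in> cauchy_seqs S d"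
  by (auto simp: cauchy_seqs_def refl_zero)

lemma completion_embed_in: "a \<in> S \<Longrightarrow> completion_embed S d a \<in> completion_space S d"
  unfolding completion_embed_def completion_space_def
  by (intro pseudometric_on.quot_class_in pseudometric_on_cauchy_seqs const_cauchy)

lemma completion_dist_embed:
  "a \<in> S \<Longrightarrow> b \<in> S \<Longrightarrow> completion_dist d (completion_embed S d a) (completion_embed S d b) = d a b"
  unfolding completion_embed_def completion_dist_def
  by (subst pseudometric_on.quot_dist_class[OF pseudometric_on_cauchy_seqs])
    (simp_all add: const_cauchy lim_dist_def)

lemma completion_embed_dense:
  assumes \<xi>: "\<xi> \<in> completion_space S d" and e: "e > 0"
  shows "\<exists>a\<in>S. completion_dist d \<xi> (completion_embed S d a) < e"
proof -
  obtain \<sigma> where \<sigma>: "\<sigma> \<in> cauchy_seqs S d" "\<xi> = quot_class (cauchy_seqs S d) (lim_dist d) \<sigma>"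
    using \<xi> unfolding completion_space_def
    by (rule pseudometric_on.quot_spaceE[OF pseudometric_on_cauchy_seqs])
  \<comment> \<open>A late term of the sequence approximates its class. The limit preserves only
    weak inequalities, hence the bound e / 2.\<close>
  have "e / 2 > 0" using e by simp
  then obtain N where N: "\<And>m n. m \<ge> N \<Longrightarrow> n \<ge> N \<Longrightarrow> d (\<sigma> m) (\<sigma> n) < e / 2"
    using cauchy_seqsD[OF \<sigma>(1)] by blast
  have N_in: "\<sigma> N \<in> S" by (rule cauchy_seqs_in[OF \<sigma>(1)])
  have "completion_dist d \<xi> (completion_embed S d (\<sigma> N)) = lim_dist d \<sigma> (\<lambda>_. \<sigma> N)"
    unfolding completion_embed_def completion_dist_def \<sigma>(2)
    by (rule pseudometric_on.quot_dist_class[OF pseudometric_on_cauchy_seqs \<sigma>(1) const_cauchy[OF N_in]])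
  also have "\<dots> \<le> e / 2"
    by (rule LIMSEQ_le_const2[OF tendsto_lim_dist[OF \<sigma>(1) const_cauchy[OF N_in]]])
      (use N in \<open>auto intro!: exI[of _ N] less_imp_le\<close>)
  finally show ?thesis using e N_in by (intro bexI[of _ "\<sigma> N"]) auto
qed

end

section \<open>Angles in Hadamard spaces\<close>

lemma geodesic_dist: "geodesic l \<gamma> \<Longrightarrow> s \<in> {0..l} \<Longrightarrow> t \<in> {0..l} \<Longrightarrow> dist (\<gamma> s) (\<gamma> t) = \<bar>s - t\<bar>"
  by (simp add: geodesic_def)

lemma geodesic_restrict: "geodesic l \<gamma> \<Longrightarrow> 0 \<le> s \<Longrightarrow> s \<le> l \<Longrightarrow> geodesic s \<gamma>"
  by (auto simp: geodesic_def)

lemma hadamard_space_ineq: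
  assumes "hadamard_space TYPE('h::complete_space)" "geodesic l \<gamma>" "0 \<le> t" "t \<le> 1"
  shows "(dist (\<gamma> (t * l)) (z :: 'h))\<^sup>2 \<le> (1 - t) * (dist (\<gamma> 0) z)\<^sup>2 + t * (dist (\<gamma> l) z)\<^sup>2 - t * (1 - t) * l\<^sup>2"
proof -
  have "dist (\<gamma> 0) (\<gamma> l) = l" using assms(2) by (auto simp: geodesic_def)
  then show ?thesis using assms unfolding hadamard_space_def by metis
qed

text \<open>In the Hadamard inequality for \<gamma>, take for the free point the one of \<eta> with
  the same parameter. Its distances to the end points are t l and (1 - t) l, and the right-hand side
  becomes t (1 - t) (t + (1 - t) - 1) l^2 = 0.\<close>

lemma geodesic_unique:
  fixes \<gamma> \<eta> :: "real \<Rightarrow> 'h::complete_space"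
  assumes H: "hadamard_space TYPE('h)" and g: "geodesic l \<gamma>" "geodesic l \<eta>"
    and eq: "\<gamma> 0 = \<eta> 0" "\<gamma> l = \<eta> l" and s: "s \<in> {0..l}"
  shows "\<gamma> s = \<eta> s"
proof (cases "l = 0")
  case True
  then show ?thesis using s eq by simp
next
  case False
  then have l: "l > 0" using s by simp
  define t where "t = s / l"
  have t: "0 \<le> t" "t \<le> 1" "t * l = s" using s l by (auto simp: t_def)
  have "dist (\<gamma> 0) (\<eta> s) = t * l" "dist (\<gamma> l) (\<eta> s) = (1 - t) * l"
    using geodesic_dist[OF g(2), of 0 s] geodesic_dist[OF g(2), of l s] s l t eq
    by (auto simp: algebra_simps)
  then have "(dist (\<gamma> s) (\<eta> s))\<^sup>2 \<le> (1 - t) * (t * l)\<^sup>2 + t * ((1 - t) * l)\<^sup>2 - t * (1 - t) * l\<^sup>2"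
    using hadamard_space_ineq[OF H g(1) t(1,2), of "\<eta> s"] t by simp
  also have "\<dots> = 0" by (simp add: power2_eq_square algebra_simps)
  finally show ?thesis by simp
qed

text \<open>The argument of \<open>arccos\<close> in \<open>comparison_angle\<close>. Monotonicity
  and limits are established for it, and \<open>arccos\<close> is applied only to the limit, in
  \<open>geod_angle_props\<close>.\<close>

definition comparison_cos :: "'a::metric_space \<Rightarrow> 'a \<Rightarrow> 'a \<Rightarrow> real" where
  "comparison_cos x y z = ((dist x y)\<^sup>2 + (dist x z)\<^sup>2 - (dist y z)\<^sup>2) / (2 * dist x y * dist x z)"

lemma comparison_cos_commute: "comparison_cos x y z = comparison_cos x z y"
  by (simp add: comparison_cos_def dist_commute mult.commute add.commute)

lemma abs_comparison_cos_le: 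
  assumes "y \<noteq> x" "z \<noteq> x" shows "\<bar>comparison_cos x y z\<bar> \<le> 1"
proof -
  let ?a = "dist x y" and ?b = "dist x z" and ?c = "dist y z"
  have pos: "?a > 0" "?b > 0" using assms by auto
  have "?c \<le> ?a + ?b" using dist_triangle[of y z x] by (simp add: dist_commute)
  then have up: "?c\<^sup>2 \<le> (?a + ?b)\<^sup>2" by (intro power_mono) auto
  have "\<bar>?a - ?b\<bar> \<le> ?c"
    using dist_triangle[of x y z] dist_triangle[of x z y] by (simp add: dist_commute abs_le_iff)
  then have "\<bar>?a - ?b\<bar>\<^sup>2 \<le> ?c\<^sup>2" by (intro power_mono) auto
  then have lo: "(?a - ?b)\<^sup>2 \<le> ?c\<^sup>2" by simp
  show ?thesis unfolding comparison_cos_def using up lo pos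
    by (simp add: abs_le_iff divide_le_eq le_divide_eq power2_sum power2_diff minus_divide_left)
qed

text \<open>The Hadamard inequality at the point with t = s' / s rearranges to t (s^2 + D^2 - E^2)
  <= s'^2 + D^2 - E'^2; division by 2 s' D gives the claim.\<close>

lemma comparison_cos_mono:
  fixes x :: "'h::complete_space"
  assumes H: "hadamard_space TYPE('h)" and g: "geodesic s \<gamma>" "\<gamma> 0 = x"
    and s: "0 < s'" "s' \<le> s" and y: "y \<noteq> x"
  shows "comparison_cos x (\<gamma> s) y \<le> comparison_cos x (\<gamma> s') y"
proof -
  define t where "t = s' / s"
  have t: "0 < t" "t \<le> 1" "t * s = s'" using s by (auto simp: t_def)
  have ds: "dist x (\<gamma> s) = s" "dist x (\<gamma> s') = s'"
    using geodesic_dist[OF g(1), of 0 s] geodesic_dist[OF g(1), of 0 s'] g(2) s by auto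
  define D where "D = dist x y"
  define E where "E = dist (\<gamma> s) y"
  define E' where "E' = dist (\<gamma> s') y"
  have D: "D > 0" using y by (auto simp: D_def)
  have "E'\<^sup>2 \<le> (1 - t) * D\<^sup>2 + t * E\<^sup>2 - t * (1 - t) * s\<^sup>2"
    using hadamard_space_ineq[OF H g(1), of t y] t g(2) by (simp add: D_def E_def E'_def)
  then have "t * (s\<^sup>2 + D\<^sup>2 - E\<^sup>2) \<le> s'\<^sup>2 + D\<^sup>2 - E'\<^sup>2"
    unfolding t(3)[symmetric] by (simp add: power2_eq_square algebra_simps)
  then have "t * (s\<^sup>2 + D\<^sup>2 - E\<^sup>2) / (2 * s' * D) \<le> (s'\<^sup>2 + D\<^sup>2 - E'\<^sup>2) / (2 * s' * D)"
    using s D by (intro divide_right_mono) auto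
  moreover have "t * (s\<^sup>2 + D\<^sup>2 - E\<^sup>2) / (2 * s' * D) = (s\<^sup>2 + D\<^sup>2 - E\<^sup>2) / (2 * s * D)"
    using t s D unfolding t(3)[symmetric] by simp
  ultimately show ?thesis by (simp add: comparison_cos_def ds D_def E_def E'_def)
qed

locale hadamard_point =
  fixes x :: "'h::complete_space"
  assumes hadamard: "hadamard_space TYPE('h)"
begin

abbreviation "geods \<equiv> geodesics_from x"

lemma geods_start: "p \<in> geods \<Longrightarrow> snd p 0 = x"
  and geods_geodesic: "p \<in> geods \<Longrightarrow> geodesic (fst p) (snd p)"
  by (auto simp: geodesics_from_def)

lemma geods_dist:
  assumes "p \<in> geods" "0 \<le> s" "s \<le> fst p"
  shows "dist x (snd p s) = s" "dist (snd p s) x = s"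
  using assms geodesic_dist[of "fst p" "snd p" 0 s]
  by (auto simp: geodesics_from_def dist_commute)

lemma geods_neq: "p \<in> geods \<Longrightarrow> 0 < s \<Longrightarrow> s \<le> fst p \<Longrightarrow> snd p s \<noteq> x"
  using geods_dist(1)[of p s] by auto

lemma geods_pos: "p \<in> geods \<Longrightarrow> 0 < fst p"
  by (auto simp: geodesics_from_def)

lemma comparison_cos_geods_mono:
  assumes p: "p \<in> geods" and q: "q \<in> geods"
    and s: "0 < s'" "s' \<le> s" "s \<le> fst p" and t: "0 < t'" "t' \<le> t" "t \<le> fst q"
  shows "comparison_cos x (snd p s) (snd q t) \<le> comparison_cos x (snd p s') (snd q t')"
proof -
  have gp: "geodesic s (snd p)" "snd p 0 = x" and gq: "geodesic t (snd q)" "snd q 0 = x"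
    using p q s t geodesic_restrict by (fastforce simp: geodesics_from_def)+
  have "comparison_cos x (snd p s) (snd q t) \<le> comparison_cos x (snd p s') (snd q t)"
    by (rule comparison_cos_mono[OF hadamard gp s(1,2)]) (use geods_neq q t in auto)
  also have "\<dots> \<le> comparison_cos x (snd p s') (snd q t')"
    unfolding comparison_cos_commute[of x "snd p s'"]
    by (rule comparison_cos_mono[OF hadamard gq t(1,2)]) (use geods_neq p s in auto)
  finally show ?thesis .
qed

text \<open>The comparison cosine increases as s and t decrease and is at most 1, so it converges to
  its supremum C. Hence the limit in the definition of the angle exists and equals arccos C, and
  every comparison cosine is bounded by the cosine of the angle.\<close>

lemma geod_angle_props:
  assumes p: "p \<in> geods" and q: "q \<in> geods"
  shows "0 \<le> geod_angle x p q" "geod_angle x p q \<le> pi"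
    and "\<And>s t. 0 < s \<Longrightarrow> s \<le> fst p \<Longrightarrow> 0 < t \<Longrightarrow> t \<le> fst q \<Longrightarrow>
      comparison_cos x (snd p s) (snd q t) \<le> cos (geod_angle x p q)"
    and "((\<lambda>(s, t). comparison_cos x (snd p s) (snd q t)) \<longlongrightarrow> cos (geod_angle x p q))
      (at_right 0 \<times>\<^sub>F at_right 0)"
proof -
  let ?F = "at_right (0::real) \<times>\<^sub>F at_right (0::real)"
  let ?Q = "\<lambda>(s, t). comparison_cos x (snd p s) (snd q t)"
  define I where "I = {0<..fst p} \<times> {0<..fst q}"
  define C where "C = Sup (?Q ` I)"
  have I_ne: "(fst p, fst q) \<in> I" using geods_pos p q by (auto simp: I_def)
  have abs_le: "\<bar>?Q st\<bar> \<le> 1" if "st \<in> I" for st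
  proof -
    obtain s t where "st = (s, t)" "0 < s" "s \<le> fst p" "0 < t" "t \<le> fst q"
      using \<open>st \<in> I\<close> by (auto simp: I_def)
    then show ?thesis using geods_neq[OF p, of s] geods_neq[OF q, of t] by (simp add: abs_comparison_cos_le)
  qed
  then have bdd: "bdd_above (?Q ` I)" by (intro bdd_aboveI[of _ 1]) (auto simp: abs_le_iff)
  have le_C: "?Q st \<le> C" if "st \<in> I" for st
    unfolding C_def using that bdd by (intro cSUP_upper)
  have "C \<le> 1" unfolding C_def
    by (rule cSUP_least) (use I_ne abs_le in \<open>auto simp: abs_le_iff\<close>)
  moreover have "-1 \<le> C" using le_C[OF I_ne] abs_le[OF I_ne] by (simp add: abs_le_iff)
  ultimately have C: "C \<in> {-1..1}" by simp
  have evI: "\<forall>\<^sub>F st in ?F. st \<in> {0<..s} \<times> {0<..t}" if "s > 0" "t > 0" for s t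
  proof -
    have "\<forall>\<^sub>F st in ?F. fst st \<in> {0<..<s} \<and> snd st \<in> {0<..<t}"
      using that by (intro eventually_prodI eventually_at_right_real)
    then show ?thesis by eventually_elim (auto simp: mem_Times_iff)
  qed
  have lim: "(?Q \<longlongrightarrow> C) ?F"
  proof (rule order_tendstoI)
    fix a assume "a < C"
    then obtain st where st: "st \<in> I" "a < ?Q st"
      using I_ne less_cSUP_iff[OF _ bdd, of a] unfolding C_def by blast
    obtain s t where st_eq: "st = (s, t)" by (cases st)
    have pos: "s > 0" "t > 0" "s \<le> fst p" "t \<le> fst q" using st by (auto simp: st_eq I_def)
    show "\<forall>\<^sub>F st in ?F. a < ?Q st"
      using evI[OF pos(1,2)]
    proof eventually_elim
      case (elim st')
      then show ?case using st(2) comparison_cos_geods_mono[OF p q, of "fst st'" s "snd st'" t] pos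
        by (auto simp: st_eq split: prod.splits)
    qed
  next
    fix a assume a: "C < a"
    show "\<forall>\<^sub>F st in ?F. ?Q st < a"
      using evI[OF geods_pos[OF p] geods_pos[OF q]]
      by eventually_elim (use le_C a in \<open>fastforce simp: I_def\<close>)
  qed
  have "((\<lambda>st. arccos (?Q st)) \<longlongrightarrow> arccos C) ?F"
  proof (rule continuous_on_tendsto_compose[OF continuous_on_arccos' lim C])
    show "\<forall>\<^sub>F st in ?F. ?Q st \<in> {-1..1}"
      using evI[OF geods_pos[OF p] geods_pos[OF q]]
    proof eventually_elim
      case (elim st)
      then show ?case using abs_le[of st] unfolding I_def by (simp add: abs_le_iff)
    qed
  qed
  moreover have "(\<lambda>st. arccos (?Q st)) = (\<lambda>(s, t). comparison_angle x (snd p s) (snd q t))"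
    by (auto simp: comparison_angle_def comparison_cos_def)
  ultimately have "geod_angle x p q = arccos C"
    unfolding geod_angle_def
    by (intro tendsto_Lim) (simp_all add: prod_filter_eq_bot)
  moreover have "cos (arccos C) = C" using C by (simp add: cos_arccos)
  ultimately show "0 \<le> geod_angle x p q" "geod_angle x p q \<le> pi"
    "((\<lambda>(s, t). comparison_cos x (snd p s) (snd q t)) \<longlongrightarrow> cos (geod_angle x p q)) ?F"
    "\<And>s t. 0 < s \<Longrightarrow> s \<le> fst p \<Longrightarrow> 0 < t \<Longrightarrow> t \<le> fst q \<Longrightarrow>
      comparison_cos x (snd p s) (snd q t) \<le> cos (geod_angle x p q)"
    using C lim le_C by (auto simp: arccos_lbound arccos_ubound I_def)
qed

lemma dist_geods:
  assumes p: "p \<in> geods" and q: "q \<in> geods" and s: "0 < s" "s \<le> fst p" and t: "0 < t" "t \<le> fst q"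
  shows "(dist (snd p s) (snd q t))\<^sup>2 = s\<^sup>2 + t\<^sup>2 - 2 * s * t * comparison_cos x (snd p s) (snd q t)"
  using geods_dist[OF p, of s] geods_dist[OF q, of t] s t by (simp add: comparison_cos_def)

text \<open>The comparison angle is at least the angle, so the two points are at least as far apart
  as the corresponding points of the Euclidean cone. This makes the logarithm nonexpansive.\<close>

lemma dist_geods_ge:
  assumes p: "p \<in> geods" and q: "q \<in> geods" and s: "0 < s" "s \<le> fst p" and t: "0 < t" "t \<le> fst q"
  shows "s\<^sup>2 + t\<^sup>2 - 2 * s * t * cos (geod_angle x p q) \<le> (dist (snd p s) (snd q t))\<^sup>2"
  using dist_geods[OF assms] mult_left_mono[OF geod_angle_props(3)[OF p q s t], of "2 * s * t"] s t
  by simp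

text \<open>The law of cosines expresses the quotient by the comparison cosine, which converges. The
  limit is the distance in the cone of vectors of lengths a and b; symmetry, vanishing and the
  triangle inequality of the angle are all read off from it.\<close>

lemma dist_geods_tendsto:
  assumes p: "p \<in> geods" and q: "q \<in> geods" and a: "0 < a" and b: "0 < b"
  shows "((\<lambda>e. dist (snd p (e * a)) (snd q (e * b)) / e) \<longlongrightarrow>
    sqrt (a\<^sup>2 + b\<^sup>2 - 2 * a * b * cos (geod_angle x p q))) (at_right 0)"
proof -
  have small: "\<forall>\<^sub>F e in at_right 0. 0 < e * c \<and> e * c \<le> l" if "c > 0" "l > 0" for c l :: real
    using eventually_at_right_real[of 0 "l / c"] that
    by (auto elim!: eventually_mono simp: field_simps)
  have "filterlim (\<lambda>e. (e * a, e * b)) (at_right 0 \<times>\<^sub>F at_right 0) (at_right (0::real))"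
  proof (rule filterlim_Pair)
    have "filterlim (\<lambda>e. e * c) (at_right 0) (at_right (0::real))" if "c > 0" for c :: real
      unfolding filterlim_at
    proof
      show "\<forall>\<^sub>F e in at_right 0. e * c \<in> {0<..} \<and> e * c \<noteq> 0"
        using small[OF that zero_less_one] by eventually_elim auto
      show "((\<lambda>e. e * c) \<longlongrightarrow> 0) (at_right 0)" by (auto intro!: tendsto_eq_intros)
    qed
    then show "filterlim (\<lambda>e. e * a) (at_right 0) (at_right (0::real))"
      "filterlim (\<lambda>e. e * b) (at_right 0) (at_right (0::real))" using a b by auto
  qed
  from filterlim_compose[OF geod_angle_props(4)[OF p q] this]
  have lim: "((\<lambda>e. comparison_cos x (snd p (e * a)) (snd q (e * b))) \<longlongrightarrow> cos (geod_angle x p q)) (at_right 0)"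
    by simp
  have "((\<lambda>e. sqrt (a\<^sup>2 + b\<^sup>2 - 2 * a * b * comparison_cos x (snd p (e * a)) (snd q (e * b)))) \<longlongrightarrow>
      sqrt (a\<^sup>2 + b\<^sup>2 - 2 * a * b * cos (geod_angle x p q))) (at_right 0)"
    by (intro tendsto_intros lim)
  moreover have "\<forall>\<^sub>F e in at_right 0.
      sqrt (a\<^sup>2 + b\<^sup>2 - 2 * a * b * comparison_cos x (snd p (e * a)) (snd q (e * b))) =
      dist (snd p (e * a)) (snd q (e * b)) / e"
    using small[OF a geods_pos[OF p]] small[OF b geods_pos[OF q]]
      eventually_at_right_less[of "0::real"]
  proof eventually_elim
    case (elim e)
    then have "(dist (snd p (e * a)) (snd q (e * b)))\<^sup>2 =
        e\<^sup>2 * (a\<^sup>2 + b\<^sup>2 - 2 * a * b * comparison_cos x (snd p (e * a)) (snd q (e * b)))"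
      using dist_geods[OF p q, of "e * a" "e * b"] by (simp add: power2_eq_square algebra_simps)
    then have "(dist (snd p (e * a)) (snd q (e * b)) / e)\<^sup>2 =
        a\<^sup>2 + b\<^sup>2 - 2 * a * b * comparison_cos x (snd p (e * a)) (snd q (e * b))"
      using elim by (simp add: power_divide)
    then show ?case using elim by (intro real_sqrt_unique) auto
  qed
  ultimately show ?thesis by (rule Lim_transform_eventually)
qed

text \<open>The distance quotient with a = b = 1 vanishes near 0, so 2 - 2 cos of the angle is 0.
  This gives reflexivity and also identifies a geodesic with its initial pieces.\<close>

lemma geod_angle_eq_0:
  assumes p: "p \<in> geods" and q: "q \<in> geods" and c: "0 < c"
    and eq: "\<And>s. 0 < s \<Longrightarrow> s \<le> c \<Longrightarrow> snd p s = snd q s"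
  shows "geod_angle x p q = 0"
proof -
  have "\<forall>\<^sub>F e in at_right 0. 0 = dist (snd p (e * 1)) (snd q (e * 1)) / e"
    using eventually_at_right_real[OF c] by eventually_elim (simp add: eq)
  from Lim_transform_eventually[OF tendsto_const this] dist_geods_tendsto[OF p q zero_less_one zero_less_one]
  have "sqrt (1\<^sup>2 + 1\<^sup>2 - 2 * 1 * 1 * cos (geod_angle x p q)) = 0"
    by (intro tendsto_unique[OF trivial_limit_at_right_real, symmetric])
  then have "cos (geod_angle x p q) = cos 0" by simp
  then show ?thesis
    using cos_inj_pi[of "geod_angle x p q" 0] geod_angle_props(1,2)[OF p q] by simp
qed

lemma geod_angle_commute:
  assumes p: "p \<in> geods" and q: "q \<in> geods"
  shows "geod_angle x p q = geod_angle x q p"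
proof -
  have "sqrt (1\<^sup>2 + 1\<^sup>2 - 2 * 1 * 1 * cos (geod_angle x p q)) =
      sqrt (1\<^sup>2 + 1\<^sup>2 - 2 * 1 * 1 * cos (geod_angle x q p))"
    using dist_geods_tendsto[OF p q zero_less_one zero_less_one]
      dist_geods_tendsto[OF q p zero_less_one zero_less_one]
    by (intro tendsto_unique[OF trivial_limit_at_right_real]) (simp_all add: dist_commute)
  then show ?thesis
    using cos_inj_pi geod_angle_props(1,2)[OF p q] geod_angle_props(1,2)[OF q p] by auto
qed

end

text \<open>The ray at angle \<open>a\<close> meets the chord between the unit vectors at angles \<open>0\<close> and \<open>a + b\<close> at
  distance \<open>r\<close> from the origin.\<close>

lemma planar_chord:
  fixes a b :: real
  assumes a: "0 \<le> a" and b: "0 \<le> b" and ab: "a + b < pi"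
  obtains r where "0 < r" and
    "sqrt (1 + r\<^sup>2 - 2 * r * cos a) + sqrt (r\<^sup>2 + 1 - 2 * r * cos b) = sqrt (2 - 2 * cos (a + b))"
proof (cases "a = 0 \<and> b = 0")
  case True
  then show thesis by (intro that[of 1]) auto
next
  case False
  define S where "S = sin a + sin b"
  have sin: "sin a \<ge> 0" "sin b \<ge> 0" using a b ab by (auto intro!: sin_ge_zero)
  have S: "S > 0"
    using False a b ab sin_gt_zero[of a] sin_gt_zero[of b] sin unfolding S_def by (smt (verit))
  \<comment> \<open>From areas: the ray cuts the triangle with two unit sides enclosing a + b, of
    area sin (a + b) / 2, into triangles of areas r sin a / 2 and r sin b / 2. The chord is divided
    in the ratio sin a : sin b, which is \<open>key\<close>.\<close>
  define r where "r = sin (a + b) / S"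
  have r: "r > 0" unfolding r_def using S False a b ab by (auto intro!: divide_pos_pos sin_gt_zero)
  have key: "1 + r\<^sup>2 - 2 * r * cos a = (sin a / S)\<^sup>2 * (2 - 2 * cos (a + b))"
    "r\<^sup>2 + 1 - 2 * r * cos b = (sin b / S)\<^sup>2 * (2 - 2 * cos (a + b))"
  proof -
    have ca: "(sin a)\<^sup>2 + (cos a)\<^sup>2 = 1" and cb: "(sin b)\<^sup>2 + (cos b)\<^sup>2 = 1" by simp_all
    have rS: "r * S = sin a * cos b + cos a * sin b" using S by (simp add: r_def sin_add)
    have "(1 + r\<^sup>2 - 2 * r * cos a) * S\<^sup>2 = S\<^sup>2 + (r * S)\<^sup>2 - 2 * (r * S) * cos a * S"
      by (simp add: power2_eq_square algebra_simps)
    also have "\<dots> = (sin a)\<^sup>2 * (2 - 2 * cos (a + b))"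
      unfolding rS unfolding S_def cos_add using ca cb by algebra
    finally show "1 + r\<^sup>2 - 2 * r * cos a = (sin a / S)\<^sup>2 * (2 - 2 * cos (a + b))"
      using S by (simp add: field_simps)
    have "(r\<^sup>2 + 1 - 2 * r * cos b) * S\<^sup>2 = S\<^sup>2 + (r * S)\<^sup>2 - 2 * (r * S) * cos b * S"
      by (simp add: power2_eq_square algebra_simps)
    also have "\<dots> = (sin b)\<^sup>2 * (2 - 2 * cos (a + b))"
      unfolding rS unfolding S_def cos_add using ca cb by algebra
    finally show "r\<^sup>2 + 1 - 2 * r * cos b = (sin b / S)\<^sup>2 * (2 - 2 * cos (a + b))"
      using S by (simp add: field_simps)
  qed
  have "sqrt (1 + r\<^sup>2 - 2 * r * cos a) + sqrt (r\<^sup>2 + 1 - 2 * r * cos b) =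
      (sin a / S + sin b / S) * sqrt (2 - 2 * cos (a + b))"
    unfolding key real_sqrt_mult using sin S by (simp add: distrib_right)
  also have "sin a / S + sin b / S = 1" using S by (simp add: S_def add_divide_distrib[symmetric])
  finally show thesis using r by (intro that[of r]) simp_all
qed

context hadamard_point
begin

text \<open>If the two angles add up to less than pi, the metric triangle inequality is applied to
  the points at parameters e, e r and e, with r from \<open>planar_chord\<close>. Divided by e, it
  tends to a comparison with the planar chord, that is, cos (a + b) <= cos c.\<close>

lemma geod_angle_triangle:
  assumes p: "p \<in> geods" and q: "q \<in> geods" and w: "w \<in> geods"
  shows "geod_angle x p w \<le> geod_angle x p q + geod_angle x q w"
proof (cases "geod_angle x p q + geod_angle x q w < pi")
  case False
  then show ?thesis using geod_angle_props(2)[OF p w] by simp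
next
  case True
  let ?a = "geod_angle x p q" and ?b = "geod_angle x q w" and ?c = "geod_angle x p w"
  note pos = geod_angle_props(1)[OF p q] geod_angle_props(1)[OF q w]
  obtain r where r: "0 < r"
    "sqrt (1 + r\<^sup>2 - 2 * r * cos ?a) + sqrt (r\<^sup>2 + 1 - 2 * r * cos ?b) = sqrt (2 - 2 * cos (?a + ?b))"
    using planar_chord[OF pos True] .
  have "sqrt (1\<^sup>2 + 1\<^sup>2 - 2 * 1 * 1 * cos ?c) \<le>
      sqrt (1\<^sup>2 + r\<^sup>2 - 2 * 1 * r * cos ?a) + sqrt (r\<^sup>2 + 1\<^sup>2 - 2 * r * 1 * cos ?b)"
  proof (rule tendsto_le[OF trivial_limit_at_right_real])
    show "((\<lambda>e. dist (snd p (e * 1)) (snd q (e * r)) / e + dist (snd q (e * r)) (snd w (e * 1)) / e) \<longlongrightarrow>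
        sqrt (1\<^sup>2 + r\<^sup>2 - 2 * 1 * r * cos ?a) + sqrt (r\<^sup>2 + 1\<^sup>2 - 2 * r * 1 * cos ?b)) (at_right 0)"
      by (intro tendsto_add dist_geods_tendsto p q w r zero_less_one)
    show "((\<lambda>e. dist (snd p (e * 1)) (snd w (e * 1)) / e) \<longlongrightarrow>
        sqrt (1\<^sup>2 + 1\<^sup>2 - 2 * 1 * 1 * cos ?c)) (at_right 0)"
      by (intro dist_geods_tendsto p w zero_less_one)
    show "\<forall>\<^sub>F e in at_right 0. dist (snd p (e * 1)) (snd w (e * 1)) / e \<le>
        dist (snd p (e * 1)) (snd q (e * r)) / e + dist (snd q (e * r)) (snd w (e * 1)) / e"
      using eventually_at_right_less[of "0::real"]
      by eventually_elim (simp add: add_divide_distrib[symmetric] divide_right_mono dist_triangle)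
  qed
  then have "cos (?a + ?b) \<le> cos ?c" using r(2) by simp
  then show ?thesis
    using cos_monotone_0_pi[of "?a + ?b" ?c] geod_angle_props(2)[OF p w] pos by (force simp: not_le[symmetric])
qed

lemma pseudometric_geod_angle: "pseudometric_on geods (geod_angle x)"
  by unfold_locales
    (auto intro: geod_angle_eq_0[OF _ _ zero_less_one] geod_angle_commute geod_angle_triangle)

end

section \<open>The tangent cone and the logarithm\<close>

text \<open>A scaling available before the cone has any linear structure. It is meant for r > 0:
  \<open>Some (\<xi>, 0)\<close> is not an element of the cone.\<close>

definition cone_scale :: "real \<Rightarrow> 'a tangent \<Rightarrow> 'a tangent" where
  "cone_scale r u = (case u of None \<Rightarrow> None | Some (\<xi>, t) \<Rightarrow> Some (\<xi>, r * t))"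

lemma cone_scale_simps [simp]: "cone_scale r None = None" "cone_scale r (Some (\<xi>, t)) = Some (\<xi>, r * t)"
  by (simp_all add: cone_scale_def)

lemma radius_simps [simp]: "radius None = 0" "radius (Some (\<xi>, t)) = t"
  by (simp_all add: radius_def)

lemma tangent_inner_simps [simp]:
  "tangent_inner x None v = 0" "tangent_inner x u None = 0"
  "tangent_inner x (Some (\<xi>, t)) (Some (\<zeta>, s)) = t * s * cos (angle x \<xi> \<zeta>)"
  by (simp_all add: tangent_inner_def split: option.splits)

lemma tangent_cone_cases:
  assumes "u \<in> tangent_cone x"
  obtains "u = None" | \<xi> t where "u = Some (\<xi>, t)" "\<xi> \<in> directions x" "t > 0"
  using assms by (auto simp: tangent_cone_def)

lemma radius_nonneg: "u \<in> tangent_cone x \<Longrightarrow> 0 \<le> radius u"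
  by (auto elim: tangent_cone_cases)

lemma cone_scale_in: "u \<in> tangent_cone x \<Longrightarrow> 0 < r \<Longrightarrow> cone_scale r u \<in> tangent_cone x"
  by (auto simp: tangent_cone_def)

lemma radius_cone_scale: "radius (cone_scale r u) = r * radius u"
  by (cases u) auto

lemma tangent_inner_cone_scale: "tangent_inner x (cone_scale r u) v = r * tangent_inner x u v"
  by (cases u; cases v) auto

lemma tangent_dist_square:
  assumes "u \<in> tangent_cone x" "v \<in> tangent_cone x"
  shows "(tangent_dist x u v)\<^sup>2 = (radius u)\<^sup>2 + (radius v)\<^sup>2 - 2 * tangent_inner x u v"
proof -
  have "tangent_inner x u v \<le> radius u * radius v"
    using assms by (auto elim!: tangent_cone_cases simp: mult_left_le)
  moreover have "0 \<le> (radius u - radius v)\<^sup>2" by simp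
  ultimately have "0 \<le> (radius u)\<^sup>2 + (radius v)\<^sup>2 - 2 * tangent_inner x u v"
    unfolding power2_diff by linarith
  then show ?thesis by (simp add: tangent_dist_def)
qed

context hadamard_point
begin

abbreviation "dir p \<equiv> completion_embed (pre_directions x) (pre_angle x) (quot_class geods (geod_angle x) p)"

lemma pseudometric_pre_angle: "pseudometric_on (pre_directions x) (pre_angle x)"
  unfolding pre_directions_def pre_angle_def
  by (rule pseudometric_on.pseudometric_on_quot_space[OF pseudometric_geod_angle])

lemma quot_class_pre_directions: "p \<in> geods \<Longrightarrow> quot_class geods (geod_angle x) p \<in> pre_directions x"
  unfolding pre_directions_def
  by (rule pseudometric_on.quot_class_in[OF pseudometric_geod_angle])

lemma dir_in: "p \<in> geods \<Longrightarrow> dir p \<in> directions x"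
  unfolding directions_def
  by (intro pseudometric_on.completion_embed_in[OF pseudometric_pre_angle] quot_class_pre_directions)

lemma angle_dir: "p \<in> geods \<Longrightarrow> q \<in> geods \<Longrightarrow> angle x (dir p) (dir q) = geod_angle x p q"
  unfolding angle_def
  by (subst pseudometric_on.completion_dist_embed[OF pseudometric_pre_angle])
    (simp_all add: quot_class_pre_directions pre_angle_def
      pseudometric_on.quot_dist_class[OF pseudometric_geod_angle])

lemma dir_eq: "p \<in> geods \<Longrightarrow> q \<in> geods \<Longrightarrow> geod_angle x p q = 0 \<Longrightarrow> dir p = dir q"
  using pseudometric_on.quot_class_eq[OF pseudometric_geod_angle] by simp

lemma dir_dense:
  assumes "\<xi> \<in> directions x" "e > 0"
  shows "\<exists>p\<in>geods. angle x \<xi> (dir p) < e"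
proof -
  obtain a where a: "a \<in> pre_directions x"
    "angle x \<xi> (completion_embed (pre_directions x) (pre_angle x) a) < e"
    using pseudometric_on.completion_embed_dense[OF pseudometric_pre_angle] assms
    unfolding directions_def angle_def by blast
  from a(1) obtain p where "p \<in> geods" "a = quot_class geods (geod_angle x) p"
    unfolding pre_directions_def
    by (rule pseudometric_on.quot_spaceE[OF pseudometric_geod_angle])
  then show ?thesis using a by blast
qed

lemma geodesic_between_props:
  "geodesic (dist x y) (snd (geodesic_between x y))" "fst (geodesic_between x y) = dist x y"
  "snd (geodesic_between x y) 0 = x" "snd (geodesic_between x y) (dist x y) = y"
proof -
  let ?p = "geodesic_between x y"
  have "\<exists>l \<gamma>. geodesic l \<gamma> \<and> \<gamma> 0 = x \<and> \<gamma> l = y"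
    by (rule hadamard[unfolded hadamard_space_def, THEN conjunct1, rule_format])
  then have "\<exists>p. case p of (l, \<gamma>) \<Rightarrow> geodesic l \<gamma> \<and> \<gamma> 0 = x \<and> \<gamma> l = y"
    unfolding split_paired_Ex prod.case .
  then have "case ?p of (l, \<gamma>) \<Rightarrow> geodesic l \<gamma> \<and> \<gamma> 0 = x \<and> \<gamma> l = y"
    unfolding geodesic_between_def by (rule someI_ex)
  then have *: "geodesic (fst ?p) (snd ?p)" "snd ?p 0 = x" "snd ?p (fst ?p) = y"
    by (simp_all add: case_prod_beta)
  moreover have "0 \<le> fst ?p" using *(1) by (simp add: geodesic_def)
  then have "fst ?p = dist x y"
    using geodesic_dist[OF *(1), of 0 "fst ?p"] *(2,3) by simp
  ultimately show "geodesic (dist x y) (snd ?p)" "fst ?p = dist x y" "snd ?p 0 = x"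
    "snd ?p (dist x y) = y"
    by simp_all
qed

lemma geodesic_between_in: "y \<noteq> x \<Longrightarrow> geodesic_between x y \<in> geods"
  using geodesic_between_props[of y] by (auto simp: geodesics_from_def case_prod_beta)

lemma log_map_eq: "log_map x y = (if y = x then None else Some (dir (geodesic_between x y), dist x y))"
  by (simp add: log_map_def)

lemma log_map_in: "log_map x y \<in> tangent_cone x"
  by (auto simp: log_map_eq tangent_cone_def dir_in geodesic_between_in)

lemma radius_log_map: "radius (log_map x y) = dist x y"
  by (simp add: log_map_eq)

definition toward :: "'h \<Rightarrow> real \<Rightarrow> 'h" where
  "toward y s = snd (geodesic_between x y) (s * dist x y)"

lemma toward_self [simp]: "toward x s = x"
  using geodesic_between_props(3)[of x] by (simp add: toward_def)

text \<open>\<open>geodesic_between\<close> is an arbitrary choice. By uniqueness it agrees with p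
  up to s, and geodesics that agree near x have angle 0.\<close>

lemma dir_geodesic_between:
  assumes p: "p \<in> geods" and s: "0 < s" "s \<le> fst p"
  shows "dir (geodesic_between x (snd p s)) = dir p"
proof (rule dir_eq)
  let ?y = "snd p s"
  have y: "?y \<noteq> x" "dist x ?y = s" using geods_neq[OF p s] geods_dist(1)[OF p, of s] s by auto
  show q: "geodesic_between x ?y \<in> geods" using y by (intro geodesic_between_in)
  show "geod_angle x (geodesic_between x ?y) p = 0"
  proof (rule geod_angle_eq_0[OF q p s(1)])
    fix t assume t: "0 < t" "t \<le> s"
    show "snd (geodesic_between x ?y) t = snd p t"
    proof (rule geodesic_unique[OF hadamard])
      show "geodesic s (snd (geodesic_between x ?y))" using geodesic_between_props(1)[of ?y] y by simp
      show "geodesic s (snd p)" using geodesic_restrict[OF geods_geodesic[OF p]] s by simp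
      show "snd (geodesic_between x ?y) 0 = snd p 0"
        using geods_start[OF p] geodesic_between_props(3) by simp
      show "snd (geodesic_between x ?y) s = snd p s" using geodesic_between_props(4)[of ?y] y by simp
    qed (use t in auto)
  qed
qed (rule p)

lemma log_map_geodesic:
  assumes p: "p \<in> geods" and s: "0 < s" "s \<le> fst p"
  shows "log_map x (snd p s) = Some (dir p, s)"
  using dir_geodesic_between[OF assms] geods_neq[OF assms] geods_dist(1)[OF p, of s] s
  by (simp add: log_map_eq)

lemma log_map_toward:
  assumes s: "0 < s" "s \<le> 1"
  shows "log_map x (toward y s) = cone_scale s (log_map x y)"
proof (cases "y = x")
  case True
  then show ?thesis by (simp add: log_map_eq)
next
  case False
  then show ?thesis
    using log_map_geodesic[OF geodesic_between_in[OF False], of "s * dist x y"] s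
    by (simp add: toward_def log_map_eq geodesic_between_props)
qed

lemma dist_toward: "0 \<le> s \<Longrightarrow> s \<le> 1 \<Longrightarrow> dist x (toward y s) = s * dist x y"
  using geodesic_dist[OF geodesic_between_props(1), of 0 y "s * dist x y"]
  by (simp add: toward_def geodesic_between_props mult_left_le_one_le)

lemma tangent_dist_log_map_le: "tangent_dist x (log_map x y) (log_map x z) \<le> dist y z"
proof (rule power2_le_imp_le)
  show "(tangent_dist x (log_map x y) (log_map x z))\<^sup>2 \<le> (dist y z)\<^sup>2"
  proof (cases "y = x \<or> z = x")
    case True
    then show ?thesis
      by (auto simp: tangent_dist_square log_map_in radius_log_map dist_commute)
        (auto simp: log_map_eq)
  next
    case False
    then have "y \<noteq> x" "z \<noteq> x" by auto
    note in_geods = geodesic_between_in[OF this(1)] geodesic_between_in[OF this(2)]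
    show ?thesis
      using dist_geods_ge[OF in_geods, of "dist x y" "dist x z"] False
      by (simp add: tangent_dist_square log_map_in radius_log_map geodesic_between_props)
        (auto simp: log_map_eq angle_dir in_geods mult.assoc)
  qed
qed simp

text \<open>This is \<open>dist_geods_tendsto\<close> with lengths rescaled. If y or z is x, there
  is no geodesic of positive length to apply it to, but then the quotient is constant for small
  e.\<close>

lemma tangent_dist_toward_tendsto:
  assumes a: "0 < a" and b: "0 < b"
  shows "((\<lambda>e. dist (toward y (e * a)) (toward z (e * b)) / e) \<longlongrightarrow>
    tangent_dist x (cone_scale a (log_map x y)) (cone_scale b (log_map x z))) (at_right 0)"
proof -
  have small: "\<forall>\<^sub>F e in at_right 0. 0 < e \<and> e * c \<le> 1" if "c > 0" for c :: real
    using eventually_at_right_real[of 0 "1 / c"] that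
    by (auto elim!: eventually_mono simp: field_simps)
  show ?thesis
  proof (cases "y = x \<or> z = x")
    case True
    have "\<forall>\<^sub>F e in at_right 0. tangent_dist x (cone_scale a (log_map x y)) (cone_scale b (log_map x z)) =
        dist (toward y (e * a)) (toward z (e * b)) / e"
      using small[OF a] small[OF b]
    proof eventually_elim
      case (elim e)
      have "dist x (toward z (e * b)) = e * b * dist x z" "dist x (toward y (e * a)) = e * a * dist x y"
        using elim a b by (auto intro!: dist_toward)
      then show ?case using True elim a b
        by (auto simp: tangent_dist_def radius_cone_scale radius_log_map log_map_eq[of x] dist_commute)
    qed
    then show ?thesis by (rule Lim_transform_eventually[OF tendsto_const])
  next
    case False
    then have yz: "y \<noteq> x" "z \<noteq> x" by auto
    note in_geods = geodesic_between_in[OF yz(1)] geodesic_between_in[OF yz(2)]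
    have "0 < a * dist x y" "0 < b * dist x z" using a b yz by auto
    from dist_geods_tendsto[OF in_geods this] show ?thesis
      using yz by (simp add: toward_def log_map_eq tangent_dist_def angle_dir in_geods mult.assoc)
  qed
qed

text \<open>Directions of geodesics are dense among all directions. Two vectors of the same length t
  at angle \<alpha> have distance 2 t sin (\<alpha>/2) <= t \<alpha>, hence the tolerance e / t. The
  factor r stretches the logarithm of the end point to length t.\<close>

lemma cone_log_map_dense:
  assumes v: "v \<in> tangent_cone x" and e: "e > 0"
  shows "\<exists>y r. 0 < r \<and> tangent_dist x v (cone_scale r (log_map x y)) < e"
  using v
proof (cases rule: tangent_cone_cases)
  case 1
  then have "tangent_dist x v (cone_scale 1 (log_map x x)) = 0" by (simp add: tangent_dist_def log_map_eq)
  then show ?thesis using e by (intro exI[of _ x] exI[of _ 1]) simp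
next
  case (2 \<xi> t)
  then have "e / t > 0" using e by simp
  from dir_dense[OF 2(2) this] obtain p where p: "p \<in> geods" "angle x \<xi> (dir p) < e / t" by blast
  let ?\<alpha> = "angle x \<xi> (dir p)"
  have pos: "?\<alpha> \<ge> 0" unfolding angle_def
    using pseudometric_on.nonneg[OF pseudometric_on.pseudometric_on_quot_space
        [OF pseudometric_on.pseudometric_on_cauchy_seqs[OF pseudometric_pre_angle]], of \<xi> "dir p"]
      2(2) dir_in[OF p(1)]
    unfolding directions_def completion_space_def completion_dist_def by blast
  have l: "fst p > 0" by (rule geods_pos[OF p(1)])
  have log: "cone_scale (t / fst p) (log_map x (snd p (fst p))) = Some (dir p, t)"
    using log_map_geodesic[OF p(1) l] l by simp
  have "(tangent_dist x v (Some (dir p, t)))\<^sup>2 = 2 * t\<^sup>2 * (1 - cos ?\<alpha>)"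
    using tangent_dist_square[of v x "Some (dir p, t)"] v 2 dir_in[OF p(1)]
    by (simp add: tangent_cone_def power2_eq_square algebra_simps)
  also have "1 - cos ?\<alpha> = 2 * (sin (?\<alpha> / 2))\<^sup>2"
    using cos_double_sin[of "?\<alpha> / 2"] by simp
  also have "\<dots> \<le> 2 * (?\<alpha> / 2)\<^sup>2"
    using abs_sin_x_le_abs_x[of "?\<alpha> / 2"] unfolding abs_le_square_iff by (rule mult_left_mono) simp
  also have "2 * t\<^sup>2 * (2 * (?\<alpha> / 2)\<^sup>2) = (t * ?\<alpha>)\<^sup>2"
    by (simp add: power2_eq_square)
  finally have "(tangent_dist x v (Some (dir p, t)))\<^sup>2 \<le> (t * ?\<alpha>)\<^sup>2"
    by (simp add: mult_left_mono)
  from power2_le_imp_le[OF this] have "tangent_dist x v (Some (dir p, t)) \<le> t * ?\<alpha>"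
    using 2(3) pos by simp
  also have "\<dots> < e" using p(2) 2(3) by (simp add: field_simps)
  finally show ?thesis using log l 2(3) by (intro exI[of _ "snd p (fst p)"] exI[of _ "t / fst p"]) simp
qed

lemma hilbert_tangent_cone:
  assumes "isometric_to_hilbert (tangent_cone x) (tangent_dist x)"
  obtains add scale where "hilbert_space_on (tangent_cone x) add None scale (tangent_inner x)"
proof (rule isometric_to_hilbert_transport[OF assms, where r = radius and g = "tangent_inner x"])
  show "None \<in> tangent_cone x" by (simp add: tangent_cone_def)
  show "radius None = 0" by simp
qed (simp_all add: tangent_dist_square that)

end

section \<open>Logarithm and scaling in the Hilbert space structure of the cone\<close>

locale hilbert_hadamard_point =
  hadamard_point x + hilbert_space_on "tangent_cone x" add None scale "tangent_inner x"
  for x :: "'h::complete_space" and add scale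
begin

lemma angle_self: "\<xi> \<in> directions x \<Longrightarrow> angle x \<xi> \<xi> = 0"
  unfolding angle_def completion_dist_def directions_def completion_space_def
  by (rule pseudometric_on.refl_zero[OF pseudometric_on.pseudometric_on_quot_space
        [OF pseudometric_on.pseudometric_on_cauchy_seqs[OF pseudometric_pre_angle]]])

lemma tangent_inner_self: "v \<in> tangent_cone x \<Longrightarrow> tangent_inner x v v = (radius v)\<^sup>2"
  by (erule tangent_cone_cases) (simp_all add: angle_self power2_eq_square)

lemma nrm_eq_radius: "v \<in> tangent_cone x \<Longrightarrow> nrm v = radius v"
  by (simp add: nrm_def tangent_inner_self radius_nonneg)

lemma dst_eq_tangent_dist:
  assumes "u \<in> tangent_cone x" "v \<in> tangent_cone x"
  shows "dst u v = tangent_dist x u v"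
proof -
  have "(dst u v)\<^sup>2 = (radius u)\<^sup>2 + (radius v)\<^sup>2 - 2 * tangent_inner x u v"
    using assms by (simp add: dst_square tangent_inner_self)
  then show ?thesis using assms unfolding tangent_dist_def
    by (metis dst_nonneg real_sqrt_abs abs_of_nonneg)
qed

text \<open>The transported scaling was not chosen to be the one of the cone; they agree for r > 0
  because both sides have the same inner product with every vector.\<close>

lemma scale_eq_cone_scale:
  assumes "v \<in> tangent_cone x" "0 < r" shows "scale r v = cone_scale r v"
  by (rule ip_ext) (use assms in \<open>simp_all add: ip_simps cone_scale_in tangent_inner_cone_scale\<close>)

abbreviation "Log \<equiv> log_map x"

lemmas Log_closed [simp] = log_map_in

lemma scale_Log_closed [simp]: "scale r (Log y) \<in> tangent_cone x"
  by (simp add: closed)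

lemma nrm_Log: "nrm (Log y) = dist x y"
  by (simp add: nrm_eq_radius radius_log_map)

lemma Log_self: "Log x = None"
  by (simp add: log_map_def)

lemma dst_Log_le: "dst (Log y) (Log z) \<le> dist y z"
  by (simp add: dst_eq_tangent_dist tangent_dist_log_map_le)

lemma Log_toward: "0 < s \<Longrightarrow> s \<le> 1 \<Longrightarrow> Log (toward y s) = scale s (Log y)"
  by (simp add: log_map_toward scale_eq_cone_scale)

lemma dst_toward_tendsto:
  "0 < a \<Longrightarrow> 0 < b \<Longrightarrow> ((\<lambda>e. dist (toward y (e * a)) (toward z (e * b)) / e) \<longlongrightarrow>
    dst (scale a (Log y)) (scale b (Log z))) (at_right 0)"
  using tangent_dist_toward_tendsto[of a b y z]
  by (simp add: scale_eq_cone_scale dst_eq_tangent_dist cone_scale_in)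

lemma Log_dense: "v \<in> tangent_cone x \<Longrightarrow> e > 0 \<Longrightarrow> \<exists>y r. 0 < r \<and> dst v (scale r (Log y)) < e"
  using cone_log_map_dense[of v e]
  by (fastforce simp: scale_eq_cone_scale dst_eq_tangent_dist cone_scale_in)

lemma scale_Log_toward:
  assumes "0 < e" "0 < r" "e * r \<le> 1"
  shows "scale (1 / e) (Log (toward y (e * r))) = scale r (Log y)"
  using assms by (simp add: Log_toward scale_scale)

end

section \<open>Directional derivatives of convex functions\<close>

locale lipschitz_convex = hilbert_hadamard_point x add scale
  for x :: "'h::complete_space" and add scale +
  fixes h :: "'h \<Rightarrow> real" and L :: real
  assumes L_nonneg: "0 \<le> L"
    and lipschitz: "\<bar>h y - h z\<bar> \<le> L * dist y z"
    and convex: "geodesic l \<gamma> \<Longrightarrow> 0 \<le> t \<Longrightarrow> t \<le> 1 \<Longrightarrow> h (\<gamma> (t * l)) \<le> (1 - t) * h (\<gamma> 0) + t * h (\<gamma> l)"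
begin

text \<open>On \<open>scale r (Log y)\<close> this is the directional derivative of \<open>h\<close> at \<open>x\<close>; the term with \<open>L\<close>
  extends it to directions that are not realized by geodesics.\<close>

definition dderiv :: "'h tangent \<Rightarrow> real" where
  "dderiv v = (INF (y, r)\<in>UNIV \<times> {0<..}. r * (h y - h x) + L * dst v (scale r (Log y)))"

lemma toward_le:
  assumes "0 \<le> s" "s \<le> 1" shows "h (toward y s) - h x \<le> s * (h y - h x)"
  using convex[OF geodesic_between_props(1) assms, of y]
  by (simp add: toward_def geodesic_between_props algebra_simps)

lemma toward_quotient_le:
  assumes "0 < e" "0 < r" "e * r \<le> 1" shows "(h (toward y (e * r)) - h x) / e \<le> r * (h y - h x)"
  using toward_le[of "e * r" y] assms by (simp add: field_simps)

text \<open>Makes the infimum in \<open>dderiv\<close> finite: the first summand is at least -L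
  times the norm of \<open>scale r (Log y)\<close>, which exceeds the norm of v by at most the
  distance in the second summand.\<close>

lemma dderiv_bound:
  assumes v: "v \<in> tangent_cone x" and r: "0 < r"
  shows "- L * nrm v \<le> r * (h y - h x) + L * dst v (scale r (Log y))"
proof -
  have "nrm (scale r (Log y)) \<le> nrm v + dst (scale r (Log y)) v"
    by (rule nrm_le_dst) (use v in auto)
  then have "r * dist x y - dst v (scale r (Log y)) \<le> nrm v"
    using r v by (simp add: nrm_scale nrm_Log dst_commute[of v])
  then have "L * (r * dist x y - dst v (scale r (Log y))) \<le> L * nrm v"
    by (rule mult_left_mono[OF _ L_nonneg])
  moreover have "- (L * dist x y) \<le> h y - h x" using lipschitz[of x y] by (simp add: abs_le_iff)
  then have "r * (- (L * dist x y)) \<le> r * (h y - h x)" using r by (intro mult_left_mono) auto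
  ultimately show ?thesis by (simp add: algebra_simps)
qed

lemma dderiv_le:
  assumes "v \<in> tangent_cone x" "0 < r"
  shows "dderiv v \<le> r * (h y - h x) + L * dst v (scale r (Log y))"
  unfolding dderiv_def
  by (rule cINF_lower2[where x = "(y, r)"])
    (use assms dderiv_bound[OF assms(1)] in \<open>auto intro!: bdd_belowI2\<close>)

lemma dderiv_greatest:
  "(\<And>y r. 0 < r \<Longrightarrow> c \<le> r * (h y - h x) + L * dst v (scale r (Log y))) \<Longrightarrow> c \<le> dderiv v"
  unfolding dderiv_def by (rule cINF_greatest) (auto intro: exI[of _ 1])

lemma dderiv_less:
  assumes "v \<in> tangent_cone x" "dderiv v < c"
  obtains y r where "0 < r" "r * (h y - h x) + L * dst v (scale r (Log y)) < c"
  using dderiv_greatest[of c v] assms(2) by (meson not_le)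

lemma dderiv_le_nrm: "v \<in> tangent_cone x \<Longrightarrow> dderiv v \<le> L * nrm v"
  using dderiv_le[of v 1 x] by (simp add: Log_self scale_zero_right)

lemma dderiv_scale_Log_le: "0 < r \<Longrightarrow> dderiv (scale r (Log y)) \<le> r * (h y - h x)"
  using dderiv_le[of "scale r (Log y)" r y] dst_scale_left[of "Log y" r r] by simp

lemma dderiv_lipschitz:
  assumes v: "v \<in> tangent_cone x" and w: "w \<in> tangent_cone x"
  shows "dderiv v \<le> dderiv w + L * dst v w"
proof -
  have "dderiv v - L * dst v w \<le> dderiv w"
  proof (rule dderiv_greatest)
    fix y and r :: real assume r: "0 < r"
    have "L * dst v (scale r (Log y)) \<le> L * (dst v w + dst w (scale r (Log y)))"
      by (intro mult_left_mono dst_triangle L_nonneg v w) simp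
    then show "dderiv v - L * dst v w \<le> r * (h y - h x) + L * dst w (scale r (Log y))"
      using dderiv_le[OF v r, of y] by (simp add: algebra_simps)
  qed
  then show ?thesis by simp
qed

lemma eventually_small:
  assumes "0 < (r :: real)" shows "\<forall>\<^sub>F e in at_right 0. 0 < e \<and> e * r \<le> 1"
  using eventually_at_right_real[of 0 "1 / r"] assms
  by (auto elim!: eventually_mono simp: field_simps)

lemma midpoint_exists:
  obtains m where "dist m y = dist y z / 2" "dist m z = dist y z / 2" "h m \<le> (h y + h z) / 2"
proof -
  from hadamard[unfolded hadamard_space_def, THEN conjunct1, rule_format, of y z]
  obtain l \<gamma> where g: "geodesic l \<gamma>" "\<gamma> 0 = y" "\<gamma> l = z" by (elim exE conjE)
  have l: "0 \<le> l" using g(1) by (simp add: geodesic_def)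
  have d: "dist y z = l" using geodesic_dist[OF g(1), of 0 l] g l by simp
  show thesis
  proof (rule that)
    show "dist (\<gamma> (1 / 2 * l)) y = dist y z / 2"
      using geodesic_dist[OF g(1), of "1 / 2 * l" 0] g l d by simp
    show "dist (\<gamma> (1 / 2 * l)) z = dist y z / 2"
      using geodesic_dist[OF g(1), of "1 / 2 * l" l] g l d by simp
    show "h (\<gamma> (1 / 2 * l)) \<le> (h y + h z) / 2"
      using convex[OF g(1), of "1 / 2"] g by simp
  qed
qed

text \<open>Since \<open>Log\<close> is nonexpansive, the rescaled logarithm of the midpoint of two points close to
  \<open>x\<close> is an almost midpoint of their rescaled logarithms, hence close to the midpoint.\<close>

lemma dderiv_add_approx:
  assumes v: "v \<in> tangent_cone x" and w: "w \<in> tangent_cone x" and r: "0 < r" and q: "0 < q"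
  shows "dderiv (add v w) \<le> (r * (h y - h x) + L * dst v (scale r (Log y))) +
    (q * (h z - h x) + L * dst w (scale q (Log z)))"
proof -
  define a where "a = scale r (Log y)"
  define b where "b = scale q (Log z)"
  have ab: "a \<in> tangent_cone x" "b \<in> tangent_cone x" by (simp_all add: a_def b_def)
  \<comment> \<open>The rescaled distance in the space, which is at least and converges to the
    distance of a and b. The excess controls how far the midpoint construction is off.\<close>
  define \<delta> where "\<delta> e = dist (toward y (e * r)) (toward z (e * q)) / e" for e
  have "(\<delta> \<longlongrightarrow> dst a b) (at_right 0)"
    unfolding \<delta>_def a_def b_def by (rule dst_toward_tendsto[OF r q])
  then have "((\<lambda>e. r * (h y - h x) + q * (h z - h x) + L * (dst v a + dst w b + sqrt ((\<delta> e)\<^sup>2 - (dst a b)\<^sup>2)))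
      \<longlongrightarrow> r * (h y - h x) + q * (h z - h x) + L * (dst v a + dst w b + sqrt ((dst a b)\<^sup>2 - (dst a b)\<^sup>2)))
      (at_right 0)"
    by (intro tendsto_intros)
  moreover have "\<forall>\<^sub>F e in at_right 0. dderiv (add v w) \<le>
      r * (h y - h x) + q * (h z - h x) + L * (dst v a + dst w b + sqrt ((\<delta> e)\<^sup>2 - (dst a b)\<^sup>2))"
    using eventually_small[OF r] eventually_small[OF q]
  proof eventually_elim
    case (elim e)
    then have e: "0 < e" "e * r \<le> 1" "e * q \<le> 1" by auto
    let ?y = "toward y (e * r)" and ?z = "toward z (e * q)"
    obtain m where m: "dist m ?y = dist ?y ?z / 2" "dist m ?z = dist ?y ?z / 2"
      "h m \<le> (h ?y + h ?z) / 2" by (rule midpoint_exists)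
    define c where "c = scale (1 / e) (Log m)"
    have c: "c \<in> tangent_cone x" by (simp add: c_def)
    \<comment> \<open>Twice the almost midpoint approximates a + b, so \<open>dderiv\<close> is
      estimated by the term of the infimum with point m and factor 2 / e.\<close>
    have two_c: "scale 2 c = scale (2 / e) (Log m)" by (simp add: c_def scale_scale)
    have a_eq: "a = scale (1 / e) (Log ?y)" and b_eq: "b = scale (1 / e) (Log ?z)"
      unfolding a_def b_def using scale_Log_toward e r q by auto
    have ca: "dst c a \<le> \<delta> e / 2"
      using dst_Log_le[of m ?y] m(1) e unfolding c_def a_eq
      by (simp add: dst_scale \<delta>_def field_simps)
    have cb: "dst c b \<le> \<delta> e / 2"
      using dst_Log_le[of m ?z] m(2) e unfolding c_def b_eq
      by (simp add: dst_scale \<delta>_def field_simps)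
    \<comment> \<open>By \<open>midpoint_dst\<close>, with both distances from c at most \<delta> e
      / 2.\<close>
    have "(dst (scale 2 c) (add a b))\<^sup>2 \<le> (\<delta> e)\<^sup>2 - (dst a b)\<^sup>2"
      using midpoint_dst[OF ab c] power_mono[OF ca, of 2] power_mono[OF cb, of 2] ab c
      by (simp add: power_divide)
    then have close: "dst (add a b) (scale 2 c) \<le> sqrt ((\<delta> e)\<^sup>2 - (dst a b)\<^sup>2)"
      using ab c by (simp add: real_le_rsqrt dst_commute closed)
    have "dst (add v w) (scale 2 c) \<le> dst (add v w) (add a b) + dst (add a b) (scale 2 c)"
      using ab c v w by (intro dst_triangle closed)
    also have "\<dots> \<le> dst v a + dst w b + sqrt ((\<delta> e)\<^sup>2 - (dst a b)\<^sup>2)"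
      using dst_add[OF v w ab] close by simp
    finally have close': "L * dst (add v w) (scale (2 / e) (Log m)) \<le>
        L * (dst v a + dst w b + sqrt ((\<delta> e)\<^sup>2 - (dst a b)\<^sup>2))"
      unfolding two_c by (rule mult_left_mono[OF _ L_nonneg])
    have "2 / e * (h m - h x) \<le> 2 / e * ((h ?y + h ?z) / 2 - h x)"
      using m(3) e by (intro mult_left_mono) auto
    also have "\<dots> = (h ?y - h x) / e + (h ?z - h x) / e"
      using e by (simp add: field_simps)
    also have "\<dots> \<le> r * (h y - h x) + q * (h z - h x)"
      using toward_quotient_le e r q by (intro add_mono) auto
    finally show ?case
      using dderiv_le[of "add v w" "2 / e" m] close' v w e by (simp add: closed)
  qed
  ultimately have "dderiv (add v w) \<le>
      r * (h y - h x) + q * (h z - h x) + L * (dst v a + dst w b + sqrt ((dst a b)\<^sup>2 - (dst a b)\<^sup>2))"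
    by (rule tendsto_lowerbound[OF _ _ trivial_limit_at_right_real])
  then show ?thesis by (simp add: a_def b_def algebra_simps)
qed

lemma sublinear_dderiv: "sublinear dderiv"
proof (rule sublinearI)
  fix v w assume vw: "v \<in> tangent_cone x" "w \<in> tangent_cone x"
  have "dderiv (add v w) - (q * (h z - h x) + L * dst w (scale q (Log z))) \<le> dderiv v" if "0 < q" for q z
    by (rule dderiv_greatest) (use dderiv_add_approx[OF vw _ that] in \<open>simp add: algebra_simps\<close>)
  then have "dderiv (add v w) - dderiv v \<le> dderiv w"
    by (intro dderiv_greatest) (simp add: algebra_simps)
  then show "dderiv (add v w) \<le> dderiv v + dderiv w" by simp
next
  fix c :: real and v assume c: "c > 0" and v: "v \<in> tangent_cone x"
  have "dderiv (scale c v) / c \<le> dderiv v"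
  proof (rule dderiv_greatest)
    fix y and r :: real assume r: "0 < r"
    have "dst (scale c v) (scale (c * r) (Log y)) = c * dst v (scale r (Log y))"
      using dst_scale[OF v, of "scale r (Log y)" c] c by (simp add: scale_scale)
    then have "dderiv (scale c v) \<le> c * (r * (h y - h x) + L * dst v (scale r (Log y)))"
      using dderiv_le[of "scale c v" "c * r" y] v c r by (simp add: closed algebra_simps)
    then show "dderiv (scale c v) / c \<le> r * (h y - h x) + L * dst v (scale r (Log y))"
      using c by (simp add: field_simps)
  qed
  then show "dderiv (scale c v) \<le> c * dderiv v" using c by (simp add: field_simps)
qed

text \<open>Each quotient is itself a term of the infimum, with factor 1 / e and vanishing distance,
  which gives the lower bound. For the upper bound a nearly optimal pair (z, q) is fixed: the
  Lipschitz bound compares the quotients towards y and z, and the rescaled distance converges to the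
  distance occurring in that term.\<close>

lemma tendsto_dderiv:
  assumes r: "0 < r"
  shows "((\<lambda>e. (h (toward y (e * r)) - h x) / e) \<longlongrightarrow> dderiv (scale r (Log y))) (at_right 0)"
proof (rule order_tendstoI)
  fix a assume a: "a < dderiv (scale r (Log y))"
  show "\<forall>\<^sub>F e in at_right 0. a < (h (toward y (e * r)) - h x) / e"
    using eventually_small[OF r]
  proof eventually_elim
    case (elim e)
    then have "dderiv (scale r (Log y)) \<le> 1 / e * (h (toward y (e * r)) - h x)"
      using dderiv_scale_Log_le[of "1 / e" "toward y (e * r)"] r by (simp add: scale_Log_toward)
    then show ?case using a by simp
  qed
next
  fix a assume "dderiv (scale r (Log y)) < a"
  from dderiv_less[OF scale_Log_closed this]
  obtain z q where q: "0 < q" and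
    less: "q * (h z - h x) + L * dst (scale r (Log y)) (scale q (Log z)) < a" by blast
  have "((\<lambda>e. q * (h z - h x) + L * (dist (toward y (e * r)) (toward z (e * q)) / e)) \<longlongrightarrow>
      q * (h z - h x) + L * dst (scale r (Log y)) (scale q (Log z))) (at_right 0)"
    by (intro tendsto_intros dst_toward_tendsto r q)
  from order_tendstoD(2)[OF this less]
  show "\<forall>\<^sub>F e in at_right 0. (h (toward y (e * r)) - h x) / e < a"
    using eventually_small[OF q]
  proof eventually_elim
    case (elim e)
    have "h (toward y (e * r)) - h (toward z (e * q)) \<le> L * dist (toward y (e * r)) (toward z (e * q))"
      using lipschitz[of "toward y (e * r)" "toward z (e * q)"] by (simp add: abs_le_iff)
    then have "(h (toward y (e * r)) - h x) / e \<le>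
        (h (toward z (e * q)) - h x + L * dist (toward y (e * r)) (toward z (e * q))) / e"
      using elim by (intro divide_right_mono) auto
    also have "\<dots> =
        (h (toward z (e * q)) - h x) / e + L * (dist (toward y (e * r)) (toward z (e * q)) / e)"
      by (simp add: add_divide_distrib)
    also have "(h (toward z (e * q)) - h x) / e \<le> q * (h z - h x)"
      using elim q by (intro toward_quotient_le) auto
    finally show ?case using elim(1) by simp
  qed
qed

lemma subgradient_of_le_dderiv:
  assumes "k \<in> tangent_cone x" "\<And>v. v \<in> tangent_cone x \<Longrightarrow> tangent_inner x k v \<le> dderiv v"
  shows "h x + tangent_inner x k (Log y) \<le> h y"
  using assms(2)[of "Log y"] dderiv_scale_Log_le[of 1 y] by (simp add: scale_one)

end

section \<open>Measurability and barycenters in the tangent cone\<close>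

text \<open>The two closure conditions are those demanded by \<open>riesz\<close>.\<close>

lemma (in hilbert_space_on) countable_half_closed:
  assumes "countable C" "C \<subseteq> V"
  obtains D where "countable D" "C \<subseteq> D" "D \<subseteq> V"
    and "\<And>v w. v \<in> D \<Longrightarrow> w \<in> D \<Longrightarrow> add v w \<in> D" "\<And>v. v \<in> D \<Longrightarrow> scale (-1/2) v \<in> D"
proof -
  define step where "step X = X \<union> (\<lambda>(v, w). add v w) ` (X \<times> X) \<union> scale (-1/2) ` X" for X
  define E where "E n = (step ^^ n) C" for n
  have E_Suc: "E (Suc n) = step (E n)" for n by (simp add: E_def)
  have E: "countable (E n) \<and> E n \<subseteq> V" for n
  proof (induction n)
    case 0
    then show ?case using assms by (simp add: E_def)
  next
    case (Suc n)
    then show ?case unfolding E_Suc step_def by (auto simp: closed subset_iff)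
  qed
  have mono: "E m \<subseteq> E n" if "m \<le> n" for m n
    by (rule lift_Suc_mono_le[OF _ that]) (auto simp: E_Suc step_def)
  show thesis
  proof (rule that[of "\<Union>n. E n"])
    show "countable (\<Union>n. E n)" using E by auto
    show "C \<subseteq> (\<Union>n. E n)" using UN_upper[of 0 UNIV E] by (simp add: E_def)
    show "(\<Union>n. E n) \<subseteq> V" using E by auto
    show "add v w \<in> (\<Union>n. E n)" if v: "v \<in> (\<Union>n. E n)" and w: "w \<in> (\<Union>n. E n)" for v w
    proof -
      obtain m n where "v \<in> E m" "w \<in> E n" using v w by auto
      then have "v \<in> E (max m n)" "w \<in> E (max m n)" using mono[of m "max m n"] mono[of n "max m n"] by auto
      then have "add v w \<in> E (Suc (max m n))" by (auto simp: E_Suc step_def)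
      then show ?thesis by blast
    qed
    show "scale (-1/2) v \<in> (\<Union>n. E n)" if v: "v \<in> (\<Union>n. E n)" for v
    proof -
      obtain n where "v \<in> E n" using v by auto
      then have "scale (-1/2) v \<in> E (Suc n)" by (auto simp: E_Suc step_def)
      then show ?thesis by blast
    qed
  qed
qed

lemma (in hilbert_hadamard_point) countable_dense_tangents:
  fixes C :: "'h set"
  assumes C: "countable C" and dense: "\<And>y e. 0 < e \<Longrightarrow> \<exists>c\<in>C. dist y c < e"
  obtains D where "countable D" "D \<subseteq> tangent_cone x" "D \<noteq> {}"
    and "\<And>v w. v \<in> D \<Longrightarrow> w \<in> D \<Longrightarrow> add v w \<in> D" "\<And>v. v \<in> D \<Longrightarrow> scale (-1/2) v \<in> D"
    and "\<And>v e. v \<in> tangent_cone x \<Longrightarrow> 0 < e \<Longrightarrow> \<exists>d\<in>D. dst v d < e"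
proof -
  define B where "B = (\<lambda>(q, y). scale q (Log y)) ` (\<rat> \<times> C)"
  have "countable B" "B \<subseteq> tangent_cone x" using C countable_rat by (auto simp: B_def)
  then obtain D where D: "countable D" "B \<subseteq> D" "D \<subseteq> tangent_cone x"
    "\<And>v w. v \<in> D \<Longrightarrow> w \<in> D \<Longrightarrow> add v w \<in> D" "\<And>v. v \<in> D \<Longrightarrow> scale (-1/2) v \<in> D"
    by (rule countable_half_closed) blast
  have D_dense: "\<exists>d\<in>D. dst v d < e" if v: "v \<in> tangent_cone x" and e: "0 < e" for v e
  proof -
    have "0 < e / 3" using e by simp
    from Log_dense[OF v this] obtain y r where r: "0 < r" "dst v (scale r (Log y)) < e / 3" by blast
    \<comment> \<open>The logarithm is nonexpansive and scaling multiplies distances by r.\<close>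
    have "0 < e / 3 / r" using e r by simp
    from dense[OF this, of y] obtain c where c: "c \<in> C" "dist y c < e / 3 / r" by blast
    \<comment> \<open>Changing the factor from r to q moves the vector by (q - r) times
      \<open>dist x c\<close>; the 1 in the denominator covers c = x.\<close>
    have "r < r + e / 3 / (dist x c + 1)" using e by (simp add: add_nonneg_pos)
    from Rats_dense_in_real[OF this] obtain q where q: "q \<in> \<rat>" "r < q" "q < r + e / 3 / (dist x c + 1)"
      by blast
    have "dst (scale r (Log y)) (scale r (Log c)) \<le> r * dist y c"
      using r dst_Log_le[of y c] by (simp add: dst_scale)
    also have "\<dots> < e / 3" using c r by (simp add: field_simps)
    finally have 1: "dst (scale r (Log y)) (scale r (Log c)) < e / 3" .
    have "dst (scale r (Log c)) (scale q (Log c)) = (q - r) * dist x c"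
      using q by (simp add: dst_scale_left nrm_Log)
    also have "\<dots> \<le> e / 3 / (dist x c + 1) * (dist x c + 1)"
      using q e by (intro mult_mono) auto
    also have "\<dots> = e / 3" 
    proof -
      have "dist x c + 1 > 0" by (simp add: add_nonneg_pos)
      then have "dist x c + 1 \<noteq> 0" by linarith
      then show ?thesis by (rule nonzero_eq_divide_eq[THEN iffD1]) (rule refl)
    qed
    finally have 2: "dst (scale r (Log c)) (scale q (Log c)) \<le> e / 3" .
    have "dst v (scale q (Log c)) \<le> dst v (scale r (Log y)) +
        (dst (scale r (Log y)) (scale r (Log c)) + dst (scale r (Log c)) (scale q (Log c)))"
      using dst_triangle[of v "scale r (Log y)" "scale q (Log c)"]
        dst_triangle[of "scale r (Log y)" "scale r (Log c)" "scale q (Log c)"] v by simp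
    then have "dst v (scale q (Log c)) < e" using r(2) 1 2 by simp
    moreover have "scale q (Log c) \<in> D" using c q D(2) by (auto simp: B_def)
    ultimately show ?thesis by blast
  qed
  moreover have "D \<noteq> {}" using D_dense[of None 1] zero_closed by auto
  ultimately show thesis using D by (intro that[of D]) auto
qed

section \<open>Weak measurability, integrability and barycenters\<close>

context hilbert_hadamard_point
begin

lemma open_sets_subset: "open_sets_on (tangent_cone x) (tangent_dist x) \<subseteq> Pow (tangent_cone x)"
  by (auto simp: open_sets_on_def)

lemma space_tangent_borel: "space (tangent_borel x) = tangent_cone x"
  unfolding tangent_borel_def by (rule space_measure_of[OF open_sets_subset])

lemma sets_tangent_borel_greater:
  assumes v: "v \<in> tangent_cone x"
  shows "{w \<in> tangent_cone x. a < tangent_inner x w v} \<in> sets (tangent_borel x)"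
proof -
  have "{w \<in> tangent_cone x. a < tangent_inner x w v} \<in> open_sets_on (tangent_cone x) (tangent_dist x)"
    unfolding open_sets_on_def
  proof (intro CollectI conjI ballI)
    fix w assume "w \<in> {w \<in> tangent_cone x. a < tangent_inner x w v}"
    then have w: "w \<in> tangent_cone x" "a < tangent_inner x w v" by auto
    let ?e = "(tangent_inner x w v - a) / (nrm v + 1)"
    have n: "0 < nrm v + 1" using v by (simp add: add_nonneg_pos)
    have "b \<in> {w \<in> tangent_cone x. a < tangent_inner x w v}"
      if b: "b \<in> tangent_cone x" "tangent_dist x w b < ?e" for b
    proof -
      have "tangent_inner x v w - tangent_inner x v b \<le> nrm v * dst w b"
        using ip_diff_le[OF v w(1) b(1)] by (simp add: abs_le_iff)
      also have "\<dots> \<le> (nrm v + 1) * dst w b" using w b by (simp add: mult_right_mono)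
      also have "\<dots> < (nrm v + 1) * ?e"
        using b w n by (intro mult_strict_left_mono) (simp_all add: dst_eq_tangent_dist)
      also have "\<dots> = tangent_inner x w v - a" using n by simp
      finally show ?thesis using b w v by (simp add: ip_commute[OF _ v])
    qed
    then show "\<exists>\<epsilon>>0. \<forall>b\<in>tangent_cone x. tangent_dist x w b < \<epsilon> \<longrightarrow>
        b \<in> {w \<in> tangent_cone x. a < tangent_inner x w v}"
      using w n by (intro exI[of _ ?e]) simp
  qed auto
  then show ?thesis unfolding tangent_borel_def using sets_measure_of[OF open_sets_subset] by auto
qed

lemma measurable_tangent_inner:
  assumes \<phi>: "\<phi> \<in> M \<rightarrow>\<^sub>M tangent_borel x" and v: "v \<in> tangent_cone x"
  shows "(\<lambda>t. tangent_inner x (\<phi> t) v) \<in> borel_measurable M"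
  unfolding borel_measurable_iff_greater
proof
  fix a
  have "{t \<in> space M. a < tangent_inner x (\<phi> t) v} =
      \<phi> -` {w \<in> tangent_cone x. a < tangent_inner x w v} \<inter> space M"
    using measurable_space[OF \<phi>] by (auto simp: space_tangent_borel)
  then show "{t \<in> space M. a < tangent_inner x (\<phi> t) v} \<in> sets M"
    using measurable_sets[OF \<phi> sets_tangent_borel_greater[OF v]] by simp
qed

lemma tangent_integrable_in: "tangent_integrable M x \<phi> \<Longrightarrow> t \<in> space M \<Longrightarrow> \<phi> t \<in> tangent_cone x"
  using measurable_space[of \<phi> M "tangent_borel x"] by (auto simp: tangent_integrable_def space_tangent_borel)

lemma tangent_integrable_nrm:
  assumes "tangent_integrable M x \<phi>" shows "integrable M (\<lambda>t. nrm (\<phi> t))"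
proof -
  have "integrable M (\<lambda>t. tangent_dist x (\<phi> t) None)" using assms by (simp add: tangent_integrable_def)
  moreover have "tangent_dist x (\<phi> t) None = nrm (\<phi> t)" if "t \<in> space M" for t
    using tangent_integrable_in[OF assms that] dst_eq_tangent_dist[of "\<phi> t" None] zero_closed by simp
  ultimately show ?thesis by (simp cong: Bochner_Integration.integrable_cong)
qed

lemma integrable_tangent_inner:
  assumes \<phi>: "tangent_integrable M x \<phi>" and v: "v \<in> tangent_cone x"
  shows "integrable M (\<lambda>t. tangent_inner x (\<phi> t) v)"
proof (rule Bochner_Integration.integrable_bound)
  show "integrable M (\<lambda>t. nrm (\<phi> t) * nrm v)" using tangent_integrable_nrm[OF \<phi>] by simp
  show "(\<lambda>t. tangent_inner x (\<phi> t) v) \<in> borel_measurable M"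
    using \<phi> v by (intro measurable_tangent_inner) (simp_all add: tangent_integrable_def)
  show "AE t in M. norm (tangent_inner x (\<phi> t) v) \<le> norm (nrm (\<phi> t) * nrm v)"
    using cauchy_schwarz[OF tangent_integrable_in[OF \<phi>] v]
    by (intro AE_I2) (auto intro: order_trans[OF _ abs_ge_self])
qed

text \<open>Weak measurability suffices by separability, as in Pettis' theorem: the norm is
  recovered from countably many inner products, so preimages of balls around points of D are
  measurable, and every open set is a countable union of such balls.\<close>

lemma tangent_integrableI:
  assumes \<phi>: "\<And>t. t \<in> space M \<Longrightarrow> \<phi> t \<in> tangent_cone x"
    and meas: "\<And>v. v \<in> tangent_cone x \<Longrightarrow> (\<lambda>t. tangent_inner x (\<phi> t) v) \<in> borel_measurable M"
    and L: "integrable M L" "\<And>t. t \<in> space M \<Longrightarrow> nrm (\<phi> t) \<le> L t"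
    and D: "countable D" "D \<subseteq> tangent_cone x"
    and dense: "\<And>v e. v \<in> tangent_cone x \<Longrightarrow> 0 < e \<Longrightarrow> \<exists>d\<in>D. dst v d < e"
  shows "tangent_integrable M x \<phi>"
proof -
  have DV: "d \<in> tangent_cone x" if "d \<in> D" for d using D that by auto
  have nrm2: "(\<lambda>t. (nrm (\<phi> t))\<^sup>2) \<in> borel_measurable M"
    unfolding borel_measurable_iff_greater
  proof
    fix a
    \<comment> \<open>The quantity 2 g(v,d) - |d|^2 equals |v|^2 - |v - d|^2; it never exceeds |v|^2
      and comes arbitrarily close for d in D.\<close>
    have "a < (nrm v)\<^sup>2 \<longleftrightarrow> (\<exists>d\<in>D. a < 2 * tangent_inner x v d - (nrm d)\<^sup>2)" if v: "v \<in> tangent_cone x" for v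
    proof
      assume a: "a < (nrm v)\<^sup>2"
      then have "0 < sqrt ((nrm v)\<^sup>2 - a)" by simp
      from dense[OF v this] obtain d where d: "d \<in> D" "dst v d < sqrt ((nrm v)\<^sup>2 - a)" by blast
      then have "(dst v d)\<^sup>2 < (nrm v)\<^sup>2 - a"
        using a power_strict_mono[OF d(2), of 2] v DV[OF d(1)] by simp
      then show "\<exists>d\<in>D. a < 2 * tangent_inner x v d - (nrm d)\<^sup>2"
        using d(1) v DV[OF d(1)] by (intro bexI[of _ d]) (simp_all add: dst_square nrm_square)
    next
      assume "\<exists>d\<in>D. a < 2 * tangent_inner x v d - (nrm d)\<^sup>2"
      then obtain d where d: "d \<in> D" "a < 2 * tangent_inner x v d - (nrm d)\<^sup>2" by blast
      have "0 \<le> (dst v d)\<^sup>2" by simp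
      then show "a < (nrm v)\<^sup>2" using d v DV[OF d(1)] by (simp add: dst_square nrm_square)
    qed
    then have "{t \<in> space M. a < (nrm (\<phi> t))\<^sup>2} =
        (\<Union>d\<in>D. {t \<in> space M. a < 2 * tangent_inner x (\<phi> t) d - (nrm d)\<^sup>2})"
      using \<phi> by auto
    also have "\<dots> \<in> sets M"
    proof (intro sets.countable_UN'' D(1))
      show "{t \<in> space M. a < 2 * tangent_inner x (\<phi> t) d - (nrm d)\<^sup>2} \<in> sets M" if "d \<in> D" for d
        using meas[OF DV[OF that]] by measurable
    qed
    finally show "{t \<in> space M. a < (nrm (\<phi> t))\<^sup>2} \<in> sets M" .
  qed
  have dst_meas: "{t \<in> space M. dst (\<phi> t) d < e} \<in> sets M" if d: "d \<in> D" and e: "0 < e" for d e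
  proof -
    have "dst (\<phi> t) d < e \<longleftrightarrow> (nrm (\<phi> t))\<^sup>2 - 2 * tangent_inner x (\<phi> t) d + (nrm d)\<^sup>2 < e\<^sup>2"
      if "t \<in> space M" for t
    proof -
      have "dst (\<phi> t) d < e \<longleftrightarrow> (dst (\<phi> t) d)\<^sup>2 < e\<^sup>2"
        using e dst_nonneg[OF \<phi>[OF that] DV[OF d]] power_mono_iff[of e "dst (\<phi> t) d" 2]
        by (simp add: not_le[symmetric])
      then show ?thesis using \<phi>[OF that] DV[OF d] by (simp add: dst_square nrm_square)
    qed
    then have "{t \<in> space M. dst (\<phi> t) d < e} =
        {t \<in> space M. (nrm (\<phi> t))\<^sup>2 - 2 * tangent_inner x (\<phi> t) d + (nrm d)\<^sup>2 < e\<^sup>2}"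
      by auto
    also have "\<dots> \<in> sets M" using nrm2 meas[OF DV[OF d]] by measurable
    finally show ?thesis .
  qed
  have "\<phi> \<in> M \<rightarrow>\<^sub>M tangent_borel x"
    unfolding tangent_borel_def
  proof (rule measurable_measure_of[OF open_sets_subset])
    show "\<phi> \<in> space M \<rightarrow> tangent_cone x" using \<phi> by auto
    fix U assume U: "U \<in> open_sets_on (tangent_cone x) (tangent_dist x)"
    \<comment> \<open>Indices of the balls with centre in D that lie inside U. A radius below half
      the distance allowed around \<phi> t leaves room for the centre to differ from \<phi>
      t.\<close>
    define I where "I = {(d, n). d \<in> D \<and> (\<forall>b\<in>tangent_cone x. dst d b < inverse (real (Suc n)) \<longrightarrow> b \<in> U)}"
    have "\<phi> -` U \<inter> space M = (\<Union>(d, n)\<in>I. {t \<in> space M. dst (\<phi> t) d < inverse (real (Suc n))})"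
    proof (intro set_eqI iffI)
      fix t assume "t \<in> \<phi> -` U \<inter> space M"
      then have t: "t \<in> space M" "\<phi> t \<in> U" by auto
      then obtain e where e: "e > 0" "\<And>b. b \<in> tangent_cone x \<Longrightarrow> tangent_dist x (\<phi> t) b < e \<Longrightarrow> b \<in> U"
        using U by (auto simp: open_sets_on_def)
      obtain n where n: "inverse (real (Suc n)) < e / 2" using reals_Archimedean[of "e / 2"] e by auto
      obtain d where d: "d \<in> D" "dst (\<phi> t) d < inverse (real (Suc n))"
        using dense[OF \<phi>[OF t(1)], of "inverse (real (Suc n))"] by auto
      have "b \<in> U" if b: "b \<in> tangent_cone x" "dst d b < inverse (real (Suc n))" for b
      proof (rule e(2)[OF b(1)])
        have "dst (\<phi> t) b \<le> dst (\<phi> t) d + dst d b" using \<phi>[OF t(1)] DV[OF d(1)] b(1) by (rule dst_triangle)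
        then show "tangent_dist x (\<phi> t) b < e"
          using d(2) b n dst_eq_tangent_dist[OF \<phi>[OF t(1)] b(1)] by linarith
      qed
      then show "t \<in> (\<Union>(d, n)\<in>I. {t \<in> space M. dst (\<phi> t) d < inverse (real (Suc n))})"
        using d t by (auto simp: I_def)
    next
      fix t assume "t \<in> (\<Union>(d, n)\<in>I. {t \<in> space M. dst (\<phi> t) d < inverse (real (Suc n))})"
      then obtain d n where "(d, n) \<in> I" "t \<in> space M" "dst (\<phi> t) d < inverse (real (Suc n))" by blast
      then show "t \<in> \<phi> -` U \<inter> space M"
        using \<phi>[of t] DV[of d] dst_commute[of d "\<phi> t"] by (simp add: I_def)
    qed
    moreover have "countable I"
      by (rule countable_subset[of _ "D \<times> UNIV"]) (use D in \<open>auto simp: I_def\<close>)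
    then have "(\<Union>(d, n)\<in>I. {t \<in> space M. dst (\<phi> t) d < inverse (real (Suc n))}) \<in> sets M"
      by (intro sets.countable_UN'') (auto simp: I_def intro!: dst_meas)
    ultimately show "\<phi> -` U \<inter> space M \<in> sets M" by simp
  qed
  moreover have "integrable M (\<lambda>t. tangent_dist x (\<phi> t) None)"
  proof (rule Bochner_Integration.integrable_bound[OF L(1)])
    have eq: "tangent_dist x (\<phi> t) None = nrm (\<phi> t)" if "t \<in> space M" for t
      using \<phi>[OF that] dst_eq_tangent_dist[of "\<phi> t" None] zero_closed by simp
    then have "tangent_dist x (\<phi> t) None = sqrt ((nrm (\<phi> t))\<^sup>2)" if "t \<in> space M" for t
      using that nrm_nonneg[OF \<phi>[OF that]] by simp
    moreover have "(\<lambda>t. sqrt ((nrm (\<phi> t))\<^sup>2)) \<in> borel_measurable M" using nrm2 by measurable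
    ultimately show "(\<lambda>t. tangent_dist x (\<phi> t) None) \<in> borel_measurable M"
      by (simp cong: measurable_cong)
    have "norm (tangent_dist x (\<phi> t) None) \<le> norm (L t)" if "t \<in> space M" for t
    proof -
      have "norm (tangent_dist x (\<phi> t) None) = nrm (\<phi> t)" using eq[OF that] nrm_nonneg[OF \<phi>[OF that]] by simp
      then show ?thesis using L(2)[OF that] by simp
    qed
    then show "AE t in M. norm (tangent_dist x (\<phi> t) None) \<le> norm (L t)" by (rule AE_I2)
  qed
  ultimately show ?thesis by (simp add: tangent_integrable_def)
qed

text \<open>Expanding the squares, the functional to be minimized is |z - k|^2 - |k|^2, so the weak
  integral k is its only minimizer.\<close>

lemma tangent_integral_eq:
  assumes M: "prob_space M" and \<phi>: "tangent_integrable M x \<phi>" and k: "k \<in> tangent_cone x"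
    and int: "\<And>v. v \<in> tangent_cone x \<Longrightarrow> (\<integral>t. tangent_inner x (\<phi> t) v \<partial>M) = tangent_inner x k v"
  shows "tangent_integral M x \<phi> = k"
proof -
  interpret prob_space M by (fact M)
  define J where "J z = (\<integral>t. ((tangent_dist x z (\<phi> t))\<^sup>2 - (tangent_dist x None (\<phi> t))\<^sup>2) \<partial>M)" for z
  have J: "J z = (dst z k)\<^sup>2 - (nrm k)\<^sup>2" if z: "z \<in> tangent_cone x" for z
  proof -
    have "J z = (\<integral>t. ((nrm z)\<^sup>2 - 2 * tangent_inner x (\<phi> t) z) \<partial>M)"
      unfolding J_def
    proof (rule Bochner_Integration.integral_cong[OF refl])
      fix t assume "t \<in> space M"
      then have "\<phi> t \<in> tangent_cone x" by (rule tangent_integrable_in[OF \<phi>])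
      then show "(tangent_dist x z (\<phi> t))\<^sup>2 - (tangent_dist x None (\<phi> t))\<^sup>2 =
          (nrm z)\<^sup>2 - 2 * tangent_inner x (\<phi> t) z"
        using z zero_closed
        by (simp add: dst_eq_tangent_dist[symmetric] dst_square nrm_square ip_commute[of "\<phi> t" z])
    qed
    also have "\<dots> = (nrm z)\<^sup>2 - 2 * tangent_inner x k z"
      using integrable_tangent_inner[OF \<phi> z] int[OF z] by (simp add: prob_space)
    also have "\<dots> = (dst z k)\<^sup>2 - (nrm k)\<^sup>2"
      using z k by (simp add: dst_square nrm_square ip_commute[of z k])
    finally show ?thesis .
  qed
  have "is_arg_min J (\<lambda>z. z \<in> tangent_cone x) z \<longleftrightarrow> z = k" for z
  proof
    assume z: "is_arg_min J (\<lambda>z. z \<in> tangent_cone x) z"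
    then have zV: "z \<in> tangent_cone x" and "\<not> J k < J z" using k by (auto simp: is_arg_min_def)
    moreover have "dst k k = 0" using dst_scale_left[OF k, of 1 1] k by (simp add: scale_one)
    ultimately have "(dst z k)\<^sup>2 \<le> 0" using J[OF zV] J[OF k] by simp
    then show "z = k" using dst_eq_zero[OF zV k] by simp
  next
    assume "z = k"
    moreover have "dst k k = 0" using dst_scale_left[OF k, of 1 1] k by (simp add: scale_one)
    then have "\<not> J y < J k" if "y \<in> tangent_cone x" for y using J[OF that] J[OF k] by simp
    ultimately show "is_arg_min J (\<lambda>z. z \<in> tangent_cone x) z" using k by (auto simp: is_arg_min_def)
  qed
  then show ?thesis unfolding tangent_integral_def J_def[symmetric] arg_min_on_def arg_min_def
    by (intro some_equality) auto
qed

text \<open>The functional v \<mapsto> \<integral> g(\<phi>(t),v) is bounded by \<integral> |\<phi>|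
  times the norm of v, so \<open>riesz\<close> yields a weak integral, which the previous lemma
  identifies with the barycenter.\<close>

lemma tangent_integral_props:
  assumes M: "prob_space M" and \<phi>: "tangent_integrable M x \<phi>"
  shows "tangent_integral M x \<phi> \<in> tangent_cone x"
    and "\<And>v. v \<in> tangent_cone x \<Longrightarrow>
      (\<integral>t. tangent_inner x (\<phi> t) v \<partial>M) = tangent_inner x (tangent_integral M x \<phi>) v"
proof -
  have "\<exists>k\<in>tangent_cone x. \<forall>v\<in>tangent_cone x. tangent_inner x k v = (\<integral>t. tangent_inner x (\<phi> t) v \<partial>M)"
  proof (rule riesz[where C = "\<integral>t. nrm (\<phi> t) \<partial>M"])
    fix v w assume vw: "v \<in> tangent_cone x" "w \<in> tangent_cone x"
    have "(\<integral>t. tangent_inner x (\<phi> t) (add v w) \<partial>M) =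
        (\<integral>t. tangent_inner x (\<phi> t) v + tangent_inner x (\<phi> t) w \<partial>M)"
      using vw tangent_integrable_in[OF \<phi>]
      by (intro Bochner_Integration.integral_cong) (auto simp: ip_simps)
    then show "(\<integral>t. tangent_inner x (\<phi> t) (add v w) \<partial>M) =
        (\<integral>t. tangent_inner x (\<phi> t) v \<partial>M) + (\<integral>t. tangent_inner x (\<phi> t) w \<partial>M)"
      using vw integrable_tangent_inner[OF \<phi>] by simp
  next
    fix v assume v: "v \<in> tangent_cone x"
    have "(\<integral>t. tangent_inner x (\<phi> t) v \<partial>M) \<le> (\<integral>t. nrm (\<phi> t) * nrm v \<partial>M)"
      using tangent_integrable_nrm[OF \<phi>] integrable_tangent_inner[OF \<phi> v] v
        tangent_integrable_in[OF \<phi>]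
      by (intro integral_mono) (auto intro: ip_le)
    then show "(\<integral>t. tangent_inner x (\<phi> t) v \<partial>M) \<le> (\<integral>t. nrm (\<phi> t) \<partial>M) * nrm v" by simp
  qed (use zero_closed closed in auto)
  then obtain k where k: "k \<in> tangent_cone x"
    "\<And>v. v \<in> tangent_cone x \<Longrightarrow> (\<integral>t. tangent_inner x (\<phi> t) v \<partial>M) = tangent_inner x k v" by metis
  have eq: "tangent_integral M x \<phi> = k" by (rule tangent_integral_eq[OF M \<phi> k])
  show "tangent_integral M x \<phi> \<in> tangent_cone x" using k eq by simp
  show "\<And>v. v \<in> tangent_cone x \<Longrightarrow>
      (\<integral>t. tangent_inner x (\<phi> t) v \<partial>M) = tangent_inner x (tangent_integral M x \<phi>) v"
    using k eq by simp
qed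

end

section \<open>Integral functionals\<close>

locale lipschitz_integrand = hilbert_hadamard_point x add scale + prob_space M
  for x :: "'h::polish_space" and add scale and M :: "'t measure" +
  fixes h :: "'t \<Rightarrow> 'h \<Rightarrow> real" and L :: "'t \<Rightarrow> real"
  assumes complete_M: "complete_measure M"
    and lipschitz: "t \<in> space M \<Longrightarrow> \<bar>h t y - h t z\<bar> \<le> L t * dist y z"
    and convex: "t \<in> space M \<Longrightarrow> geodesic l \<gamma> \<Longrightarrow> 0 \<le> s \<Longrightarrow> s \<le> 1 \<Longrightarrow>
      h t (\<gamma> (s * l)) \<le> (1 - s) * h t (\<gamma> 0) + s * h t (\<gamma> l)"
    and L_nonneg: "t \<in> space M \<Longrightarrow> 0 \<le> L t"
    and L_integrable: "integrable M L"
    and h_integrable: "integrable M (\<lambda>t. h t y)"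
begin

lemma lipschitz_convex: "t \<in> space M \<Longrightarrow> lipschitz_convex x add scale (h t) (L t)"
  by unfold_locales (auto intro: lipschitz convex L_nonneg)

definition p :: "'t \<Rightarrow> 'h tangent \<Rightarrow> real" where
  "p t = lipschitz_convex.dderiv x add scale (h t) (L t)"

lemma p_tendsto:
  assumes t: "t \<in> space M" and r: "0 < r"
  shows "(\<lambda>n. (h t (toward y (inverse (real (Suc n)) * r)) - h t x) / inverse (real (Suc n)))
    \<longlonglongrightarrow> p t (scale r (Log y))"
proof -
  have "filterlim (\<lambda>n. inverse (real (Suc n))) (at_right 0) sequentially"
    unfolding filterlim_at using LIMSEQ_inverse_real_of_nat by (auto intro!: always_eventually)
  from filterlim_compose[OF lipschitz_convex.tendsto_dderiv[OF lipschitz_convex[OF t] r] this]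
  show ?thesis by (simp add: p_def)
qed

text \<open>One sequence serves all t, since only the Lipschitz constant of p t depends on t. Hence
  measurability can be passed from rescaled logarithms to arbitrary v.\<close>

lemma p_approx:
  assumes v: "v \<in> tangent_cone x"
  obtains y r where "\<And>n. 0 < r n" "\<And>n. dst v (scale (r n) (Log (y n))) < inverse (real (Suc n))"
    and "\<And>t. t \<in> space M \<Longrightarrow> (\<lambda>n. p t (scale (r n) (Log (y n)))) \<longlonglongrightarrow> p t v"
proof -
  have "\<exists>y r. 0 < r \<and> dst v (scale r (Log y)) < inverse (real (Suc n))" for n
    using Log_dense[OF v] by simp
  then obtain y r where r: "\<And>n. 0 < r n" "\<And>n. dst v (scale (r n) (Log (y n))) < inverse (real (Suc n))"
    by metis
  have "(\<lambda>n. p t (scale (r n) (Log (y n)))) \<longlonglongrightarrow> p t v" if t: "t \<in> space M" for t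
  proof -
    interpret lc: lipschitz_convex x add scale "h t" "L t" by (rule lipschitz_convex[OF t])
    have "norm (p t (scale (r n) (Log (y n))) - p t v) \<le> L t * inverse (real (Suc n))" for n
    proof -
      let ?w = "scale (r n) (Log (y n))"
      have "\<bar>p t ?w - p t v\<bar> \<le> L t * dst v ?w"
        using lc.dderiv_lipschitz[OF v scale_Log_closed[of "r n" "y n"]]
          lc.dderiv_lipschitz[OF scale_Log_closed[of "r n" "y n"] v] v
        by (simp add: p_def abs_le_iff dst_commute[of _ v])
      also have "\<dots> \<le> L t * inverse (real (Suc n))"
        using r(2)[of n] L_nonneg[OF t] by (intro mult_left_mono) auto
      finally show ?thesis by simp
    qed
    moreover have "(\<lambda>n. L t * inverse (real (Suc n))) \<longlonglongrightarrow> 0"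
      using tendsto_mult_right_zero[OF LIMSEQ_inverse_real_of_nat] by simp
    ultimately have "(\<lambda>n. p t (scale (r n) (Log (y n))) - p t v) \<longlonglongrightarrow> 0"
      by (rule_tac Lim_null_comparison[rotated]) (auto intro: always_eventually)
    then show ?thesis by (simp add: LIM_zero_iff)
  qed
  then show thesis using r by (intro that[of r y])
qed

lemma p_measurable:
  assumes v: "v \<in> tangent_cone x" shows "(\<lambda>t. p t v) \<in> borel_measurable M"
proof -
  note [measurable] = borel_measurable_integrable[OF h_integrable]
  obtain y r where r: "\<And>n. 0 < r n" "\<And>n. dst v (scale (r n) (Log (y n))) < inverse (real (Suc n))"
    and lim: "\<And>t. t \<in> space M \<Longrightarrow> (\<lambda>n. p t (scale (r n) (Log (y n)))) \<longlonglongrightarrow> p t v"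
    by (rule p_approx[OF v], rule that)
  have "(\<lambda>t. p t (scale (r n) (Log (y n)))) \<in> borel_measurable M" for n
    by (rule borel_measurable_LIMSEQ_real[OF p_tendsto[OF _ r(1)]]) auto
  from borel_measurable_LIMSEQ_real[OF lim this] show ?thesis .
qed

sublocale P: sublinear_integrand "tangent_cone x" add None scale "tangent_inner x" M p L
proof
  fix t assume t: "t \<in> space M"
  interpret lc: lipschitz_convex x add scale "h t" "L t" by (rule lipschitz_convex[OF t])
  show "sublinear (p t)" unfolding p_def by (rule lc.sublinear_dderiv)
  show "p t v \<le> L t * nrm v" if "v \<in> tangent_cone x" for v
    unfolding p_def by (rule lc.dderiv_le_nrm[OF that])
qed (auto intro: p_measurable L_integrable)

text \<open>The subgradient inequality at a point close to x on the way to y is divided by e: its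
  left-hand side does not change, because the logarithm scales, and its right-hand side is an
  integral of difference quotients, dominated by L t times \<open>r * dist x y\<close>. Density of
  the rescaled logarithms then gives all v.\<close>

lemma subgradient_le_integral:
  assumes u: "u \<in> tangent_cone x"
    and sub: "\<And>y. (\<integral>t. h t x \<partial>M) + tangent_inner x u (Log y) \<le> (\<integral>t. h t y \<partial>M)"
    and v: "v \<in> tangent_cone x"
  shows "tangent_inner x u v \<le> (\<integral>t. p t v \<partial>M)"
proof -
  define e where "e n = inverse (real (Suc n))" for n
  have e: "0 < e n" for n by (simp add: e_def)
  have e0: "e \<longlonglongrightarrow> 0" unfolding e_def[abs_def] by (rule LIMSEQ_inverse_real_of_nat)
  have Log_case: "tangent_inner x u (scale r (Log y)) \<le> (\<integral>t. p t (scale r (Log y)) \<partial>M)" if r: "0 < r" for r y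
  proof -
    have ev: "\<forall>\<^sub>F n in sequentially. e n * r \<le> 1"
    proof -
      have "\<forall>\<^sub>F n in sequentially. e n < 1 / r" using e0 r by (intro order_tendstoD) auto
      then show ?thesis by eventually_elim (use r in \<open>simp add: field_simps\<close>)
    qed
    \<comment> \<open>\<open>toward\<close> is meaningful only for parameters at most 1, so the
      sequence is started at N.\<close>
    then obtain N where N: "\<And>n. n \<ge> N \<Longrightarrow> e n * r \<le> 1" by (auto simp: eventually_sequentially)
    define q where "q n t = (h t (toward y (e (n + N) * r)) - h t x) / e (n + N)" for n t
    have q_int: "integrable M (q n)" for n
      unfolding q_def using h_integrable by (intro Bochner_Integration.integrable_divide Bochner_Integration.integrable_diff)
    have "(\<lambda>n. \<integral>t. q n t \<partial>M) \<longlonglongrightarrow> (\<integral>t. p t (scale r (Log y)) \<partial>M)"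
    proof (rule integral_dominated_convergence[where w="\<lambda>t. L t * (r * dist x y)"])
      show "AE t in M. (\<lambda>n. q n t) \<longlonglongrightarrow> p t (scale r (Log y))"
        using LIMSEQ_ignore_initial_segment[OF p_tendsto[OF _ r], of _ y N]
        by (intro AE_I2) (simp add: q_def e_def)
      have "\<bar>q n t\<bar> \<le> L t * (r * dist x y)" if t: "t \<in> space M" for n t
      proof -
        have "\<bar>h t (toward y (e (n + N) * r)) - h t x\<bar> \<le> L t * dist (toward y (e (n + N) * r)) x"
          by (rule lipschitz[OF t])
        also have "\<dots> = L t * (r * dist x y) * e (n + N)"
          using dist_toward[of "e (n + N) * r" y] N[of "n + N"] e[of "n + N"] r
          by (simp add: dist_commute)
        finally show ?thesis using e[of "n + N"] by (simp add: q_def field_simps)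
      qed
      then show "AE t in M. norm (q n t) \<le> L t * (r * dist x y)" for n by (intro AE_I2) simp
      show "(\<lambda>t. p t (scale r (Log y))) \<in> borel_measurable M" by (rule p_measurable) simp
      show "q n \<in> borel_measurable M" for n using q_int by auto
      show "integrable M (\<lambda>t. L t * (r * dist x y))" using L_integrable by simp
    qed
    moreover have "tangent_inner x u (scale r (Log y)) \<le> (\<integral>t. q n t \<partial>M)" for n
    proof -
      let ?y = "toward y (e (n + N) * r)"
      have "tangent_inner x u (scale r (Log y)) = tangent_inner x u (Log ?y) / e (n + N)"
        using scale_Log_toward[OF e r N, of "n + N" y] u ip_scale_right[of "Log ?y" u "1 / e (n + N)"]
        by simp
      also have "\<dots> \<le> ((\<integral>t. h t ?y \<partial>M) - (\<integral>t. h t x \<partial>M)) / e (n + N)"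
        using sub[of ?y] e[of "n + N"] by (intro divide_right_mono) auto
      also have "\<dots> = (\<integral>t. q n t \<partial>M)" unfolding q_def using h_integrable by simp
      finally show ?thesis .
    qed
    ultimately show ?thesis by (intro LIMSEQ_le_const) auto
  qed
  obtain y r where r: "\<And>n. 0 < r n" "\<And>n. dst v (scale (r n) (Log (y n))) < e n"
    and "\<And>t. t \<in> space M \<Longrightarrow> (\<lambda>n. p t (scale (r n) (Log (y n)))) \<longlonglongrightarrow> p t v"
    by (rule p_approx[OF v], rule that) (simp_all add: e_def)
  let ?w = "\<lambda>n. scale (r n) (Log (y n))"
  \<comment> \<open>Both sides of the claim are Lipschitz in v, with constants \<open>nrm u\<close>
    and \<integral> L.\<close>
  have "tangent_inner x u v \<le> (\<integral>t. p t v \<partial>M) + ((\<integral>t. L t \<partial>M) + nrm u) * e n" for n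
  proof -
    have "(\<integral>t. p t (?w n) \<partial>M) \<le> (\<integral>t. p t v + L t * dst v (?w n) \<partial>M)"
    proof (intro integral_mono)
      show "p t (?w n) \<le> p t v + L t * dst v (?w n)" if "t \<in> space M" for t
        using lipschitz_convex.dderiv_lipschitz[OF lipschitz_convex[OF that] scale_Log_closed v, of "r n" "y n"]
        by (simp add: p_def dst_commute[OF v])
    qed (use P.p_integrable v L_integrable in auto)
    also have "\<dots> = (\<integral>t. p t v \<partial>M) + (\<integral>t. L t \<partial>M) * dst v (?w n)"
      using P.p_integrable[OF v] L_integrable by simp
    finally have "tangent_inner x u (?w n) \<le> (\<integral>t. p t v \<partial>M) + (\<integral>t. L t \<partial>M) * dst v (?w n)"
      using Log_case[OF r(1), of n "y n"] by simp
    moreover have "tangent_inner x u v \<le> tangent_inner x u (?w n) + nrm u * dst v (?w n)"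
      using ip_diff_le[OF u v, of "?w n"] by (simp add: abs_le_iff)
    ultimately have "tangent_inner x u v \<le> (\<integral>t. p t v \<partial>M) + ((\<integral>t. L t \<partial>M) + nrm u) * dst v (?w n)"
      by (simp add: algebra_simps)
    also have "((\<integral>t. L t \<partial>M) + nrm u) * dst v (?w n) \<le> ((\<integral>t. L t \<partial>M) + nrm u) * e n"
      using r(2)[of n] u L_nonneg by (intro mult_left_mono add_nonneg_nonneg Bochner_Integration.integral_nonneg) auto
    finally show ?thesis by simp
  qed
  moreover have "(\<lambda>n. (\<integral>t. p t v \<partial>M) + ((\<integral>t. L t \<partial>M) + nrm u) * e n) \<longlonglongrightarrow>
      (\<integral>t. p t v \<partial>M) + ((\<integral>t. L t \<partial>M) + nrm u) * 0"
    by (intro tendsto_intros e0)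
  ultimately have "tangent_inner x u v \<le> (\<integral>t. p t v \<partial>M) + ((\<integral>t. L t \<partial>M) + nrm u) * 0"
    by (intro LIMSEQ_le_const) auto
  then show ?thesis by simp
qed

theorem aumann_integral_subgradients:
  "aumann_integral M x (\<lambda>t. {u \<in> tangent_cone x. \<forall>y. h t x + tangent_inner x u (Log y) \<le> h t y}) =
    {u \<in> tangent_cone x. \<forall>y. (\<integral>t. h t x \<partial>M) + tangent_inner x u (Log y) \<le> (\<integral>t. h t y \<partial>M)}"
    (is "aumann_integral M x ?S = ?R")
proof (intro set_eqI iffI)
  fix u assume "u \<in> aumann_integral M x ?S"
  then obtain \<phi> where u: "u = tangent_integral M x \<phi>" and \<phi>: "tangent_integrable M x \<phi>"
    and S: "\<And>t. t \<in> space M \<Longrightarrow> \<phi> t \<in> ?S t"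
    by (auto simp: aumann_integral_def)
  note props = tangent_integral_props[OF prob_space_axioms \<phi>]
  have "(\<integral>t. h t x \<partial>M) + tangent_inner x u (Log y) \<le> (\<integral>t. h t y \<partial>M)" for y
  proof -
    have "(\<integral>t. h t x \<partial>M) + tangent_inner x u (Log y) =
        (\<integral>t. h t x + tangent_inner x (\<phi> t) (Log y) \<partial>M)"
      using h_integrable integrable_tangent_inner[OF \<phi>, of "Log y"] props(2)[of "Log y"] by (simp add: u)
    also have "\<dots> \<le> (\<integral>t. h t y \<partial>M)"
      using h_integrable integrable_tangent_inner[OF \<phi>, of "Log y"] S by (intro integral_mono) auto
    finally show ?thesis .
  qed
  then show "u \<in> ?R" using props(1) u by simp
next
  fix u assume "u \<in> ?R"
  then have u: "u \<in> tangent_cone x"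
    and sub: "\<And>y. (\<integral>t. h t x \<partial>M) + tangent_inner x u (Log y) \<le> (\<integral>t. h t y \<partial>M)" by auto
  obtain C :: "'h set" where C: "countable C" "\<And>X. open X \<Longrightarrow> X \<noteq> {} \<Longrightarrow> \<exists>c\<in>C. c \<in> X"
    using countable_dense_exists by metis
  have "\<exists>c\<in>C. dist y c < e" if "0 < e" for y :: 'h and e
    using C(2)[of "ball y e"] that by auto
  from countable_dense_tangents[OF C(1) this] obtain D where D: "countable D" "D \<subseteq> tangent_cone x" "D \<noteq> {}"
    "\<And>v w. v \<in> D \<Longrightarrow> w \<in> D \<Longrightarrow> add v w \<in> D" "\<And>v. v \<in> D \<Longrightarrow> scale (-1/2) v \<in> D"
    "\<And>v e. v \<in> tangent_cone x \<Longrightarrow> 0 < e \<Longrightarrow> \<exists>d\<in>D. dst v d < e" by blast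
  obtain \<phi> where \<phi>: "\<And>t. t \<in> space M \<Longrightarrow> \<phi> t \<in> tangent_cone x"
    and \<phi>_le: "\<And>t v. t \<in> space M \<Longrightarrow> v \<in> tangent_cone x \<Longrightarrow> tangent_inner x (\<phi> t) v \<le> p t v"
    and \<phi>_meas: "\<And>v. v \<in> tangent_cone x \<Longrightarrow> (\<lambda>t. tangent_inner x (\<phi> t) v) \<in> borel_measurable M"
    and \<phi>_int: "\<And>v. v \<in> tangent_cone x \<Longrightarrow> (\<integral>t. tangent_inner x (\<phi> t) v \<partial>M) = tangent_inner x u v"
    using P.strassen[OF complete_M D u subgradient_le_integral[OF u sub]] by blast
  \<comment> \<open>Testing with v = \<phi> t gives |\<phi> t|^2 <= p t (\<phi> t) <= L t |\<phi>
    t|.\<close>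
  have nrm_le: "nrm (\<phi> t) \<le> L t" if t: "t \<in> space M" for t
  proof (cases "nrm (\<phi> t) = 0")
    case True
    then show ?thesis using L_nonneg[OF t] by simp
  next
    case False
    then have "nrm (\<phi> t) > 0" using nrm_nonneg[OF \<phi>[OF t]] by simp
    moreover have "nrm (\<phi> t) * nrm (\<phi> t) \<le> L t * nrm (\<phi> t)"
      using \<phi>_le[OF t \<phi>[OF t]] P.p_le[OF t \<phi>[OF t]] nrm_square[OF \<phi>[OF t]]
      by (simp add: power2_eq_square)
    ultimately show ?thesis by simp
  qed
  have "tangent_integrable M x \<phi>"
    by (rule tangent_integrableI[OF \<phi> \<phi>_meas L_integrable nrm_le D(1,2,6)])
  moreover from tangent_integral_eq[OF prob_space_axioms this u \<phi>_int] have "u = tangent_integral M x \<phi>" by simp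
  moreover have "\<phi> t \<in> ?S t" if t: "t \<in> space M" for t
    using \<phi>[OF t] lipschitz_convex.subgradient_of_le_dderiv[OF lipschitz_convex[OF t] \<phi>[OF t]]
      \<phi>_le[OF t] by (simp add: p_def)
  ultimately show "u \<in> aumann_integral M x ?S" unfolding aumann_integral_def by blast
qed

end

section \<open>From extended real to real integrands\<close>

lemma ereal_integral_eq:
  assumes "integrable M g" "\<And>t. t \<in> space M \<Longrightarrow> \<phi> t = ereal (g t)"
  shows "ereal_integral M \<phi> = ereal (\<integral>t. g t \<partial>M)"
proof -
  have "(\<integral>\<^sup>+ t. e2ennreal (\<phi> t) \<partial>M) = (\<integral>\<^sup>+ t. ennreal (g t) \<partial>M)"
    "(\<integral>\<^sup>+ t. e2ennreal (- \<phi> t) \<partial>M) = (\<integral>\<^sup>+ t. ennreal (- g t) \<partial>M)"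
    using assms(2) by (auto intro!: nn_integral_cong simp: ennreal.rep_eq e2ennreal_ereal)
  moreover obtain a where a: "0 \<le> a" "(\<integral>\<^sup>+ t. ennreal (g t) \<partial>M) = ennreal a"
    using assms(1) unfolding real_integrable_def by (cases "\<integral>\<^sup>+ t. ennreal (g t) \<partial>M") auto
  moreover obtain b where b: "0 \<le> b" "(\<integral>\<^sup>+ t. ennreal (- g t) \<partial>M) = ennreal b"
    using assms(1) unfolding real_integrable_def by (cases "\<integral>\<^sup>+ t. ennreal (- g t) \<partial>M") auto
  ultimately show ?thesis
    unfolding ereal_integral_def real_lebesgue_integral_def[OF assms(1)] by (simp add: enn2ereal_ennreal)
qed

lemma (in prob_space) L2_maps_integrable:
  assumes "u \<in> L2_maps M"
  shows "integrable M (\<lambda>t. (dist (u t) y)\<^sup>2)" and "integrable M (\<lambda>t. dist (u t) y)"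
proof -
  obtain z where u [measurable]: "u \<in> borel_measurable M" and z: "integrable M (\<lambda>t. (dist (u t) z)\<^sup>2)"
    using assms by (auto simp: L2_maps_def)
  have [measurable]: "(\<lambda>t. dist (u t) y) \<in> borel_measurable M"
    by (rule measurable_compose[OF u borel_measurable_continuous_onI]) (intro continuous_intros)
  show sq: "integrable M (\<lambda>t. (dist (u t) y)\<^sup>2)"
  proof (rule Bochner_Integration.integrable_bound)
    show "integrable M (\<lambda>t. 2 * (dist (u t) z)\<^sup>2 + 2 * (dist z y)\<^sup>2)" using z by simp
    have "(dist (u t) y)\<^sup>2 \<le> 2 * (dist (u t) z)\<^sup>2 + 2 * (dist z y)\<^sup>2" for t
    proof -
      have "(dist (u t) y)\<^sup>2 \<le> (dist (u t) z + dist z y)\<^sup>2" by (intro power_mono dist_triangle) simp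
      also have "\<dots> \<le> 2 * (dist (u t) z)\<^sup>2 + 2 * (dist z y)\<^sup>2"
        using zero_le_power2[of "dist (u t) z - dist z y"] unfolding power2_sum power2_diff by linarith
      finally show ?thesis .
    qed
    then show "AE t in M. norm ((dist (u t) y)\<^sup>2) \<le> norm (2 * (dist (u t) z)\<^sup>2 + 2 * (dist z y)\<^sup>2)"
      by (intro AE_I2) (auto intro: order_trans)
  qed measurable
  show "integrable M (\<lambda>t. dist (u t) y)"
  proof (rule Bochner_Integration.integrable_bound)
    show "integrable M (\<lambda>t. (dist (u t) y)\<^sup>2 + 1)" using sq by simp
    have "dist (u t) y \<le> (dist (u t) y)\<^sup>2 + 1" for t
      using zero_le_power2[of "dist (u t) y - 1"] unfolding power2_diff
      by (simp add: power2_eq_square[of "dist (u t) y"]) (smt (verit) zero_le_dist)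
    then show "AE t in M. norm (dist (u t) y) \<le> norm ((dist (u t) y)\<^sup>2 + 1)"
      by (intro AE_I2) (auto intro: order_trans)
  qed measurable
qed

theorem theorem6p15:
  fixes M :: "'t measure"
    and f :: "'t \<Rightarrow> 'h::polish_space \<Rightarrow> ereal"
    and x :: 'h
  assumes "full_hilbert_hadamard_space TYPE('h)"
    and "prob_space M" and "complete_measure M" and "separable_measure M"
    and "normal_convex_integrand M f"
    and "\<forall>t\<in>space M. proper_fun (f t)"
    and "L2_Lipschitz M f"
    and "\<exists>u\<^sub>0\<in>L2_maps M. L1_ereal M (\<lambda>t. f t (u\<^sub>0 t))"
  shows "aumann_integral M x (\<lambda>t. subdifferential (f t) x) =
    subdifferential (\<lambda>y. ereal_integral M (\<lambda>t. f t y)) x"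
proof -
  interpret prob_space M by fact
  have hadamard: "hadamard_space TYPE('h)" and iso: "isometric_to_hilbert (tangent_cone x) (tangent_dist x)"
    using assms(1) by (auto simp: full_hilbert_hadamard_space_def)
  interpret hadamard_point x by unfold_locales (fact hadamard)
  obtain add scale where "hilbert_space_on (tangent_cone x) add None scale (tangent_inner x)"
    using hilbert_tangent_cone[OF iso] .
  then interpret hilbert_hadamard_point x add scale
    by (intro hilbert_hadamard_point.intro hadamard_point_axioms)
  obtain L :: "'t \<Rightarrow> real" where L: "L \<in> L2_maps M" and L_pos: "\<And>t. t \<in> space M \<Longrightarrow> 0 < L t"
    and L_lip: "\<And>t y z. t \<in> space M \<Longrightarrow> \<bar>f t y - f t z\<bar> \<le> ereal (L t * dist y z)"
    using assms(7) by (auto simp: L2_Lipschitz_def)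
  obtain u\<^sub>0 where u\<^sub>0: "u\<^sub>0 \<in> L2_maps M" "L1_ereal M (\<lambda>t. f t (u\<^sub>0 t))" using assms(8) by blast
  define h where "h t y = real_of_ereal (f t y)" for t y
  \<comment> \<open>The Lipschitz bound against a point z where f t is finite excludes the value
    infinity.\<close>
  have f: "f t y = ereal (h t y)" if t: "t \<in> space M" for t y
  proof -
    obtain z where z: "f t z \<noteq> \<infinity>" "f t z \<noteq> -\<infinity>" and y: "f t y \<noteq> -\<infinity>"
      using assms(6) t by (auto simp: proper_fun_def)
    moreover have "f t y \<noteq> \<infinity>"
      using L_lip[OF t, of y z] z by (cases "f t z") auto
    ultimately show ?thesis by (cases "f t y") (simp_all add: h_def)
  qed
  have lip: "\<bar>h t y - h t z\<bar> \<le> L t * dist y z" if "t \<in> space M" for t y z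
    using L_lip[OF that, of y z] by (simp add: f[OF that])
  have h_meas [measurable]: "(\<lambda>t. h t y) \<in> borel_measurable M" for y
    unfolding borel_measurable_iff_le
  proof
    fix a :: real
    \<comment> \<open>The epigraph of f t meets the closed set \<open>{y} \<times> {..a}\<close>
      exactly when f t y <= a, so measurability for fixed y comes directly from the epigraph
      map.\<close>
    have "closed ({y} \<times> {..a})" by (intro closed_Times) auto
    then have "{t \<in> space M. {(z, \<alpha>). f t z \<le> ereal \<alpha>} \<inter> ({y} \<times> {..a}) \<noteq> {}} \<in> sets M"
      using assms(5) by (auto simp: normal_convex_integrand_def normal_integrand_def)
    also have "{t \<in> space M. {(z, \<alpha>). f t z \<le> ereal \<alpha>} \<inter> ({y} \<times> {..a}) \<noteq> {}} = {t \<in> space M. h t y \<le> a}"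
      by (auto simp: f simp flip: ex_in_conv)
    finally show "{t \<in> space M. h t y \<le> a} \<in> sets M" .
  qed
  \<comment> \<open>The value at y is compared with the one at \<open>u\<^sub>0 t\<close>; the
    Lipschitz error, a product of two square integrable functions, is bounded by the sum of their
    squares.\<close>
  have h_int: "integrable M (\<lambda>t. h t y)" for y
  proof (rule Bochner_Integration.integrable_bound)
    have "integrable M (\<lambda>t. h t (u\<^sub>0 t))" unfolding h_def using u\<^sub>0(2) by (simp add: L1_ereal_def)
    then show "integrable M (\<lambda>t. \<bar>h t (u\<^sub>0 t)\<bar> + ((L t)\<^sup>2 + (dist (u\<^sub>0 t) y)\<^sup>2))"
      using L2_maps_integrable(1)[OF L, of 0] L2_maps_integrable(1)[OF u\<^sub>0(1), of y] by simp
    have "\<bar>h t y\<bar> \<le> \<bar>h t (u\<^sub>0 t)\<bar> + ((L t)\<^sup>2 + (dist (u\<^sub>0 t) y)\<^sup>2)" if "t \<in> space M" for t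
    proof -
      have "L t * dist (u\<^sub>0 t) y \<le> (L t)\<^sup>2 + (dist (u\<^sub>0 t) y)\<^sup>2"
        using sum_squares_bound[of "L t" "dist (u\<^sub>0 t) y"]
          mult_nonneg_nonneg[OF less_imp_le[OF L_pos[OF that]] zero_le_dist[of "u\<^sub>0 t" y]]
        unfolding mult.assoc by linarith
      then show ?thesis using lip[OF that, of "u\<^sub>0 t" y] by linarith
    qed
    then show "AE t in M. norm (h t y) \<le> norm (\<bar>h t (u\<^sub>0 t)\<bar> + ((L t)\<^sup>2 + (dist (u\<^sub>0 t) y)\<^sup>2))"
      by (intro AE_I2) (auto intro: order_trans[OF _ abs_ge_self])
  qed simp
  interpret I: lipschitz_integrand x add scale M h L
  proof (intro lipschitz_integrand.intro lipschitz_integrand_axioms.intro)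
    show "hilbert_hadamard_point x add scale" by unfold_locales
    show "prob_space M" by unfold_locales
    show "complete_measure M" by fact
    show "\<bar>h t y - h t z\<bar> \<le> L t * dist y z" if "t \<in> space M" for t y z by (rule lip[OF that])
    show "h t (\<gamma> (s * l)) \<le> (1 - s) * h t (\<gamma> 0) + s * h t (\<gamma> l)"
      if "t \<in> space M" "geodesic l \<gamma>" "0 \<le> s" "s \<le> 1" for t l \<gamma> s
    proof -
      have "f t (\<gamma> (s * l)) \<le> ereal (1 - s) * f t (\<gamma> 0) + ereal s * f t (\<gamma> l)"
        using assms(5) that unfolding normal_convex_integrand_def convex_along_geodesics_def by blast
      then show ?thesis by (simp add: f[OF that(1)])
    qed
    show "0 \<le> L t" if "t \<in> space M" for t using L_pos[OF that] by simp
    have "integrable M (\<lambda>t. dist (L t) 0)" by (rule L2_maps_integrable(2)[OF L])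
    then show "integrable M L"
      by (rule Bochner_Integration.integrable_cong[THEN iffD1, OF refl, rotated])
        (use L_pos in \<open>simp add: less_imp_le\<close>)
    show "integrable M (\<lambda>t. h t y)" for y by (rule h_int)
  qed
  have "subdifferential (f t) x =
      {u \<in> tangent_cone x. \<forall>y. h t x + tangent_inner x u (log_map x y) \<le> h t y}"
    if "t \<in> space M" for t
    by (simp add: subdifferential_def f[OF that])
  then have "aumann_integral M x (\<lambda>t. subdifferential (f t) x) =
      aumann_integral M x (\<lambda>t. {u \<in> tangent_cone x. \<forall>y. h t x + tangent_inner x u (log_map x y) \<le> h t y})"
    unfolding aumann_integral_def by simp
  also have "\<dots> = subdifferential (\<lambda>y. ereal_integral M (\<lambda>t. f t y)) x"
    unfolding I.aumann_integral_subgradients subdifferential_def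
    using ereal_integral_eq[OF h_int f] by simp
  finally show ?thesis .
qed

end
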